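(* Let $n\ge1$, $\hbar>0$ and $p\in\mathbb{C}^n$. The family of Wick star products $$f\star^\alpha_{\mathrm{Wick}}g=\sum_{N=0}^\infty\frac{(2\alpha)^{|N|}}{N!}\frac{\partial^{|N|}f}{\partial z^N}\frac{\partial^{|N|}g}{\partial\overline{z}^N},\qquad \alpha\in\mathbb{C},\ f,g\in\mathcal{A}_{p,\hbar},$$ is a holomorphic deformation (over $\mathbb{C}$, with base point $0$) of the pointwise product of $\mathcal{A}_{p,\hbar}$.
   Context: Conventions: $\mathbb{N}=\{0,1,2,\dots\}$; $z=(z^1,\dots,z^n)$ are the standard holomorphic coordinates on $\mathbb{C}^n$; multiindex notation is the usual componentwise one; $\sum_{N=0}^\infty$ means summation over $N\in\mathbb{N}^n$ and $\sum_{I=0}^R$ summation over $I\in\mathbb{N}^n$ with $I\le R$. Holomorphic deformation: let $\mathcal{A}$ be a Fréchet algebra with product $\cdot$, and let $\mathcal{O}(\mathbb{C},\mathcal{A})\cong\mathcal{O}(\mathbb{C})\,\widehat{\otimes}\,\mathcal{A}$ be the Fréchet space of entire $\mathcal{A}$-valued functions with the topology of uniform convergence on compact subsets of $\mathbb{C}$. A family of bilinear products $(\star^\alpha)_{\alpha\in\mathbb{C}}$ on $\mathcal{A}$ is a holomorphic deformation of $\cdot$ (over $\mathbb{C}$, with base point $0$) if $(F\star G)(\alpha)=F(\alpha)\star^\alpha G(\alpha)$ defines a continuous associative $\mathcal{O}(\mathbb{C})$-bilinear product on $\mathcal{O}(\mathbb{C},\mathcal{A})$ and $\star^0$ is the original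 product $\cdot$. For $f\in C^\infty(\mathbb{C}^n)$, $m\in\mathbb{N}$, $\ell\in\{0,\dots,2^m-1\}$, $R,S\in\mathbb{N}^n$ define recursively, with values in $[0,+\infty]$, $$h^{p,\hbar}_{0,0,R,S}(f)=\sum_{N=0}^\infty\frac{(2\hbar)^{|R|+|S|+|N|}}{N!}\left|\frac{\partial^{|R|+|S|+|N|}f}{\partial z^R\partial\overline{z}^{N+S}}(p)\right|^2,$$ and for $m\ge1$ $$h^{p,\hbar}_{m,\ell,R,S}(f)=\sum_{N=0}^\infty\frac1{N!}\Big(\sum_{I=0}^R\sum_{J=0}^{N+S}\tbinom{R}{I}\tbinom{N+S}{J}h^{p,\hbar}_{m-1,\ell/2,I,J}(f)\Big)^2\quad(\ell\text{ even}),$$ $$h^{p,\hbar}_{m,\ell,R,S}(f)=\sum_{N=0}^\infty\frac1{N!}\Big(\sum_{I=0}^R\sum_{J=0}^{N+S}\tbinom{R}{I}\tbinom{N+S}{J}h^{p,\hbar}_{m-1,(\ell-1)/2,J,I}(f)\Big)^2\quad(\ell\text{ odd}).$$ Put $\|f\|^{p,\hbar}_{m,\ell,R,S}=\big(h^{p,\hbar}_{m,\ell,R,S}(f)\big)^{1/2^{m+1}}$ and $\widetilde{\mathcal{A}}_{p,\hbar}=\{f\in C^\infty(\mathbb{C}^n)\mid \|f\|^{p,\hbar}_{m,\ell,R,S}<\infty\text{ for all }m,\ell,R,S\}$, a vector space on which these are seminorms. Define $\mathcal{A}_{p,\hbar}=\widetilde{\mathcal{A}}_{p,\hbar}/\{f\in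 C^\infty(\mathbb{C}^n)\mid \mathsf{j}^\infty_pf=0\}$ (quotient by the functions with vanishing $\infty$-jet at $p$), with the topology induced by all the seminorms; it is a Fréchet space, and a Fréchet algebra for the pointwise product. Every class has a unique real-analytic representative, so $\mathcal{A}_{p,\hbar}$ is identified with a subspace of $C^\omega(\mathbb{C}^n)$. *)

theory Defs
  imports "HOL-Analysis.Analysis" "HOL-Algebra.Module"
begin

section \<open>Frechet algebras and their holomorphic deformations\<close>

definition complex_ring :: "complex ring" where
  "complex_ring = \<lparr>carrier = UNIV, mult = (*), one = 1, zero = 0, add = (+)\<rparr>"

text \<open>
  A complex vector space is a HOL-Algebra module over \<^const>\<open>complex_ring\<close>; it is equipped with a
  family of seminorms \<open>q i\<close>, where \<open>i\<close> ranges over an index set \<open>I\<close>. The fields \<open>mult\<close> and \<open>one\<close>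
  of the module record play no role as long as only the vector space is concerned.
\<close>

locale seminormed_space = module complex_ring M for M (structure) +
  fixes I :: "'i set" and q :: "'i \<Rightarrow> 'a \<Rightarrow> real"
  assumes seminorm_smult: "\<lbrakk>i \<in> I; x \<in> carrier M\<rbrakk> \<Longrightarrow> q i (c \<odot> x) = norm c * q i x"
    and seminorm_add: "\<lbrakk>i \<in> I; x \<in> carrier M; y \<in> carrier M\<rbrakk> \<Longrightarrow> q i (x \<oplus> y) \<le> q i x + q i y"

text \<open>The locally convex topology defined by a family of seminorms.\<close>

definition seminorm_topology ::
    "(complex, 'a, 'm) module_scheme \<Rightarrow> 'i set \<Rightarrow> ('i \<Rightarrow> 'a \<Rightarrow> real) \<Rightarrow> 'a topology" where
  "seminorm_topology M I q = topology_generated_by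
     (insert (carrier M)
       {{y \<in> carrier M. q i (y \<ominus>\<^bsub>M\<^esub> x) < e} | i x e. i \<in> I \<and> x \<in> carrier M \<and> 0 < e})"

locale frechet_space = seminormed_space +
  assumes countable_seminorms: "countable I"
    and separating: "\<lbrakk>x \<in> carrier M; \<forall>i\<in>I. q i x = 0\<rbrakk> \<Longrightarrow> x = \<zero>"
    and complete: "\<lbrakk>range s \<subseteq> carrier M;
        \<forall>i\<in>I. \<forall>e>0. \<exists>N. \<forall>j\<ge>N. \<forall>k\<ge>N. q i (s j \<ominus> s k) < e\<rbrakk>
      \<Longrightarrow> \<exists>x. limitin (seminorm_topology M I q) (s :: nat \<Rightarrow> 'a) x sequentially"

definition bilinear_product ::
    "(complex, 'a, 'm) module_scheme \<Rightarrow> ('a \<Rightarrow> 'a \<Rightarrow> 'a) \<Rightarrow> bool" where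
  "bilinear_product M B \<longleftrightarrow>
     (\<forall>x\<in>carrier M. \<forall>y\<in>carrier M. B x y \<in> carrier M) \<and>
     (\<forall>x\<in>carrier M. \<forall>y\<in>carrier M. \<forall>z\<in>carrier M.
        B (x \<oplus>\<^bsub>M\<^esub> y) z = B x z \<oplus>\<^bsub>M\<^esub> B y z \<and> B z (x \<oplus>\<^bsub>M\<^esub> y) = B z x \<oplus>\<^bsub>M\<^esub> B z y) \<and>
     (\<forall>c. \<forall>x\<in>carrier M. \<forall>y\<in>carrier M.
        B (c \<odot>\<^bsub>M\<^esub> x) y = c \<odot>\<^bsub>M\<^esub> B x y \<and> B x (c \<odot>\<^bsub>M\<^esub> y) = c \<odot>\<^bsub>M\<^esub> B x y)"

definition continuous_product :: "'a topology \<Rightarrow> ('a \<Rightarrow> 'a \<Rightarrow> 'a) \<Rightarrow> bool" where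
  "continuous_product T B \<longleftrightarrow> continuous_map (prod_topology T T) T (\<lambda>(x, y). B x y)"

definition associative_on :: "'a set \<Rightarrow> ('a \<Rightarrow> 'a \<Rightarrow> 'a) \<Rightarrow> bool" where
  "associative_on A B \<longleftrightarrow> (\<forall>x\<in>A. \<forall>y\<in>A. \<forall>z\<in>A. B (B x y) z = B x (B y z))"

locale frechet_algebra = frechet_space +
  assumes mult_bilinear: "bilinear_product M (\<otimes>)"
    and mult_associative: "associative_on (carrier M) (\<otimes>)"
    and mult_continuous: "continuous_product (seminorm_topology M I q) (\<otimes>)"

text \<open>
  The space of entire \<open>M\<close>-valued functions (complex differentiable at every point), and the
  seminorms \<open>sup_{\<alpha> \<in> K} q i (F \<alpha>)\<close>, \<open>K\<close> compact, which define the topology of uniform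
  convergence on compact sets.
\<close>

definition entire_functions ::
    "(complex, 'a, 'm) module_scheme \<Rightarrow> 'i set \<Rightarrow> ('i \<Rightarrow> 'a \<Rightarrow> real) \<Rightarrow> (complex \<Rightarrow> 'a) set" where
  "entire_functions M I q = {F. range F \<subseteq> carrier M \<and>
     (\<forall>\<alpha>. \<exists>d. limitin (seminorm_topology M I q)
            (\<lambda>h. inverse h \<odot>\<^bsub>M\<^esub> (F (\<alpha> + h) \<ominus>\<^bsub>M\<^esub> F \<alpha>)) d (at 0))}"

definition entire_module ::
    "(complex, 'a, 'm) module_scheme \<Rightarrow> 'i set \<Rightarrow> ('i \<Rightarrow> 'a \<Rightarrow> real) \<Rightarrow> (complex, complex \<Rightarrow> 'a) module"
  where
  "entire_module M I q =
     \<lparr>carrier = entire_functions M I q,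
      mult = (\<lambda>F G \<alpha>. F \<alpha> \<otimes>\<^bsub>M\<^esub> G \<alpha>), one = (\<lambda>\<alpha>. \<one>\<^bsub>M\<^esub>),
      zero = (\<lambda>\<alpha>. \<zero>\<^bsub>M\<^esub>), add = (\<lambda>F G \<alpha>. F \<alpha> \<oplus>\<^bsub>M\<^esub> G \<alpha>),
      smult = (\<lambda>c F \<alpha>. c \<odot>\<^bsub>M\<^esub> F \<alpha>)\<rparr>"

definition entire_index :: "'i set \<Rightarrow> ('i \<times> complex set) set" where
  "entire_index I = I \<times> {K. compact K \<and> K \<noteq> {}}"

definition entire_seminorm ::
    "('i \<Rightarrow> 'a \<Rightarrow> real) \<Rightarrow> 'i \<times> complex set \<Rightarrow> (complex \<Rightarrow> 'a) \<Rightarrow> real" where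
  "entire_seminorm q = (\<lambda>(i, K) F. SUP \<alpha>\<in>K. q i (F \<alpha>))"

definition entire_topology ::
    "(complex, 'a, 'm) module_scheme \<Rightarrow> 'i set \<Rightarrow> ('i \<Rightarrow> 'a \<Rightarrow> real) \<Rightarrow> (complex \<Rightarrow> 'a) topology" where
  "entire_topology M I q =
     seminorm_topology (entire_module M I q) (entire_index I) (entire_seminorm q)"

definition lift_product ::
    "(complex \<Rightarrow> 'a \<Rightarrow> 'a \<Rightarrow> 'a) \<Rightarrow> (complex \<Rightarrow> 'a) \<Rightarrow> (complex \<Rightarrow> 'a) \<Rightarrow> (complex \<Rightarrow> 'a)" where
  "lift_product star F G = (\<lambda>\<alpha>. star \<alpha> (F \<alpha>) (G \<alpha>))"

text \<open>
  \<open>bilinear_product\<close> for the lifted product provides that entire functions are mapped to entire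
  functions and that the product is biadditive; the two homogeneity assumptions complete this to
  bilinearity over the ring of entire functions.
\<close>

locale holomorphic_deformation = frechet_algebra +
  fixes star :: "complex \<Rightarrow> 'a \<Rightarrow> 'a \<Rightarrow> 'a"
  assumes star_bilinear: "bilinear_product M (star \<alpha>)"
    and lift_bilinear: "bilinear_product (entire_module M I q) (lift_product star)"
    and lift_homogeneous_left:
      "\<lbrakk>\<phi> holomorphic_on UNIV; F \<in> entire_functions M I q; G \<in> entire_functions M I q\<rbrakk>
        \<Longrightarrow> lift_product star (\<lambda>\<alpha>. \<phi> \<alpha> \<odot> F \<alpha>) G = (\<lambda>\<alpha>. \<phi> \<alpha> \<odot> lift_product star F G \<alpha>)"
    and lift_homogeneous_right:
      "\<lbrakk>\<phi> holomorphic_on UNIV; F \<in> entire_functions M I q; G \<in> entire_functions M I q\<rbrakk>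
        \<Longrightarrow> lift_product star F (\<lambda>\<alpha>. \<phi> \<alpha> \<odot> G \<alpha>) = (\<lambda>\<alpha>. \<phi> \<alpha> \<odot> lift_product star F G \<alpha>)"
    and lift_associative: "associative_on (entire_functions M I q) (lift_product star)"
    and lift_continuous: "continuous_product (entire_topology M I q) (lift_product star)"
    and star_base_point: "\<lbrakk>x \<in> carrier M; y \<in> carrier M\<rbrakk> \<Longrightarrow> star 0 x y = x \<otimes> y"


section \<open>Multiindices, smooth and real-analytic functions\<close>

definition mdegree :: "nat ^ 'n \<Rightarrow> nat" where
  "mdegree N = (\<Sum>k\<in>UNIV. N $ k)"

definition mfact :: "nat ^ 'n \<Rightarrow> nat" where
  "mfact N = (\<Prod>k\<in>UNIV. fact (N $ k))"

definition mbinom :: "nat ^ 'n \<Rightarrow> nat ^ 'n \<Rightarrow> nat" where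
  "mbinom N K = (\<Prod>k\<in>UNIV. (N $ k) choose (K $ k))"

definition mpow :: "complex ^ 'n \<Rightarrow> nat ^ 'n \<Rightarrow> complex" where
  "mpow z N = (\<Prod>k\<in>UNIV. (z $ k) ^ (N $ k))"

definition dir_deriv ::
    "complex ^ 'n \<Rightarrow> (complex ^ 'n \<Rightarrow> complex) \<Rightarrow> complex ^ 'n \<Rightarrow> complex" where
  "dir_deriv v f x = frechet_derivative f (at x) v"

text \<open>
  \<open>C\<^sup>\<infinity>\<close> in the real sense (scalars are real in \<^const>\<open>frechet_derivative\<close>): all iterated
  directional derivatives exist and are differentiable, hence continuous.
\<close>

definition smooth :: "(complex ^ 'n \<Rightarrow> complex) \<Rightarrow> bool" where
  "smooth f \<longleftrightarrow> (\<forall>vs x. foldr dir_deriv vs f differentiable (at x))"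

text \<open>The Wirtinger derivatives with respect to \<open>z\<^sup>k\<close> and its conjugate.\<close>

definition wirtinger ::
    "'n \<Rightarrow> (complex ^ 'n \<Rightarrow> complex) \<Rightarrow> complex ^ 'n \<Rightarrow> complex" where
  "wirtinger k f x = (dir_deriv (axis k 1) f x - \<i> * dir_deriv (axis k \<i>) f x) / 2"

definition wirtinger_bar ::
    "'n \<Rightarrow> (complex ^ 'n \<Rightarrow> complex) \<Rightarrow> complex ^ 'n \<Rightarrow> complex" where
  "wirtinger_bar k f x = (dir_deriv (axis k 1) f x + \<i> * dir_deriv (axis k \<i>) f x) / 2"

text \<open>
  The derivative of order \<open>R\<close> in \<open>z\<close> and \<open>S\<close> in the conjugate variables. The index type carries no
  order, so an enumeration is chosen; for smooth functions the partial derivatives commute and the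
  choice is irrelevant.
\<close>

definition indices :: "'n::finite list" where
  "indices = (SOME ks. distinct ks \<and> set ks = UNIV)"

definition mderiv ::
    "nat ^ 'n \<Rightarrow> nat ^ 'n \<Rightarrow> (complex ^ 'n \<Rightarrow> complex) \<Rightarrow> complex ^ 'n \<Rightarrow> complex" where
  "mderiv R S f =
     foldr (\<lambda>k. wirtinger k ^^ (R $ k)) indices
       (foldr (\<lambda>k. wirtinger_bar k ^^ (S $ k)) indices f)"

text \<open>
  Real-analytic functions. An expansion in the real and imaginary parts of the coordinates is,
  by a complex linear substitution, the same as an expansion in \<open>z - x\<close> and its conjugate.
  (\<open>has_sum\<close> is unconditional, i.e. absolute, convergence.)
\<close>

definition real_analytic :: "(complex ^ 'n \<Rightarrow> complex) \<Rightarrow> bool" where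
  "real_analytic f \<longleftrightarrow> (\<forall>x. \<exists>r>0. \<exists>c :: nat ^ 'n \<Rightarrow> nat ^ 'n \<Rightarrow> complex. \<forall>y\<in>ball x r.
     ((\<lambda>(R, S). c R S * mpow (y - x) R * cnj (mpow (y - x) S)) has_sum f y) UNIV)"


section \<open>The Wick algebra\<close>

text \<open>
  The quantities \<open>h\<close> with values in \<open>[0, \<infinity>]\<close>. Infinite sums in \<^typ>\<open>ennreal\<close> always converge; sums
  over \<open>I \<le> R\<close> are finite, the order on multiindices being componentwise.
\<close>

primrec wick_h ::
    "complex ^ 'n \<Rightarrow> real \<Rightarrow> (complex ^ 'n \<Rightarrow> complex) \<Rightarrow>
     nat \<Rightarrow> nat \<Rightarrow> nat ^ 'n \<Rightarrow> nat ^ 'n \<Rightarrow> ennreal" where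
  "wick_h p hbar f 0 l R S =
     (\<Sum>\<^sub>\<infinity>N\<in>UNIV. ennreal ((2 * hbar) ^ (mdegree R + mdegree S + mdegree N) / real (mfact N)
                       * (norm (mderiv R (N + S) f p))\<^sup>2))"
| "wick_h p hbar f (Suc m) l R S =
     (\<Sum>\<^sub>\<infinity>N\<in>UNIV. ennreal (1 / real (mfact N)) *
        (\<Sum>I\<le>R. \<Sum>J\<le>N + S. of_nat (mbinom R I * mbinom (N + S) J) *
           (if even l then wick_h p hbar f m (l div 2) I J
            else wick_h p hbar f m ((l - 1) div 2) J I))\<^sup>2)"

type_synonym 'n wick_index = "nat \<times> nat \<times> (nat ^ 'n) \<times> (nat ^ 'n)"

definition wick_indices :: "'n wick_index set" where
  "wick_indices = {(m, l, R, S). l < 2 ^ m}"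

definition wick_seminorm ::
    "complex ^ 'n \<Rightarrow> real \<Rightarrow> 'n wick_index \<Rightarrow> (complex ^ 'n \<Rightarrow> complex) \<Rightarrow> real" where
  "wick_seminorm p hbar = (\<lambda>(m, l, R, S) f. enn2real (wick_h p hbar f m l R S) powr (1 / 2 ^ (m + 1)))"

text \<open>
  The space of smooth functions with finite seminorms, and the relation of having the same
  \<open>\<infinity>\<close>-jet at \<open>p\<close>; its quotient is the underlying set of the Wick algebra.
\<close>

definition wick_functions ::
    "complex ^ 'n \<Rightarrow> real \<Rightarrow> (complex ^ 'n \<Rightarrow> complex) set" where
  "wick_functions p hbar =
     {f. smooth f \<and> (\<forall>(m, l, R, S)\<in>wick_indices. wick_h p hbar f m l R S < \<infinity>)}"

definition jet_vanishing :: "complex ^ 'n \<Rightarrow> (complex ^ 'n \<Rightarrow> complex) set" where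
  "jet_vanishing p = {f. smooth f \<and> (\<forall>R S. mderiv R S f p = 0)}"

definition jet_rel ::
    "complex ^ 'n \<Rightarrow> real \<Rightarrow> ((complex ^ 'n \<Rightarrow> complex) \<times> (complex ^ 'n \<Rightarrow> complex)) set" where
  "jet_rel p hbar = {(f, g). f \<in> wick_functions p hbar \<and> g \<in> wick_functions p hbar \<and>
                             (\<lambda>x. f x - g x) \<in> jet_vanishing p}"

text \<open>
  The Wick algebra, each class being identified with its real-analytic representative, together with
  the pointwise operations.
\<close>

definition wick_algebra ::
    "complex ^ 'n \<Rightarrow> real \<Rightarrow> (complex, complex ^ 'n \<Rightarrow> complex) module" where
  "wick_algebra p hbar =
     \<lparr>carrier = {f \<in> wick_functions p hbar. real_analytic f},
      mult = (\<lambda>f g x. f x * g x), one = (\<lambda>x. 1),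
      zero = (\<lambda>x. 0), add = (\<lambda>f g x. f x + g x),
      smult = (\<lambda>c f x. c * f x)\<rparr>"

definition wick_term ::
    "complex \<Rightarrow> (complex ^ 'n \<Rightarrow> complex) \<Rightarrow> (complex ^ 'n \<Rightarrow> complex) \<Rightarrow>
     complex ^ 'n \<Rightarrow> nat ^ 'n \<Rightarrow> complex" where
  "wick_term \<alpha> f g x N =
     (2 * \<alpha>) ^ mdegree N / of_nat (mfact N) * mderiv N 0 f x * mderiv 0 N g x"

definition wick_star ::
    "complex \<Rightarrow> (complex ^ 'n \<Rightarrow> complex) \<Rightarrow> (complex ^ 'n \<Rightarrow> complex) \<Rightarrow>
     complex ^ 'n \<Rightarrow> complex" where
  "wick_star \<alpha> f g x = (\<Sum>\<^sub>\<infinity>N\<in>UNIV. wick_term \<alpha> f g x N)"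

end

theory Submission
  imports Defs
begin

text \<open>
  The derivatives of \<open>f\<close> at \<open>p\<close> of order \<open>(R, S)\<close> are treated as coefficients \<open>a N\<close> with
  a single multiindex \<open>N = (R, S)\<close> over the \<open>2n\<close> variables \<open>(z, cnj z)\<close>. The Wick seminorms
  define the same topology as the conditions \<open>|a N| \<le> A (N!)^e\<close> for all \<open>e > 0\<close>: an even and an
  odd step of the recursion for \<open>h\<close> bound \<open>a N\<close> by a single seminorm, and conversely each
  recursion step at most doubles the exponent of \<open>N!\<close>. Hence the elements of the algebra are the
  entire power series in \<open>(z, cnj z)\<close> with such coefficients; neither \<open>hbar\<close> nor \<open>p\<close> matters. The
  growth condition makes every series below absolutely convergent, uniformly for bounded \<open>\<alpha>\<close>,
  so that associativity follows by rearranging a triple series and holomorphy in \<open>\<alpha>\<close> from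
  estimates for the scalar weights \<open>(2 \<alpha>)^d\<close>.
\<close>

section \<open>Seminorm topologies and lifted products\<close>

text \<open>Exponential factors are free: c^|N| is at most C (N!)^d for every d > 0, so the losses
  2^|N| caused by binomial sums or by splitting (N + K)! cost only an arbitrarily small part of the
  exponent. This requires the growth condition for all exponents at once, and it is why powers of
  hbar drop out. The recurring threshold 1/4 comes from products of two factors: (M!)^(1/4)
  (M!)^(1/4) / M! still decays like (M!)^(-1/2) and so outweighs every exponential.

  Two obstacles shape the argument. The seminorms are roots of iterated sums of squares, so the
  triangle inequality is not visible in their formula; it follows from convexity and homogeneity of
  h by the usual argument for a Minkowski functional. Moreover, the seminorms see only the jet at p,
  whereas the star product is a series in derivatives at each point x; recentring the power series
  carries the growth bounds from p to x.\<close>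

lemma complex_ring_simps [simp]:
  "carrier complex_ring = UNIV" "mult complex_ring = (*)" "one complex_ring = 1"
  "zero complex_ring = 0" "add complex_ring = (+)"
  by (simp_all add: complex_ring_def)

lemma cring_complex_ring: "cring complex_ring"
proof (rule cringI)
  show "abelian_group complex_ring"
    by (rule abelian_groupI) (auto intro: exI [of _ "- x" for x] simp: add_eq_0_iff)
  show "comm_monoid complex_ring"
    by (rule comm_monoidI) auto
qed (auto simp: algebra_simps)

context seminormed_space
begin

lemma smult_in [simp, intro]: "x \<in> carrier M \<Longrightarrow> c \<odot> x \<in> carrier M"
  using smult_closed by simp

lemma smult_add_left: "x \<in> carrier M \<Longrightarrow> (a + b) \<odot> x = a \<odot> x \<oplus> b \<odot> x"
  using smult_l_distr [of a b x] by simp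

lemma smult_add_right:
  "\<lbrakk>x \<in> carrier M; y \<in> carrier M\<rbrakk> \<Longrightarrow> c \<odot> (x \<oplus> y) = c \<odot> x \<oplus> c \<odot> y"
  using smult_r_distr [of c x y] by simp

lemma smult_smult: "x \<in> carrier M \<Longrightarrow> a \<odot> (b \<odot> x) = (a * b) \<odot> x"
  using smult_assoc1 [of a b x] by simp

lemma smult_1 [simp]: "x \<in> carrier M \<Longrightarrow> 1 \<odot> x = x"
  using smult_one [of x] by simp

lemma smult_0 [simp]: "x \<in> carrier M \<Longrightarrow> 0 \<odot> x = \<zero>"
  using smult_l_null [of x] by simp

lemma uminus_eq_smult: "x \<in> carrier M \<Longrightarrow> \<ominus> x = (-1) \<odot> x"
  using smult_add_left [of x 1 "-1"] minus_equality [of "(-1) \<odot> x" x]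
  by (simp add: a_comm)

lemma minus_eq_smult: "\<lbrakk>x \<in> carrier M; y \<in> carrier M\<rbrakk> \<Longrightarrow> x \<ominus> y = x \<oplus> (-1) \<odot> y"
  by (simp add: a_minus_def uminus_eq_smult)

lemma seminorm_zero: "i \<in> I \<Longrightarrow> q i \<zero> = 0"
  using seminorm_smult [of i \<zero> 0] by simp

lemma seminorm_uminus: "\<lbrakk>i \<in> I; x \<in> carrier M\<rbrakk> \<Longrightarrow> q i (\<ominus> x) = q i x"
  using seminorm_smult [of i x "-1"] by (simp add: uminus_eq_smult)

lemma seminorm_nonneg: "\<lbrakk>i \<in> I; x \<in> carrier M\<rbrakk> \<Longrightarrow> 0 \<le> q i x"
  using seminorm_add [of i x "\<ominus> x"] by (simp add: seminorm_uminus seminorm_zero r_neg)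

lemma minus_self: "x \<in> carrier M \<Longrightarrow> x \<ominus> x = \<zero>"
  by (simp add: a_minus_def r_neg)

lemma seminorm_minus_self: "\<lbrakk>i \<in> I; x \<in> carrier M\<rbrakk> \<Longrightarrow> q i (x \<ominus> x) = 0"
  by (simp add: minus_self seminorm_zero)

lemma minus_split:
  "\<lbrakk>x \<in> carrier M; y \<in> carrier M; z \<in> carrier M\<rbrakk> \<Longrightarrow> x \<ominus> z = (x \<ominus> y) \<oplus> (y \<ominus> z)"
  by (simp add: a_minus_def a_assoc r_neg1)

lemma seminorm_minus_triangle:
  "\<lbrakk>i \<in> I; x \<in> carrier M; y \<in> carrier M; z \<in> carrier M\<rbrakk>
    \<Longrightarrow> q i (x \<ominus> z) \<le> q i (x \<ominus> y) + q i (y \<ominus> z)"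
  using seminorm_add [of i "x \<ominus> y" "y \<ominus> z"] by (simp add: minus_split [of x y z])

lemma seminorm_minus_commute:
  assumes "i \<in> I" "x \<in> carrier M" "y \<in> carrier M"
  shows "q i (x \<ominus> y) = q i (y \<ominus> x)"
proof -
  have "x \<ominus> y = \<ominus> (y \<ominus> x)"
    using assms by (simp add: a_minus_def minus_add a_comm)
  then show ?thesis using assms by (simp add: seminorm_uminus)
qed

lemma seminorm_le_minus:
  assumes "i \<in> I" "x \<in> carrier M" "y \<in> carrier M"
  shows "q i x \<le> q i (x \<ominus> y) + q i y"
proof -
  have "x = (x \<ominus> y) \<oplus> y"
    using assms by (simp add: a_minus_def a_assoc l_neg)
  then show ?thesis using assms seminorm_add [of i "x \<ominus> y" y] by simp
qed

section \<open>Balls and convergence in the topology of a family of seminorms\<close>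

lemma topspace_seminorm_topology [simp]: "topspace (seminorm_topology M I q) = carrier M"
  unfolding seminorm_topology_def by auto

lemma openin_seminorm_ball:
  "\<lbrakk>i \<in> I; x \<in> carrier M\<rbrakk> \<Longrightarrow> openin (seminorm_topology M I q) {y \<in> carrier M. q i (y \<ominus> x) < e}"
proof (cases "0 < e")
  case False
  assume "i \<in> I" "x \<in> carrier M"
  then have "{y \<in> carrier M. q i (y \<ominus> x) < e} = {}"
    using False by (auto simp: not_less) (meson minus_closed order_trans seminorm_nonneg leD)
  then show ?thesis by (simp only: openin_empty)
next
  case True
  assume "i \<in> I" "x \<in> carrier M"
  then show ?thesis
    unfolding seminorm_topology_def using True
    by (intro topology_generated_by_Basis) blast
qed

text \<open>Convergence need only be tested on generating sets. Such a set is a ball whose centre z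
  may differ from the limit x; the triangle inequality then leaves the radius
  \<open>e - q i (x \<ominus> z)\<close> around x.\<close>

lemma limitin_seminorm_topology:
  "limitin (seminorm_topology M I q) s x F \<longleftrightarrow>
     x \<in> carrier M \<and> (\<forall>\<^sub>F j in F. s j \<in> carrier M) \<and>
     (\<forall>i\<in>I. ((\<lambda>j. q i (s j \<ominus> x)) \<longlongrightarrow> 0) F)" (is "?L \<longleftrightarrow> ?R")
proof
  assume L: ?L
  then have x: "x \<in> carrier M" using limitin_topspace by fastforce
  have s: "\<forall>\<^sub>F j in F. s j \<in> carrier M"
    using limitinD [OF L openin_topspace] x by simp
  have "((\<lambda>j. q i (s j \<ominus> x)) \<longlongrightarrow> 0) F" if "i \<in> I" for i
  proof (rule tendstoI)
    fix e :: real assume "e > 0"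
    then have "\<forall>\<^sub>F j in F. s j \<in> {y \<in> carrier M. q i (y \<ominus> x) < e}"
      using L x that openin_seminorm_ball
      by (intro limitinD) (auto simp: seminorm_minus_self)
    then show "\<forall>\<^sub>F j in F. dist (q i (s j \<ominus> x)) 0 < e"
      by eventually_elim (use that x seminorm_nonneg in auto)
  qed
  with x s show ?R by blast
next
  assume R: ?R
  then have x: "x \<in> carrier M" by blast
  have "\<forall>\<^sub>F j in F. s j \<in> U" if "generate_topology_on
     (insert (carrier M) {{y \<in> carrier M. q i (y \<ominus> x) < e} | i x e. i \<in> I \<and> x \<in> carrier M \<and> 0 < e}) U"
     and "x \<in> U" for U
    using that
  proof (induction rule: generate_topology_on.induct)
    case (Int a b)
    then show ?case by (simp add: eventually_conj_iff)
  next
    case (UN K)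
    then obtain k where "k \<in> K" "x \<in> k" by blast
    then have "\<forall>\<^sub>F j in F. s j \<in> k" using UN by blast
    then show ?case by (rule eventually_mono) (use \<open>k \<in> K\<close> in blast)
  next
    case (Basis S)
    then consider "S = carrier M"
      | i z e where "S = {y \<in> carrier M. q i (y \<ominus> z) < e}" "i \<in> I" "z \<in> carrier M"
      by blast
    then show ?case
    proof cases
      case 1 then show ?thesis using R by blast
    next
      case 2
      have "0 < e - q i (x \<ominus> z)" using 2 Basis by simp
      moreover have "((\<lambda>j. q i (s j \<ominus> x)) \<longlongrightarrow> 0) F" using R 2 by blast
      ultimately have "\<forall>\<^sub>F j in F. q i (s j \<ominus> x) < e - q i (x \<ominus> z)"
        by (rule order_tendstoD(2) [rotated])
      moreover have "\<forall>\<^sub>F j in F. s j \<in> carrier M" using R by blast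
      ultimately show ?thesis
      proof eventually_elim
        case (elim j)
        then show ?case
          using 2 x seminorm_minus_triangle [of i "s j" x z] by simp
      qed
    qed
  qed auto
  then show ?L
    unfolding limitin_def using x
    by (auto simp: seminorm_topology_def openin_topology_generated_by_iff)
qed

section \<open>Continuity of bilinear products\<close>

lemma bilinear_minus_left:
  assumes "bilinear_product M B" "x \<in> carrier M" "y \<in> carrier M" "z \<in> carrier M"
  shows "B (x \<ominus> y) z = B x z \<ominus> B y z"
  using assms unfolding bilinear_product_def by (auto simp: minus_eq_smult)

lemma bilinear_minus_right:
  assumes "bilinear_product M B" "x \<in> carrier M" "y \<in> carrier M" "z \<in> carrier M"
  shows "B z (x \<ominus> y) = B z x \<ominus> B z y"
  using assms unfolding bilinear_product_def by (auto simp: minus_eq_smult)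

lemma bilinear_minus_minus:
  assumes "bilinear_product M B" "x \<in> carrier M" "y \<in> carrier M" "x' \<in> carrier M" "y' \<in> carrier M"
  shows "B x' y' \<ominus> B x y = B (x' \<ominus> x) y' \<oplus> B x (y' \<ominus> y)"
proof -
  have "B x' y' \<in> carrier M" "B x y' \<in> carrier M" "B x y \<in> carrier M"
    using assms by (auto simp: bilinear_product_def)
  then show ?thesis
    using assms by (simp add: bilinear_minus_left bilinear_minus_right minus_split [symmetric])
qed

text \<open>The increment of B splits into \<open>B (x' \<ominus> x) y'\<close> and
  \<open>B x (y' \<ominus> y)\<close>, so a bound by products of seminorms gives joint continuity at
  every point. Only preimages of the generating sets have to be examined.\<close>

lemma continuous_productI:
  assumes B: "bilinear_product M B"
    and bound: "\<And>i. i \<in> I \<Longrightarrow> \<exists>j\<in>I. \<exists>k\<in>I. \<exists>C. \<forall>x\<in>carrier M. \<forall>y\<in>carrier M. q i (B x y) \<le> C * q j x * q k y"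
  shows "continuous_product (seminorm_topology M I q) B"
proof -
  let ?T = "seminorm_topology M I q"
  have closed: "B x y \<in> carrier M" if "x \<in> carrier M" "y \<in> carrier M" for x y
    using B that by (auto simp: bilinear_product_def)
  have main: "openin (prod_topology ?T ?T) ((\<lambda>(x, y). B x y) -` U \<inter> topspace (prod_topology ?T ?T))"
    if U: "U \<in> insert (carrier M) {{y \<in> carrier M. q i (y \<ominus> x) < e} | i x e. i \<in> I \<and> x \<in> carrier M \<and> 0 < e}" for U
  proof -
    have "\<exists>V W. openin ?T V \<and> openin ?T W \<and> x \<in> V \<and> y \<in> W \<and>
            V \<times> W \<subseteq> (\<lambda>(x, y). B x y) -` U \<inter> topspace (prod_topology ?T ?T)"
      if xy: "x \<in> carrier M" "y \<in> carrier M" "B x y \<in> U" for x y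
    proof -
      consider "U = carrier M"
        | i z e where "U = {y \<in> carrier M. q i (y \<ominus> z) < e}" "i \<in> I" "z \<in> carrier M"
        using U by blast
      then show ?thesis
      proof cases
        case 1
        then have "carrier M \<times> carrier M \<subseteq> (\<lambda>(x, y). B x y) -` U \<inter> topspace (prod_topology ?T ?T)"
          using closed by auto
        then show ?thesis using xy openin_topspace [of ?T] by auto
      next
        case 2
        obtain j k C where jk: "j \<in> I" "k \<in> I"
          and C: "\<And>x y. \<lbrakk>x \<in> carrier M; y \<in> carrier M\<rbrakk> \<Longrightarrow> q i (B x y) \<le> C * q j x * q k y"
          using bound [OF 2(2)] by blast
        \<comment> \<open>C is not assumed positive, but its replacement occurs in denominators
          below.\<close>
        define C' where "C' = max C 1"
        have C': "q i (B x y) \<le> C' * q j x * q k y" if "x \<in> carrier M" "y \<in> carrier M" for x y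
        proof -
          have "C * (q j x * q k y) \<le> C' * (q j x * q k y)"
            using that jk seminorm_nonneg by (intro mult_right_mono) (auto simp: C'_def)
          then show ?thesis using C [OF that] by (simp add: mult.assoc)
        qed
        have "C' > 0" by (simp add: C'_def)
        define d where "d = e - q i (B x y \<ominus> z)"
        have "d > 0" using xy 2 by (simp add: d_def)
        \<comment> \<open>The divisor is \<open>q k y + 1\<close> because \<open>q k y'\<close> is
          only known to be at most this when y' is within 1 of y, which the minimum in the
          definition of b' ensures. The summand 1 also excludes a zero denominator.\<close>
        define a where "a = min 1 (d / (4 * C' * (q k y + 1)))"
        define b where "b = d / (4 * C' * (q j x + 1))"
        have pos: "q k y + 1 > 0" "q j x + 1 > 0"
          using xy jk seminorm_nonneg[of k y] seminorm_nonneg [of j x] by auto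
        have aux: "C' * (d / (4 * C' * u)) * u = d / 4" if "u > 0" for u
          using that \<open>C' > 0\<close> by (simp add: field_simps)
        have ab: "a > 0" "b > 0"
          using pos \<open>d > 0\<close> \<open>C' > 0\<close> by (auto simp: a_def b_def)
        define b' where "b' = min 1 b"
        have "b' > 0" using ab by (simp add: b'_def)
        let ?V = "{x' \<in> carrier M. q j (x' \<ominus> x) < a}" and ?W = "{y' \<in> carrier M. q k (y' \<ominus> y) < b'}"
        have "q i (B x' y' \<ominus> z) < e" if x': "x' \<in> ?V" and y': "y' \<in> ?W" for x' y'
        proof -
          have m: "x' \<in> carrier M" "y' \<in> carrier M" using x' y' by auto
          have "q k y' \<le> q k y + 1"
            using seminorm_le_minus [of k y' y] m xy jk y' by (simp add: b'_def)
          have "q i (B (x' \<ominus> x) y') \<le> C' * q j (x' \<ominus> x) * q k y'"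
            using m xy by (intro C') auto
          also have "\<dots> \<le> C' * a * (q k y + 1)"
            using x' m xy jk \<open>C' > 0\<close> ab \<open>q k y' \<le> q k y + 1\<close>
            by (intro mult_mono mult_nonneg_nonneg seminorm_nonneg) auto
          also have "\<dots> \<le> C' * (d / (4 * C' * (q k y + 1))) * (q k y + 1)"
            using \<open>C' > 0\<close> pos by (intro mult_right_mono mult_left_mono) (auto simp: a_def)
          also have "\<dots> = d / 4" using aux pos by blast
          finally have 1: "q i (B (x' \<ominus> x) y') \<le> d / 4" .
          have "q i (B x (y' \<ominus> y)) \<le> C' * q j x * q k (y' \<ominus> y)"
            using m xy by (intro C') auto
          also have "\<dots> \<le> C' * (q j x + 1) * b"
            using y' m xy jk \<open>C' > 0\<close> ab pos
            by (intro mult_mono mult_nonneg_nonneg seminorm_nonneg) (auto simp: b'_def)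
          also have "\<dots> = C' * b * (q j x + 1)" by (simp only: mult_ac)
          also have "\<dots> = d / 4" unfolding b_def using aux pos by blast
          finally have 3: "q i (B x (y' \<ominus> y)) \<le> d / 4" .
          have "q i (B x' y' \<ominus> B x y) \<le> q i (B (x' \<ominus> x) y') + q i (B x (y' \<ominus> y))"
            using m xy closed 2 by (simp add: bilinear_minus_minus [OF B] seminorm_add)
          then have "q i (B x' y' \<ominus> B x y) \<le> d / 2" using 1 3 by simp
          moreover have "q i (B x' y' \<ominus> z) \<le> q i (B x' y' \<ominus> B x y) + q i (B x y \<ominus> z)"
            using m xy closed 2 by (intro seminorm_minus_triangle) auto
          ultimately show ?thesis using \<open>d > 0\<close> by (simp add: d_def)
        qed
        then have "?V \<times> ?W \<subseteq> (\<lambda>(x, y). B x y) -` U \<inter> topspace (prod_topology ?T ?T)"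
          using 2 closed by auto
        moreover have "x \<in> ?V" "y \<in> ?W"
          using xy jk ab \<open>b' > 0\<close> by (auto simp: seminorm_minus_self)
        moreover have "openin ?T ?V" "openin ?T ?W"
          using xy jk by (auto intro: openin_seminorm_ball)
        ultimately show ?thesis by blast
      qed
    qed
    then show ?thesis
      unfolding openin_prod_topology_alt by auto
  qed
  show ?thesis
    unfolding continuous_product_def seminorm_topology_def
    by (rule continuous_on_generated_topo)
       (use main closed in \<open>auto simp: seminorm_topology_def [symmetric]\<close>)
qed

section \<open>Limits, and entire functions with values in a seminormed space\<close>

lemma minus_add_add:
  "\<lbrakk>x \<in> carrier M; y \<in> carrier M; x' \<in> carrier M; y' \<in> carrier M\<rbrakk>
    \<Longrightarrow> (x \<oplus> y) \<ominus> (x' \<oplus> y') = (x \<ominus> x') \<oplus> (y \<ominus> y')"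
  by (simp add: a_minus_def minus_add a_ac)

lemma smult_minus:
  "\<lbrakk>x \<in> carrier M; y \<in> carrier M\<rbrakk> \<Longrightarrow> c \<odot> (x \<ominus> y) = c \<odot> x \<ominus> c \<odot> y"
  by (simp add: minus_eq_smult smult_add_right smult_smult)

lemma limitin_add:
  assumes "limitin (seminorm_topology M I q) s x F" "limitin (seminorm_topology M I q) t y F"
  shows "limitin (seminorm_topology M I q) (\<lambda>h. s h \<oplus> t h) (x \<oplus> y) F"
proof -
  have in_carrier: "x \<in> carrier M" "y \<in> carrier M"
      "\<forall>\<^sub>F h in F. s h \<in> carrier M" "\<forall>\<^sub>F h in F. t h \<in> carrier M"
    using assms by (auto simp: limitin_seminorm_topology)
  have ev: "\<forall>\<^sub>F h in F. s h \<in> carrier M \<and> t h \<in> carrier M"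
    using in_carrier(3,4) by eventually_elim auto
  have "((\<lambda>h. q i (s h \<oplus> t h \<ominus> (x \<oplus> y))) \<longlongrightarrow> 0) F" if "i \<in> I" for i
  proof (rule tendsto_sandwich)
    show "\<forall>\<^sub>F h in F. 0 \<le> q i (s h \<oplus> t h \<ominus> (x \<oplus> y))"
      using ev by eventually_elim (use in_carrier that in \<open>auto intro: seminorm_nonneg\<close>)
    show "\<forall>\<^sub>F h in F. q i (s h \<oplus> t h \<ominus> (x \<oplus> y)) \<le> q i (s h \<ominus> x) + q i (t h \<ominus> y)"
      using ev by eventually_elim (use in_carrier that in \<open>simp add: minus_add_add seminorm_add\<close>)
    have "((\<lambda>h. q i (s h \<ominus> x) + q i (t h \<ominus> y)) \<longlongrightarrow> 0 + 0) F"
      using assms that by (intro tendsto_add) (auto simp: limitin_seminorm_topology)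
    then show "((\<lambda>h. q i (s h \<ominus> x) + q i (t h \<ominus> y)) \<longlongrightarrow> 0) F" by simp
  qed auto
  with in_carrier ev show ?thesis
    by (auto simp: limitin_seminorm_topology elim: eventually_mono)
qed

lemma limitin_smult:
  assumes "limitin (seminorm_topology M I q) s x F"
  shows "limitin (seminorm_topology M I q) (\<lambda>h. c \<odot> s h) (c \<odot> x) F"
proof -
  have in_carrier: "x \<in> carrier M" and ev: "\<forall>\<^sub>F h in F. s h \<in> carrier M"
    using assms by (auto simp: limitin_seminorm_topology)
  have "((\<lambda>h. q i (c \<odot> s h \<ominus> c \<odot> x)) \<longlongrightarrow> 0) F" if "i \<in> I" for i
  proof -
    have "((\<lambda>h. norm c * q i (s h \<ominus> x)) \<longlongrightarrow> norm c * 0) F"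
      using assms that by (intro tendsto_mult) (auto simp: limitin_seminorm_topology)
    moreover have "\<forall>\<^sub>F h in F. norm c * q i (s h \<ominus> x) = q i (c \<odot> s h \<ominus> c \<odot> x)"
      using ev by eventually_elim
        (use in_carrier that in \<open>simp add: smult_minus [symmetric] seminorm_smult\<close>)
    ultimately show ?thesis by (simp add: Lim_transform_eventually)
  qed
  with in_carrier ev show ?thesis
    by (auto simp: limitin_seminorm_topology elim: eventually_mono)
qed

lemma entire_functionsD: "F \<in> entire_functions M I q \<Longrightarrow> F \<alpha> \<in> carrier M"
  by (auto simp: entire_functions_def)

text \<open>The increment is h times the difference quotient, whose seminorms stay bounded near h =
  0 because it converges.\<close>

lemma entire_functions_limit:
  assumes F: "F \<in> entire_functions M I q"
  shows "limitin (seminorm_topology M I q) (\<lambda>h. F (\<alpha> + h)) (F \<alpha>) (at 0)"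
proof -
  obtain d where d: "limitin (seminorm_topology M I q)
            (\<lambda>h. inverse h \<odot> (F (\<alpha> + h) \<ominus> F \<alpha>)) d (at 0)"
    using F by (auto simp: entire_functions_def)
  have "((\<lambda>h. q i (F (\<alpha> + h) \<ominus> F \<alpha>)) \<longlongrightarrow> 0) (at 0)" if i: "i \<in> I" for i
  proof (rule tendsto_sandwich)
    let ?g = "\<lambda>h. norm h * (q i (inverse h \<odot> (F (\<alpha> + h) \<ominus> F \<alpha>) \<ominus> d) + q i d)"
    show "\<forall>\<^sub>F h in at 0. 0 \<le> q i (F (\<alpha> + h) \<ominus> F \<alpha>)"
      using entire_functionsD [OF F] i by (intro always_eventually allI seminorm_nonneg) auto
    have "q i (F (\<alpha> + h) \<ominus> F \<alpha>) \<le> ?g h" if "h \<noteq> 0" for h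
    proof -
      have "q i (F (\<alpha> + h) \<ominus> F \<alpha>) = norm h * q i (inverse h \<odot> (F (\<alpha> + h) \<ominus> F \<alpha>))"
        using that i entire_functionsD [OF F] by (simp add: seminorm_smult norm_inverse)
      also have "\<dots> \<le> ?g h"
        using i d entire_functionsD [OF F]
        by (intro mult_left_mono seminorm_le_minus) (auto simp: limitin_seminorm_topology)
      finally show ?thesis .
    qed
    then show "\<forall>\<^sub>F h in at 0. q i (F (\<alpha> + h) \<ominus> F \<alpha>) \<le> ?g h"
      by (auto simp: eventually_at_filter)
    have "(?g \<longlongrightarrow> norm (0::complex) * (0 + q i d)) (at 0)"
      using d i by (intro tendsto_intros) (auto simp: limitin_seminorm_topology)
    then show "(?g \<longlongrightarrow> 0) (at 0)" by simp
  qed auto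
  then show ?thesis
    using entire_functionsD [OF F] by (auto simp: limitin_seminorm_topology)
qed

text \<open>Continuity follows from the reverse triangle inequality. It makes the seminorm bounded
  on compact sets, without which the suprema in \<open>entire_seminorm\<close> would be unspecified
  values.\<close>

lemma continuous_on_entire_seminorm:
  assumes F: "F \<in> entire_functions M I q" and i: "i \<in> I"
  shows "continuous_on K (\<lambda>\<alpha>. q i (F \<alpha>))"
proof -
  have "isCont (\<lambda>\<alpha>. q i (F \<alpha>)) \<alpha>" for \<alpha>
  proof -
    have lim: "((\<lambda>h. q i (F (\<alpha> + h) \<ominus> F \<alpha>)) \<longlongrightarrow> 0) (at 0)"
      using entire_functions_limit [OF F, of \<alpha>] i by (auto simp: limitin_seminorm_topology)
    have "((\<lambda>h. q i (F (\<alpha> + h)) - q i (F \<alpha>)) \<longlongrightarrow> 0) (at 0)"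
    proof (rule Lim_null_comparison [OF _ lim], rule always_eventually, rule allI)
      fix h
      show "norm (q i (F (\<alpha> + h)) - q i (F \<alpha>)) \<le> q i (F (\<alpha> + h) \<ominus> F \<alpha>)"
        using seminorm_le_minus [OF i entire_functionsD [OF F] entire_functionsD [OF F], of "\<alpha> + h" \<alpha>]
          seminorm_le_minus [OF i entire_functionsD [OF F] entire_functionsD [OF F], of \<alpha> "\<alpha> + h"]
          seminorm_minus_commute [OF i entire_functionsD [OF F] entire_functionsD [OF F], of \<alpha> "\<alpha> + h"]
        by simp
    qed
    then show ?thesis
      unfolding isCont_iff by (simp add: LIM_zero_iff)
  qed
  then show ?thesis by (simp add: continuous_at_imp_continuous_on)
qed

lemma bdd_above_entire_seminorm:
  assumes "F \<in> entire_functions M I q" "i \<in> I" "compact K"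
  shows "bdd_above ((\<lambda>\<alpha>. q i (F \<alpha>)) ` K)"
  by (intro bounded_imp_bdd_above compact_imp_bounded compact_continuous_image
        continuous_on_entire_seminorm assms)

lemma entire_functions_add:
  assumes "F \<in> entire_functions M I q" "G \<in> entire_functions M I q"
  shows "(\<lambda>\<alpha>. F \<alpha> \<oplus> G \<alpha>) \<in> entire_functions M I q"
proof -
  have "\<exists>d. limitin (seminorm_topology M I q)
         (\<lambda>h. inverse h \<odot> ((F (\<alpha> + h) \<oplus> G (\<alpha> + h)) \<ominus> (F \<alpha> \<oplus> G \<alpha>))) d (at 0)" for \<alpha>
  proof -
    obtain d e where "limitin (seminorm_topology M I q) (\<lambda>h. inverse h \<odot> (F (\<alpha> + h) \<ominus> F \<alpha>)) d (at 0)"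
        "limitin (seminorm_topology M I q) (\<lambda>h. inverse h \<odot> (G (\<alpha> + h) \<ominus> G \<alpha>)) e (at 0)"
      using assms unfolding entire_functions_def by blast
    from limitin_add [OF this] show ?thesis
      using assms entire_functionsD by (auto simp: minus_add_add smult_add_right)
  qed
  then show ?thesis
    using assms entire_functionsD by (auto simp: entire_functions_def)
qed

lemma entire_functions_smult:
  assumes "F \<in> entire_functions M I q"
  shows "(\<lambda>\<alpha>. c \<odot> F \<alpha>) \<in> entire_functions M I q"
proof -
  have "\<exists>d. limitin (seminorm_topology M I q)
         (\<lambda>h. inverse h \<odot> (c \<odot> F (\<alpha> + h) \<ominus> c \<odot> F \<alpha>)) d (at 0)" for \<alpha>
  proof -
    obtain d where "limitin (seminorm_topology M I q) (\<lambda>h. inverse h \<odot> (F (\<alpha> + h) \<ominus> F \<alpha>)) d (at 0)"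
      using assms unfolding entire_functions_def by blast
    from limitin_smult [OF this, of c] show ?thesis
      using assms entire_functionsD
      by (auto simp: smult_minus [symmetric] smult_smult mult.commute)
  qed
  then show ?thesis
    using assms entire_functionsD by (auto simp: entire_functions_def)
qed

lemma entire_functions_zero: "(\<lambda>\<alpha>. \<zero>) \<in> entire_functions M I q"
  by (auto simp: entire_functions_def minus_self intro!: exI [of _ \<zero>])

lemma module_entire_module: "module complex_ring (entire_module M I q)"
proof (rule moduleI)
  show "abelian_group (entire_module M I q)"
  proof (rule abelian_groupI)
    fix F assume "F \<in> carrier (entire_module M I q)"
    then have F: "F \<in> entire_functions M I q" by (simp add: entire_module_def)
    then show "\<exists>G\<in>carrier (entire_module M I q). G \<oplus>\<^bsub>entire_module M I q\<^esub> F = \<zero>\<^bsub>entire_module M I q\<^esub>"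
      using entire_functionsD [OF F] entire_functions_smult [OF F, of "-1"]
      by (intro bexI [of _ "\<lambda>\<alpha>. (-1) \<odot> F \<alpha>"])
         (auto simp: entire_module_def uminus_eq_smult [symmetric] l_neg)
  qed (auto simp: entire_module_def entire_functions_add entire_functions_zero entire_functionsD a_ac)
qed (auto simp: cring_complex_ring entire_module_def entire_functions_smult entire_functionsD
       smult_add_left smult_add_right smult_smult)

text \<open>With this, the continuity criterion for bilinear products applies to the space of entire
  functions as well as to M itself.\<close>

lemma seminormed_space_entire_module:
  "seminormed_space (entire_module M I q) (entire_index I) (entire_seminorm q)"
proof (intro seminormed_space.intro seminormed_space_axioms.intro)
  show "module complex_ring (entire_module M I q)" by (rule module_entire_module)
next
  fix iK F c
  assume "iK \<in> entire_index I" "F \<in> carrier (entire_module M I q)"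
  then obtain i K where iK: "iK = (i, K)" "i \<in> I" "compact K" "K \<noteq> {}" and F: "F \<in> entire_functions M I q"
    by (auto simp: entire_index_def entire_module_def)
  have "(SUP \<alpha>\<in>K. q i (c \<odot> F \<alpha>)) = norm c * (SUP \<alpha>\<in>K. q i (F \<alpha>))"
  proof (rule antisym)
    show "(SUP \<alpha>\<in>K. q i (c \<odot> F \<alpha>)) \<le> norm c * (SUP \<alpha>\<in>K. q i (F \<alpha>))"
      using iK entire_functionsD [OF F] bdd_above_entire_seminorm [OF F]
      by (intro cSUP_least) (auto simp: seminorm_smult intro!: mult_left_mono cSUP_upper)
    show "norm c * (SUP \<alpha>\<in>K. q i (F \<alpha>)) \<le> (SUP \<alpha>\<in>K. q i (c \<odot> F \<alpha>))"
    proof (cases "c = 0")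
      case True
      then show ?thesis using iK entire_functionsD [OF F] by (simp add: seminorm_zero)
    next
      case False
      have "(SUP \<alpha>\<in>K. q i (F \<alpha>)) \<le> (SUP \<alpha>\<in>K. q i (c \<odot> F \<alpha>)) / norm c"
      proof (rule cSUP_least [OF iK(4)])
        fix \<alpha> assume "\<alpha> \<in> K"
        then have "q i (c \<odot> F \<alpha>) \<le> (SUP \<alpha>\<in>K. q i (c \<odot> F \<alpha>))"
          using iK bdd_above_entire_seminorm [OF entire_functions_smult [OF F]]
          by (intro cSUP_upper) auto
        then show "q i (F \<alpha>) \<le> (SUP \<alpha>\<in>K. q i (c \<odot> F \<alpha>)) / norm c"
          using False iK entire_functionsD [OF F] by (simp add: seminorm_smult field_simps)
      qed
      then show ?thesis using False by (simp add: field_simps)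
    qed
  qed
  then show "entire_seminorm q iK (c \<odot>\<^bsub>entire_module M I q\<^esub> F) = norm c * entire_seminorm q iK F"
    by (simp add: iK entire_seminorm_def entire_module_def)
next
  fix iK F G
  assume "iK \<in> entire_index I" "F \<in> carrier (entire_module M I q)" "G \<in> carrier (entire_module M I q)"
  then obtain i K where iK: "iK = (i, K)" "i \<in> I" "compact K" "K \<noteq> {}"
    and F: "F \<in> entire_functions M I q" and G: "G \<in> entire_functions M I q"
    by (auto simp: entire_index_def entire_module_def)
  have "(SUP \<alpha>\<in>K. q i (F \<alpha> \<oplus> G \<alpha>)) \<le> (SUP \<alpha>\<in>K. q i (F \<alpha>)) + (SUP \<alpha>\<in>K. q i (G \<alpha>))"
  proof (rule cSUP_least [OF iK(4)])
    fix \<alpha> assume "\<alpha> \<in> K"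
    then have "q i (F \<alpha>) \<le> (SUP \<alpha>\<in>K. q i (F \<alpha>))" "q i (G \<alpha>) \<le> (SUP \<alpha>\<in>K. q i (G \<alpha>))"
      using iK bdd_above_entire_seminorm [OF F] bdd_above_entire_seminorm [OF G]
      by (auto intro: cSUP_upper)
    then show "q i (F \<alpha> \<oplus> G \<alpha>) \<le> (SUP \<alpha>\<in>K. q i (F \<alpha>)) + (SUP \<alpha>\<in>K. q i (G \<alpha>))"
      using seminorm_add [OF iK(2) entire_functionsD [OF F] entire_functionsD [OF G], of \<alpha> \<alpha>]
      by linarith
  qed
  then show "entire_seminorm q iK (F \<oplus>\<^bsub>entire_module M I q\<^esub> G) \<le> entire_seminorm q iK F + entire_seminorm q iK G"
    by (simp add: iK entire_seminorm_def entire_module_def)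
qed

text \<open>
  A family of bilinear products that is bounded uniformly for bounded \<open>\<alpha>\<close> and entire in \<open>\<alpha>\<close> for
  fixed factors is entire on pairs of entire functions, by the product rule.
\<close>

context
  fixes star :: "complex \<Rightarrow> 'a \<Rightarrow> 'a \<Rightarrow> 'a"
  assumes bilin: "\<And>\<alpha>. bilinear_product M (star \<alpha>)"
    and bound: "\<And>i \<rho>. i \<in> I \<Longrightarrow> \<exists>j\<in>I. \<exists>C. \<forall>\<alpha> x y. norm \<alpha> \<le> \<rho> \<longrightarrow> x \<in> carrier M \<longrightarrow> y \<in> carrier M
                  \<longrightarrow> q i (star \<alpha> x y) \<le> C * q j x * q j y"
    and entire: "\<And>x y. \<lbrakk>x \<in> carrier M; y \<in> carrier M\<rbrakk> \<Longrightarrow> (\<lambda>\<alpha>. star \<alpha> x y) \<in> entire_functions M I q"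
begin

lemma star_closed: "\<lbrakk>x \<in> carrier M; y \<in> carrier M\<rbrakk> \<Longrightarrow> star \<alpha> x y \<in> carrier M"
  using bilin by (auto simp: bilinear_product_def)

text \<open>The error splits into the changes of the first factor, of the second factor and of the
  parameter. The bound that is uniform for \<open>norm \<beta> \<le> norm \<alpha> + 1\<close>
  controls the first two; entirety for fixed factors controls the last.\<close>

lemma limitin_star:
  assumes s: "limitin (seminorm_topology M I q) s x (at 0)"
    and t: "limitin (seminorm_topology M I q) t y (at 0)"
  shows "limitin (seminorm_topology M I q) (\<lambda>h. star (\<alpha> + h) (s h) (t h)) (star \<alpha> x y) (at 0)"
proof -
  have x: "x \<in> carrier M" and y: "y \<in> carrier M"
    and "\<forall>\<^sub>F h in at 0. s h \<in> carrier M" "\<forall>\<^sub>F h in at 0. t h \<in> carrier M"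
    using s t by (auto simp: limitin_seminorm_topology)
  then have ev: "\<forall>\<^sub>F h in at 0. s h \<in> carrier M \<and> t h \<in> carrier M"
    by (simp add: eventually_conj)
  have "((\<lambda>h. q i (star (\<alpha> + h) (s h) (t h) \<ominus> star \<alpha> x y)) \<longlongrightarrow> 0) (at 0)" if i: "i \<in> I" for i
  proof -
    obtain j C where j: "j \<in> I" and C: "\<And>\<beta> x y. \<lbrakk>norm \<beta> \<le> norm \<alpha> + 1; x \<in> carrier M; y \<in> carrier M\<rbrakk>
          \<Longrightarrow> q i (star \<beta> x y) \<le> C * q j x * q j y"
      using bound [OF i, of "norm \<alpha> + 1"] by metis
    define C' where "C' = max C 0"
    let ?g = "\<lambda>h. C' * q j (s h \<ominus> x) * (q j (t h \<ominus> y) + q j y) + C' * q j x * q j (t h \<ominus> y)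
                  + q i (star (\<alpha> + h) x y \<ominus> star \<alpha> x y)"
    have C': "q i (star \<beta> u v) \<le> C' * q j u * q j v"
      if "norm \<beta> \<le> norm \<alpha> + 1" "u \<in> carrier M" "v \<in> carrier M" for \<beta> u v
    proof -
      have "C * (q j u * q j v) \<le> C' * (q j u * q j v)"
        using that j seminorm_nonneg by (intro mult_right_mono) (auto simp: C'_def)
      then show ?thesis using C [OF that] by (simp add: mult.assoc)
    qed
    have small: "\<forall>\<^sub>F h in at (0::complex). norm h < 1"
      using order_tendstoD(2) [OF tendsto_norm_zero [OF tendsto_ident_at], of 1] by simp
    show ?thesis
    proof (rule tendsto_sandwich)
      show "\<forall>\<^sub>F h in at 0. 0 \<le> q i (star (\<alpha> + h) (s h) (t h) \<ominus> star \<alpha> x y)"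
        using ev by eventually_elim (use x y i star_closed in \<open>auto intro: seminorm_nonneg\<close>)
      show "\<forall>\<^sub>F h in at 0. q i (star (\<alpha> + h) (s h) (t h) \<ominus> star \<alpha> x y) \<le> ?g h"
        using ev small
      proof eventually_elim
        case (elim h)
        have n: "norm (\<alpha> + h) \<le> norm \<alpha> + 1"
          using norm_triangle_ineq [of \<alpha> h] elim by simp
        have "q i (star (\<alpha> + h) (s h) (t h) \<ominus> star \<alpha> x y)
            \<le> q i (star (\<alpha> + h) (s h) (t h) \<ominus> star (\<alpha> + h) x y) + q i (star (\<alpha> + h) x y \<ominus> star \<alpha> x y)"
          using elim x y i star_closed by (intro seminorm_minus_triangle) auto
        also have "q i (star (\<alpha> + h) (s h) (t h) \<ominus> star (\<alpha> + h) x y)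
            \<le> q i (star (\<alpha> + h) (s h \<ominus> x) (t h)) + q i (star (\<alpha> + h) x (t h \<ominus> y))"
          using elim x y i star_closed
          by (simp add: bilinear_minus_minus [OF bilin] seminorm_add)
        also have "q i (star (\<alpha> + h) (s h \<ominus> x) (t h)) \<le> C' * q j (s h \<ominus> x) * q j (t h)"
          using elim x n by (intro C') auto
        also have "\<dots> \<le> C' * q j (s h \<ominus> x) * (q j (t h \<ominus> y) + q j y)"
          using elim x y j
          by (intro mult_left_mono seminorm_le_minus mult_nonneg_nonneg seminorm_nonneg) (auto simp: C'_def)
        also have "q i (star (\<alpha> + h) x (t h \<ominus> y)) \<le> C' * q j x * q j (t h \<ominus> y)"
          using elim x y n by (intro C') auto
        finally show ?case by simp
      qed
      have "(?g \<longlongrightarrow> C' * 0 * (0 + q j y) + C' * q j x * 0 + 0) (at 0)"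
        using s t i j entire_functions_limit [OF entire [OF x y], of \<alpha>]
        by (intro tendsto_intros) (auto simp: limitin_seminorm_topology)
      then show "(?g \<longlongrightarrow> 0) (at 0)" by simp
    qed auto
  qed
  moreover have "\<forall>\<^sub>F h in at 0. star (\<alpha> + h) (s h) (t h) \<in> carrier M"
    using ev by eventually_elim (simp add: star_closed)
  ultimately show ?thesis
    using star_closed x y by (auto simp: limitin_seminorm_topology)
qed

lemma entire_functions_lift_product:
  assumes F: "F \<in> entire_functions M I q" and G: "G \<in> entire_functions M I q"
  shows "lift_product star F G \<in> entire_functions M I q"
proof -
  note [simp] = entire_functionsD [OF F] entire_functionsD [OF G] star_closed
  have "\<exists>d. limitin (seminorm_topology M I q)
         (\<lambda>h. inverse h \<odot> (star (\<alpha> + h) (F (\<alpha> + h)) (G (\<alpha> + h)) \<ominus> star \<alpha> (F \<alpha>) (G \<alpha>))) d (at 0)" for \<alpha>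
  proof -
    obtain d e where de: "limitin (seminorm_topology M I q) (\<lambda>h. inverse h \<odot> (F (\<alpha> + h) \<ominus> F \<alpha>)) d (at 0)"
        "limitin (seminorm_topology M I q) (\<lambda>h. inverse h \<odot> (G (\<alpha> + h) \<ominus> G \<alpha>)) e (at 0)"
      using F G unfolding entire_functions_def by blast
    obtain k where k: "limitin (seminorm_topology M I q)
          (\<lambda>h. inverse h \<odot> (star (\<alpha> + h) (F \<alpha>) (G \<alpha>) \<ominus> star \<alpha> (F \<alpha>) (G \<alpha>))) k (at 0)"
      using entire [of "F \<alpha>" "G \<alpha>"] unfolding entire_functions_def by auto
    \<comment> \<open>The product rule with three increments: of F, of G and of the parameter. The
      first two are evaluated at the shifted parameter \<alpha> + h, which is why
      \<open>limitin_star\<close> lets parameter and factors vary together.\<close>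
    have "inverse h \<odot> (star (\<alpha> + h) (F (\<alpha> + h)) (G (\<alpha> + h)) \<ominus> star \<alpha> (F \<alpha>) (G \<alpha>)) =
        star (\<alpha> + h) (inverse h \<odot> (F (\<alpha> + h) \<ominus> F \<alpha>)) (G (\<alpha> + h)) \<oplus>
        star (\<alpha> + h) (F \<alpha>) (inverse h \<odot> (G (\<alpha> + h) \<ominus> G \<alpha>)) \<oplus>
        inverse h \<odot> (star (\<alpha> + h) (F \<alpha>) (G \<alpha>) \<ominus> star \<alpha> (F \<alpha>) (G \<alpha>))" for h
    proof -
      have homog: "star (\<alpha> + h) (c \<odot> x) y = c \<odot> star (\<alpha> + h) x y"
          "star (\<alpha> + h) x (c \<odot> y) = c \<odot> star (\<alpha> + h) x y"
        if "x \<in> carrier M" "y \<in> carrier M" for c x y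
        using bilin [of "\<alpha> + h"] that by (auto simp: bilinear_product_def)
      show ?thesis
        by (simp add: homog smult_add_right [symmetric] bilinear_minus_minus [OF bilin, symmetric]
              minus_split [symmetric])
    qed
    moreover have "limitin (seminorm_topology M I q)
        (\<lambda>h. star (\<alpha> + h) (inverse h \<odot> (F (\<alpha> + h) \<ominus> F \<alpha>)) (G (\<alpha> + h)) \<oplus>
        star (\<alpha> + h) (F \<alpha>) (inverse h \<odot> (G (\<alpha> + h) \<ominus> G \<alpha>)) \<oplus>
        inverse h \<odot> (star (\<alpha> + h) (F \<alpha>) (G \<alpha>) \<ominus> star \<alpha> (F \<alpha>) (G \<alpha>)))
        (star \<alpha> d (G \<alpha>) \<oplus> star \<alpha> (F \<alpha>) e \<oplus> k) (at 0)"
      by (intro limitin_add limitin_star [OF de(1) entire_functions_limit [OF G]]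
            limitin_star [OF _ de(2)] k) simp
    ultimately show ?thesis by auto
  qed
  then show ?thesis
    unfolding entire_functions_def lift_product_def by auto
qed

lemma bilinear_lift_product: "bilinear_product (entire_module M I q) (lift_product star)"
proof -
  have "star \<alpha> (x \<oplus> y) z = star \<alpha> x z \<oplus> star \<alpha> y z" "star \<alpha> z (x \<oplus> y) = star \<alpha> z x \<oplus> star \<alpha> z y"
    if "x \<in> carrier M" "y \<in> carrier M" "z \<in> carrier M" for \<alpha> x y z
    using bilin [of \<alpha>] that by (auto simp: bilinear_product_def)
  moreover have "star \<alpha> (c \<odot> x) y = c \<odot> star \<alpha> x y" "star \<alpha> x (c \<odot> y) = c \<odot> star \<alpha> x y"
    if "x \<in> carrier M" "y \<in> carrier M" for \<alpha> c x y
    using bilin [of \<alpha>] that by (auto simp: bilinear_product_def)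
  ultimately show ?thesis
    unfolding bilinear_product_def
    by (auto simp: entire_module_def entire_functions_lift_product)
       (auto simp: lift_product_def entire_functionsD fun_eq_iff)
qed

text \<open>A compact K lies in a disc, where the bound on the products is uniform; taking suprema
  over K turns it into a bound by the seminorm with index (j, K).\<close>

lemma continuous_lift_product: "continuous_product (entire_topology M I q) (lift_product star)"
  unfolding entire_topology_def
proof (rule seminormed_space.continuous_productI [OF seminormed_space_entire_module bilinear_lift_product])
  fix iK assume "iK \<in> entire_index I"
  then obtain i K where iK: "iK = (i, K)" "i \<in> I" "compact K" "K \<noteq> {}"
    by (auto simp: entire_index_def)
  obtain \<rho> where \<rho>: "\<And>\<alpha>. \<alpha> \<in> K \<Longrightarrow> norm \<alpha> \<le> \<rho>"
    using compact_imp_bounded [OF iK(3)] by (auto simp: bounded_iff)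
  obtain j C where j: "j \<in> I" and C: "\<And>\<beta> x y. \<lbrakk>norm \<beta> \<le> \<rho>; x \<in> carrier M; y \<in> carrier M\<rbrakk>
          \<Longrightarrow> q i (star \<beta> x y) \<le> C * q j x * q j y"
    using bound [OF iK(2), of \<rho>] by metis
  define C' where "C' = max C 0"
  have "entire_seminorm q iK (lift_product star F G)
          \<le> C' * entire_seminorm q (j, K) F * entire_seminorm q (j, K) G"
    if "F \<in> carrier (entire_module M I q)" "G \<in> carrier (entire_module M I q)" for F G
  proof -
    have F: "F \<in> entire_functions M I q" and G: "G \<in> entire_functions M I q"
      using that by (auto simp: entire_module_def)
    have "(SUP \<alpha>\<in>K. q i (star \<alpha> (F \<alpha>) (G \<alpha>))) \<le> C' * (SUP \<alpha>\<in>K. q j (F \<alpha>)) * (SUP \<alpha>\<in>K. q j (G \<alpha>))"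
    proof (rule cSUP_least [OF iK(4)])
      fix \<alpha> assume \<alpha>: "\<alpha> \<in> K"
      note c = entire_functionsD [OF F, of \<alpha>] entire_functionsD [OF G, of \<alpha>]
      have up: "q j (F \<alpha>) \<le> (SUP \<alpha>\<in>K. q j (F \<alpha>))" "q j (G \<alpha>) \<le> (SUP \<alpha>\<in>K. q j (G \<alpha>))"
        using \<alpha> iK j bdd_above_entire_seminorm [OF F] bdd_above_entire_seminorm [OF G]
        by (auto intro: cSUP_upper)
      have nn: "0 \<le> q j (F \<alpha>)" "0 \<le> q j (G \<alpha>)" using j c by (auto intro: seminorm_nonneg)
      have "q i (star \<alpha> (F \<alpha>) (G \<alpha>)) \<le> C * (q j (F \<alpha>) * q j (G \<alpha>))"
        using C [OF \<rho> [OF \<alpha>] c] by (simp add: mult.assoc)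
      also have "\<dots> \<le> C' * (q j (F \<alpha>) * q j (G \<alpha>))"
        using nn by (intro mult_right_mono) (auto simp: C'_def)
      also have "\<dots> \<le> C' * ((SUP \<alpha>\<in>K. q j (F \<alpha>)) * (SUP \<alpha>\<in>K. q j (G \<alpha>)))"
        using up nn by (intro mult_left_mono mult_mono) (auto simp: C'_def)
      finally show "q i (star \<alpha> (F \<alpha>) (G \<alpha>)) \<le> C' * (SUP \<alpha>\<in>K. q j (F \<alpha>)) * (SUP \<alpha>\<in>K. q j (G \<alpha>))"
        by (simp add: mult.assoc)
    qed
    then show ?thesis by (simp add: iK entire_seminorm_def lift_product_def)
  qed
  moreover have "(j, K) \<in> entire_index I" using j iK by (simp add: entire_index_def)
  ultimately show "\<exists>j\<in>entire_index I. \<exists>k\<in>entire_index I. \<exists>C.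
       \<forall>F\<in>carrier (entire_module M I q). \<forall>G\<in>carrier (entire_module M I q).
          entire_seminorm q iK (lift_product star F G) \<le> C * entire_seminorm q j F * entire_seminorm q k G"
    by blast
qed

end

end

text \<open>By \<open>base\<close> the multiplication of M is the member \<alpha> = 0 of the family,
  so its bilinearity, associativity and continuity are instances of the assumptions and the Frechet
  algebra axioms need no separate verification.\<close>

lemma (in frechet_space) holomorphic_deformationI:
  assumes bilin: "\<And>\<alpha>. bilinear_product M (star \<alpha>)"
    and bound: "\<And>i \<rho>. i \<in> I \<Longrightarrow> \<exists>j\<in>I. \<exists>C. \<forall>\<alpha> x y. norm \<alpha> \<le> \<rho> \<longrightarrow> x \<in> carrier M \<longrightarrow> y \<in> carrier M
                  \<longrightarrow> q i (star \<alpha> x y) \<le> C * q j x * q j y"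
    and entire: "\<And>x y. \<lbrakk>x \<in> carrier M; y \<in> carrier M\<rbrakk> \<Longrightarrow> (\<lambda>\<alpha>. star \<alpha> x y) \<in> entire_functions M I q"
    and assoc: "\<And>\<alpha>. associative_on (carrier M) (star \<alpha>)"
    and base: "\<And>x y. \<lbrakk>x \<in> carrier M; y \<in> carrier M\<rbrakk> \<Longrightarrow> star 0 x y = x \<otimes> y"
  shows "holomorphic_deformation M I q star"
proof -
  have closed: "x \<otimes> y \<in> carrier M" if "x \<in> carrier M" "y \<in> carrier M" for x y
    using bilin [of 0] that by (auto simp: bilinear_product_def base [symmetric])
  have mult: "bilinear_product M (\<otimes>)"
    using bilin [of 0] by (auto simp: bilinear_product_def base)
  have "\<exists>j\<in>I. \<exists>k\<in>I. \<exists>C. \<forall>x\<in>carrier M. \<forall>y\<in>carrier M. q i (x \<otimes> y) \<le> C * q j x * q k y"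
    if "i \<in> I" for i
    using bound [OF that, of 0] base by (metis norm_zero order_refl)
  then have "continuous_product (seminorm_topology M I q) (\<otimes>)"
    by (intro continuous_productI mult)
  moreover have "associative_on (carrier M) (\<otimes>)"
    using assoc [of 0] closed by (auto simp: associative_on_def base)
  ultimately have alg: "frechet_algebra M I q"
    using mult by (intro frechet_algebra.intro frechet_space_axioms) (simp add: frechet_algebra_axioms_def)
  have homog: "star \<alpha> (c \<odot> x) y = c \<odot> star \<alpha> x y" "star \<alpha> x (c \<odot> y) = c \<odot> star \<alpha> x y"
    if "x \<in> carrier M" "y \<in> carrier M" for \<alpha> c x y
    using bilin [of \<alpha>] that by (auto simp: bilinear_product_def)
  show ?thesis
  proof (intro holomorphic_deformation.intro alg holomorphic_deformation_axioms.intro)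
    show "associative_on (entire_functions M I q) (lift_product star)"
      using assoc unfolding associative_on_def lift_product_def
      by (auto simp: entire_functionsD)
    show "bilinear_product (entire_module M I q) (lift_product star)"
      by (rule bilinear_lift_product [OF bilin bound entire])
    show "continuous_product (entire_topology M I q) (lift_product star)"
      by (rule continuous_lift_product [OF bilin bound entire])
  qed (auto simp: bilin base lift_product_def homog entire_functionsD)
qed

section \<open>Multiindices\<close>

lemma vec_le_iff: "I \<le> N \<longleftrightarrow> (\<forall>k. I $ k \<le> N $ k)"
  by (simp add: less_eq_vec_def)

lemma vec_le_sum_multiindex: "(K::nat^'m) \<le> N \<longleftrightarrow> (\<exists>L. N = K + L)"
proof
  assume "K \<le> N"
  then have "N = K + (N - K)" by (simp add: vec_eq_iff vec_le_iff)
  then show "\<exists>L. N = K + L" by blast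
qed (auto simp: vec_le_iff)

lemma vec_add_diff_multiindex [simp]: "(K::nat^'m) + L - K = L"
  by (simp add: vec_eq_iff)

lemma bij_betw_vec_nth_atMost:
  "bij_betw vec_nth {..N :: nat ^ 'm} (PiE UNIV (\<lambda>k. {..N $ k}))"
  by (rule bij_betw_byWitness [where f' = vec_lambda]) (auto simp: vec_le_iff PiE_def Pi_def)

lemma finite_atMost_multiindex [simp]: "finite {..N :: nat ^ 'm}"
  using bij_betw_finite [OF bij_betw_vec_nth_atMost [of N]] by (simp add: finite_PiE)

lemma sum_prod_multiindex:
  fixes f :: "'m::finite \<Rightarrow> nat \<Rightarrow> 'b::comm_semiring_1"
  shows "(\<Sum>I\<le>N. \<Prod>k\<in>UNIV. f k (I $ k)) = (\<Prod>k\<in>UNIV. \<Sum>i\<le>N $ k. f k i)"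
  using sum.reindex_bij_betw [OF bij_betw_vec_nth_atMost [of N], of "\<lambda>g. \<Prod>k\<in>UNIV. f k (g k)"]
  by (simp add: prod_sum_PiE)

text \<open>A finite set of multiindices lies in a box, and over a box the sum factorises into
  one-variable sums.\<close>

lemma summable_prod_multiindex:
  fixes f :: "'m::finite \<Rightarrow> nat \<Rightarrow> real"
  assumes nn: "\<And>k n. 0 \<le> f k n" and f: "\<And>k. summable (f k)"
  shows "(\<lambda>N :: nat ^ 'm. \<Prod>k\<in>UNIV. f k (N $ k)) summable_on UNIV"
proof (rule nonneg_bdd_above_summable_on)
  show "bdd_above (sum (\<lambda>N :: nat ^ 'm. \<Prod>k\<in>UNIV. f k (N $ k)) ` {F. F \<subseteq> UNIV \<and> finite F})"
  proof (rule bdd_aboveI2)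
    fix F :: "(nat ^ 'm) set" assume "F \<in> {F. F \<subseteq> UNIV \<and> finite F}"
    then have F: "finite F" by simp
    define B :: "nat ^ 'm" where "B = (\<chi> k. Max (insert 0 ((\<lambda>N. N $ k) ` F)))"
    have "F \<subseteq> {..B}" using F by (auto simp: B_def vec_le_iff)
    then have "(\<Sum>N\<in>F. \<Prod>k\<in>UNIV. f k (N $ k)) \<le> (\<Sum>N\<le>B. \<Prod>k\<in>UNIV. f k (N $ k))"
      using nn by (intro sum_mono2) (auto intro: prod_nonneg)
    also have "\<dots> = (\<Prod>k\<in>UNIV. \<Sum>i\<le>B $ k. f k i)" by (rule sum_prod_multiindex)
    also have "\<dots> \<le> (\<Prod>k\<in>UNIV. suminf (f k))"
      using nn f by (intro prod_mono) (auto intro: sum_nonneg sum_le_suminf)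
    finally show "(\<Sum>N\<in>F. \<Prod>k\<in>UNIV. f k (N $ k)) \<le> (\<Prod>k\<in>UNIV. suminf (f k))" .
  qed
qed (simp add: nn prod_nonneg)

abbreviation (input) rfact :: "nat ^ 'm \<Rightarrow> real" where
  "rfact N \<equiv> real (mfact N)"

lemma mfact_pos [simp]: "0 < mfact N" "mfact N \<noteq> 0"
  by (auto simp: mfact_def prod_pos)

lemma mfact_ge_1: "1 \<le> rfact N"
  using mfact_pos(1) [of N] by linarith

lemma mfact_0 [simp]: "mfact 0 = 1"
  by (simp add: mfact_def)

lemma mdegree_0 [simp]: "mdegree 0 = 0"
  by (simp add: mdegree_def)

lemma mdegree_add [simp]: "mdegree (N + K) = mdegree N + mdegree K"
  by (simp add: mdegree_def sum.distrib)

lemma power_mdegree: "c ^ mdegree N = (\<Prod>k\<in>UNIV. c ^ (N $ k))"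
  by (simp add: mdegree_def power_sum)

text \<open>Coordinatewise this is the bound 2^(n + k) for a binomial coefficient. It separates sums
  of indices at the price of an exponential.\<close>

lemma mfact_add_le: "mfact (N + K) \<le> 2 ^ mdegree (N + K) * (mfact N * mfact K)"
proof -
  have "fact (n + k) \<le> 2 ^ (n + k) * (fact n * fact k :: nat)" for n k :: nat
  proof -
    have "fact (n + k) = ((n + k) choose n) * (fact n * fact k :: nat)"
      using binomial_fact_lemma [of n "n + k"] by (simp add: ac_simps)
    also have "\<dots> \<le> 2 ^ (n + k) * (fact n * fact k)"
      by (intro mult_right_mono binomial_le_pow2) auto
    finally show ?thesis .
  qed
  then have "(\<Prod>k\<in>UNIV. fact (N $ k + K $ k)) \<le> (\<Prod>k\<in>UNIV. 2 ^ (N $ k + K $ k) * (fact (N $ k) * fact (K $ k) :: nat))"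
    by (intro prod_mono) auto
  then show ?thesis
    unfolding mfact_def power_mdegree by (simp add: prod.distrib)
qed

lemma mfact_mult_le: "mfact K * mfact L \<le> mfact (K + L)"
proof -
  have "fact (k::nat) * fact l \<le> (fact (k + l) :: nat)" for k l
    using fact_fact_dvd_fact [of k l] by (intro dvd_imp_le) auto
  then show ?thesis
    unfolding mfact_def by (simp add: prod.distrib [symmetric] prod_mono)
qed

lemma sum_mbinom: "(\<Sum>K\<le>N. real (mbinom N K)) = 2 ^ mdegree N"
proof -
  have "(\<Sum>K\<le>N. real (mbinom N K)) = (\<Prod>k\<in>UNIV. \<Sum>i\<le>N $ k. real ((N $ k) choose i))"
    unfolding mbinom_def of_nat_prod by (rule sum_prod_multiindex)
  also have "\<dots> = (\<Prod>k\<in>UNIV. 2 ^ (N $ k))"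
    by (simp add: choose_row_sum flip: of_nat_sum)
  finally show ?thesis by (simp add: power_mdegree)
qed

lemma mbinom_eq: "real (mbinom (K + L) K) * (mfact K * mfact L) = mfact (K + L)"
proof -
  have "((k + l) choose k) * (fact k * fact l) = (fact (k + l) :: nat)" for k l :: nat
    using binomial_fact_lemma [of k "k + l"] by (simp add: ac_simps)
  then have "mbinom (K + L) K * (mfact K * mfact L) = mfact (K + L)"
    by (simp add: mbinom_def mfact_def prod.distrib [symmetric])
  then show ?thesis by (metis of_nat_mult)
qed

text \<open>The substitution N = K + L turns free pairs into pairs with K \<le> N. Every Cauchy
  product and every Leibniz sum below is rearranged this way.\<close>

lemma has_sum_antidiagonal_iff:
  "((\<lambda>(K, L). F K L) has_sum s) (UNIV :: ((nat ^ 'm) \<times> (nat ^ 'm)) set) \<longleftrightarrow>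
   ((\<lambda>(N, K). F K (N - K)) has_sum s) (SIGMA N:UNIV. {..N})"
  by (rule has_sum_reindex_bij_witness
        [where i = "\<lambda>(N, K). (K, N - K)" and j = "\<lambda>(K, L). (K + L, K)"])
     (auto simp: vec_le_sum_multiindex)

lemma has_sum_antidiagonal:
  fixes F :: "nat ^ 'm \<Rightarrow> nat ^ 'm \<Rightarrow> 'b::{topological_comm_monoid_add,t3_space}"
  assumes "((\<lambda>(K, L). F K L) has_sum s) UNIV"
  shows "((\<lambda>N. \<Sum>K\<le>N. F K (N - K)) has_sum s) UNIV"
  by (rule has_sum_SigmaD [OF assms [unfolded has_sum_antidiagonal_iff]])
     (auto intro: has_sum_finiteI)

lemma summable_on_antidiagonal:
  fixes F :: "nat ^ 'm \<Rightarrow> nat ^ 'm \<Rightarrow> real"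
  assumes nn: "\<And>K L. 0 \<le> F K L" and "(\<lambda>N. \<Sum>K\<le>N. F K (N - K)) summable_on UNIV"
  shows "(\<lambda>(K, L). F K L) summable_on UNIV"
proof -
  have "(\<lambda>(N, K). F K (N - K)) summable_on (SIGMA N:UNIV. {..N})"
    by (rule summable_on_SigmaI [OF _ assms(2)]) (auto simp: nn intro: has_sum_finiteI)
  then show ?thesis
    unfolding summable_on_def has_sum_antidiagonal_iff .
qed

lemma summable_on_times:
  fixes f :: "'a \<Rightarrow> real" and g :: "'b \<Rightarrow> real"
  assumes "f summable_on UNIV" "g summable_on UNIV" "\<And>x. 0 \<le> f x" "\<And>x. 0 \<le> g x"
  shows "(\<lambda>(x, y). f x * g y) summable_on UNIV"
proof -
  have "(\<lambda>(x, y). f x * g y) summable_on (UNIV \<times> UNIV)"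
    by (rule summable_on_SigmaI [where g = "\<lambda>x. f x * infsum g UNIV"])
       (use assms in \<open>auto intro: has_sum_cmult_right summable_on_cmult_left\<close>)
  then show ?thesis by simp
qed

section \<open>Divided powers, and factorials against exponentials\<close>

definition divpow :: "complex ^ 'm \<Rightarrow> nat ^ 'm \<Rightarrow> complex" where
  "divpow w N = mpow w N / of_nat (mfact N)"

lemma divpow_0_right [simp]: "divpow w 0 = 1"
  by (simp add: divpow_def mpow_def)

lemma divpow_0_left: "divpow 0 N = (if N = 0 then 1 else 0)"
proof (cases "N = 0")
  case False
  then have "mpow 0 N = 0" by (auto simp: mpow_def vec_eq_iff)
  then show ?thesis using False by (simp add: divpow_def)
qed simp

lemma divpow_axis [simp]: "divpow w (axis k 1) = w $ k"
proof -
  have "(\<Prod>i\<in>UNIV. w $ i ^ axis k 1 $ i) = (\<Prod>i\<in>UNIV. if i = k then w $ k else 1)"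
    by (intro prod.cong) (auto simp: axis_def)
  moreover have "(\<Prod>i\<in>UNIV. fact (axis k 1 $ i)) = (1::nat)"
    by (intro prod.neutral) (auto simp: axis_def)
  ultimately show ?thesis by (simp add: divpow_def mpow_def mfact_def)
qed

lemma norm_divpow: "norm (divpow w N) = (\<Prod>k\<in>UNIV. norm (w $ k) ^ (N $ k)) / mfact N"
  by (simp add: divpow_def mpow_def norm_divide prod_norm [symmetric] norm_power)

lemma divpow_prod: "divpow w N = (\<Prod>k\<in>UNIV. (w $ k) ^ (N $ k) / fact (N $ k))"
  by (simp add: divpow_def mpow_def mfact_def prod_dividef)

text \<open>Once the factorials are absorbed into the powers, the binomial theorem has coefficients
  1 and becomes a Cauchy product over K + L = N.\<close>

lemma divpow_add: "divpow (u + v) N = (\<Sum>K\<le>N. divpow u K * divpow v (N - K))"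
proof -
  have 1: "(a + b) ^ n / fact n = (\<Sum>i\<le>n. (a ^ i / fact i) * (b ^ (n - i) / fact (n - i)))"
    for a b :: complex and n
  proof -
    have "(a + b) ^ n / fact n = (\<Sum>i\<le>n. of_nat (n choose i) * a ^ i * b ^ (n - i) / fact n)"
      by (simp add: binomial_ring sum_divide_distrib)
    also have "\<dots> = (\<Sum>i\<le>n. (a ^ i / fact i) * (b ^ (n - i) / fact (n - i)))"
      by (intro sum.cong) (auto simp: binomial_fact)
    finally show ?thesis .
  qed
  have "divpow (u + v) N
      = (\<Prod>k\<in>UNIV. \<Sum>i\<le>N $ k. (u $ k ^ i / fact i) * (v $ k ^ (N $ k - i) / fact (N $ k - i)))"
    by (simp add: divpow_prod 1)
  also have "\<dots> = (\<Sum>K\<le>N. \<Prod>k\<in>UNIV. (u $ k ^ (K $ k) / fact (K $ k)) *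
                   (v $ k ^ (N $ k - K $ k) / fact (N $ k - K $ k)))"
    by (rule sum_prod_multiindex [symmetric])
  also have "\<dots> = (\<Sum>K\<le>N. divpow u K * divpow v (N - K))"
    unfolding prod.distrib divpow_prod by simp
  finally show ?thesis .
qed

lemma divpow_mult_divpow:
  "divpow w K * divpow w L = of_nat (mbinom (K + L) K) * divpow w (K + L)"
proof -
  have "complex_of_real (real (mbinom (K + L) K) * (mfact K * mfact L)) = of_real (rfact (K + L))"
    by (simp only: mbinom_eq)
  then have "of_nat (mbinom (K + L) K) * (of_nat (mfact K) * of_nat (mfact L)) = (of_nat (mfact (K + L)) :: complex)"
    by simp
  moreover have "mpow w (K + L) = mpow w K * mpow w L"
    by (simp add: mpow_def power_add prod.distrib)
  ultimately show ?thesis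
    by (simp add: divpow_def field_simps)
qed

text \<open>Apply \<open>x ^ n \<le> n! exp x\<close> to \<open>x = c powr (1 / e)\<close>.\<close>

lemma power_mdegree_le_mfact_powr:
  assumes "0 < e" "0 \<le> c"
  obtains C where "0 < C" "\<And>N :: nat ^ 'm. c ^ mdegree N \<le> C * rfact N powr e"
proof -
  define x where "x = c powr (1 / e)"
  have x: "x ^ n \<le> fact n * exp x" for n
  proof -
    have "(x ^ n /\<^sub>R fact n) \<le> (\<Sum>k. x ^ k /\<^sub>R fact k)"
      using sum_le_suminf [OF summable_exp_generic [of x], of "{n}"] by (auto simp: x_def)
    then show ?thesis by (simp add: exp_def field_simps)
  qed
  have 1: "c ^ n \<le> exp (e * x) * fact n powr e" for n
  proof (cases "c = 0")
    case True then show ?thesis using assms by (auto simp: power_0_left x_def)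
  next
    case False
    have "c ^ n = (x ^ n) powr e"
      using assms False by (simp add: x_def powr_powr powr_realpow [symmetric])
    also have "\<dots> \<le> (fact n * exp x) powr e"
      using x [of n] assms by (intro powr_mono2) (auto simp: x_def)
    also have "\<dots> = exp (e * x) * fact n powr e"
      by (simp add: powr_mult exp_powr_real mult.commute)
    finally show ?thesis .
  qed
  have "c ^ mdegree N \<le> exp (e * x) ^ CARD('m) * rfact N powr e" for N :: "nat ^ 'm"
  proof -
    have "c ^ mdegree N \<le> (\<Prod>k\<in>(UNIV::'m set). exp (e * x) * fact (N $ k) powr e)"
      unfolding power_mdegree using 1 assms by (intro prod_mono) auto
    also have "\<dots> = exp (e * x) ^ CARD('m) * rfact N powr e"
      by (simp add: prod.distrib mfact_def prod_powr_distrib)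
    finally show ?thesis .
  qed
  then show thesis by (intro that [of "exp (e * x) ^ CARD('m)"]) auto
qed

text \<open>Applying the exponential bound to 2 c instead of c leaves a spare factor (1/2)^|N|,
  whose sum is a product of geometric series.\<close>

lemma summable_power_mfact_powr:
  assumes "0 \<le> c" "e < 0"
  shows "(\<lambda>N :: nat ^ 'm. c ^ mdegree N * rfact N powr e) summable_on UNIV"
proof -
  obtain C where C: "0 < C" "\<And>N :: nat ^ 'm. (2 * c) ^ mdegree N \<le> C * rfact N powr (- e)"
    by (rule power_mdegree_le_mfact_powr [where e = "- e" and c = "2 * c"]) (use assms in auto)
  have "(\<lambda>N :: nat ^ 'm. \<Prod>k\<in>UNIV. (1 / 2 :: real) ^ (N $ k)) summable_on UNIV"
    by (rule summable_prod_multiindex) (auto intro: summable_geometric)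
  then have "(\<lambda>N :: nat ^ 'm. C * (1 / 2) ^ mdegree N) summable_on UNIV"
    unfolding power_mdegree by (rule summable_on_cmult_right)
  then show ?thesis
  proof (rule summable_on_comparison_test)
    fix N :: "nat ^ 'm"
    have "c ^ mdegree N = (2 * c) ^ mdegree N * (1 / 2) ^ mdegree N"
      unfolding power_mult_distrib [symmetric] by simp
    also have "\<dots> \<le> (C * rfact N powr (- e)) * (1 / 2) ^ mdegree N"
      using C by (intro mult_right_mono) auto
    finally show "c ^ mdegree N * rfact N powr e \<le> C * (1 / 2) ^ mdegree N"
      by (simp add: powr_minus field_simps)
  qed (use assms in auto)
qed

section \<open>Expansions in the coordinates and their conjugates\<close>

definition dbl :: "complex ^ 'n \<Rightarrow> complex ^ ('n + 'n)" where
  "dbl z = (\<chi> i. case i of Inl k \<Rightarrow> z $ k | Inr k \<Rightarrow> cnj (z $ k))"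

definition mpair :: "nat ^ 'n \<Rightarrow> nat ^ 'n \<Rightarrow> nat ^ ('n + 'n)" where
  "mpair R S = (\<chi> i. case i of Inl k \<Rightarrow> R $ k | Inr k \<Rightarrow> S $ k)"

definition lpart :: "nat ^ ('n + 'n) \<Rightarrow> nat ^ 'n" where
  "lpart N = (\<chi> k. N $ Inl k)"

definition rpart :: "nat ^ ('n + 'n) \<Rightarrow> nat ^ 'n" where
  "rpart N = (\<chi> k. N $ Inr k)"

lemma sum_UNIV_Plus:
  fixes f :: "'n::finite + 'n \<Rightarrow> 'b::comm_monoid_add"
  shows "(\<Sum>i\<in>UNIV. f i) = (\<Sum>k\<in>UNIV. f (Inl k)) + (\<Sum>k\<in>UNIV. f (Inr k))"
  by (simp add: UNIV_Plus_UNIV [symmetric] sum.Plus del: UNIV_Plus_UNIV)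

lemma prod_UNIV_Plus:
  fixes f :: "'n::finite + 'n \<Rightarrow> 'b::comm_monoid_mult"
  shows "(\<Prod>i\<in>UNIV. f i) = (\<Prod>k\<in>UNIV. f (Inl k)) * (\<Prod>k\<in>UNIV. f (Inr k))"
  by (simp add: UNIV_Plus_UNIV [symmetric] prod.Plus del: UNIV_Plus_UNIV)

lemma parts_mpair [simp]: "lpart (mpair R S) = R" "rpart (mpair R S) = S" "mpair (lpart N) (rpart N) = N"
  by (auto simp: lpart_def rpart_def mpair_def vec_eq_iff split: sum.split)

lemma mpair_nth [simp]: "mpair R S $ Inl k = R $ k" "mpair R S $ Inr k = S $ k"
  by (simp_all add: mpair_def)

lemma dbl_nth [simp]: "dbl z $ Inl k = z $ k" "dbl z $ Inr k = cnj (z $ k)"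
  by (simp_all add: dbl_def)

lemma mpair_0 [simp]: "mpair 0 0 = 0"
  by (auto simp: vec_eq_iff mpair_def split: sum.split)

lemma mpair_add: "mpair R S + mpair R' S' = mpair (R + R') (S + S')"
  by (auto simp: vec_eq_iff mpair_def split: sum.split)

lemma bij_mpair: "bij (\<lambda>(R, S). mpair R S)"
  by (rule bij_betw_byWitness [where f' = "\<lambda>N. (lpart N, rpart N)"]) auto

lemma mfact_mpair [simp]: "mfact (mpair R S) = mfact R * mfact S"
  by (simp add: mfact_def prod_UNIV_Plus)

lemma mdegree_mpair [simp]: "mdegree (mpair R S) = mdegree R + mdegree S"
  by (simp add: mdegree_def sum_UNIV_Plus)

lemma mpow_mpair: "mpow (dbl z) (mpair R S) = mpow z R * cnj (mpow z S)"
  by (simp add: mpow_def prod_UNIV_Plus)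

lemma dbl_add: "dbl (u + v) = dbl u + dbl v"
  by (auto simp: vec_eq_iff dbl_def split: sum.split)

lemma dbl_0 [simp]: "dbl 0 = 0"
  by (auto simp: vec_eq_iff dbl_def split: sum.split)

lemma norm_dbl_nth_le: "norm (dbl z $ i) \<le> norm z"
  by (cases i) (auto intro: Finite_Cartesian_Product.norm_nth_le)

text \<open>A point inside a given ball with all coordinates nonzero: no monomial vanishes there, so
  coefficients and other monomials can be compared with the terms of the series at this
  point.\<close>

lemma small_constant_vector:
  assumes "0 < e"
  obtains t where "0 < t" "norm (\<chi> k. complex_of_real t :: complex ^ 'n) < e"
proof
  let ?t = "e / (2 * real CARD('n))"
  show "0 < ?t" using assms by simp
  have "norm (\<chi> k. complex_of_real ?t :: complex ^ 'n) \<le> (\<Sum>k\<in>(UNIV::'n set). \<bar>?t\<bar>)"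
    unfolding norm_vec_def by (rule order_trans [OF L2_set_le_sum])
      (simp_all only: vec_lambda_beta norm_of_real norm_ge_zero order_refl)
  also have "\<dots> < e" using assms by simp
  finally show "norm (\<chi> k. complex_of_real ?t :: complex ^ 'n) < e" .
qed

text \<open>Norms of monomials at v are values of monomials at \<open>vabs v\<close>, a point of the
  same norm and hence of the same ball about 0. Thus the binomial theorem can be applied to series
  of norms.\<close>

definition vabs :: "complex ^ 'm \<Rightarrow> complex ^ 'm" where
  "vabs v = (\<chi> k. of_real (norm (v $ k)))"

lemma norm_vabs [simp]: "norm (vabs v) = norm v"
  by (simp add: vabs_def norm_vec_def)

lemma dbl_vabs: "dbl (vabs v) = vabs (dbl v)"
  by (auto simp: vec_eq_iff vabs_def dbl_def split: sum.split)

lemma divpow_vabs: "divpow (vabs v) N = of_real (norm (divpow v N))"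
  by (simp add: norm_divpow) (simp add: divpow_def mpow_def vabs_def)

text \<open>The coefficients are normalised so that differentiation shifts them.\<close>

definition expands ::
    "(complex ^ 'n \<Rightarrow> complex) \<Rightarrow> (nat ^ ('n + 'n) \<Rightarrow> complex) \<Rightarrow> complex ^ 'n \<Rightarrow> real \<Rightarrow> bool" where
  "expands f a x r \<longleftrightarrow> (\<forall>u. norm u < r \<longrightarrow> ((\<lambda>N. a N * divpow (dbl u) N) has_sum f (x + u)) UNIV)"

lemma expandsD: "expands f a x r \<Longrightarrow> norm u < r \<Longrightarrow> ((\<lambda>N. a N * divpow (dbl u) N) has_sum f (x + u)) UNIV"
  by (simp add: expands_def)

lemma expands_mono: "expands f a x r \<Longrightarrow> s \<le> r \<Longrightarrow> expands f a x s"
  by (auto simp: expands_def)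

lemma expands_abs_summable:
  assumes "expands f a x r" "norm u < r"
  shows "(\<lambda>N. norm (a N) * norm (divpow (dbl u) N)) summable_on UNIV"
  using has_sum_imp_summable [OF expandsD [OF assms]]
  by (simp add: summable_on_iff_abs_summable_on_complex norm_mult)

text \<open>The point \<open>vabs v + vabs u\<close> still lies in the ball. The absolutely
  convergent series there, expanded by the binomial theorem, has nonnegative terms and is the
  Cauchy-product arrangement of the double series.\<close>

lemma expands_pairs_summable:
  assumes a: "expands f a x r" and uv: "norm u + norm v < r"
  shows "(\<lambda>(I, K). norm (a (I + K)) * norm (divpow (dbl v) I) * norm (divpow (dbl u) K)) summable_on UNIV"
proof (rule summable_on_antidiagonal)
  have "norm (vabs v + vabs u) < r"
    using norm_triangle_ineq [of "vabs v" "vabs u"] uv by simp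
  from expands_abs_summable [OF a this]
  have "(\<lambda>N. norm (a N) * norm (divpow (vabs (dbl v) + vabs (dbl u)) N)) summable_on UNIV"
    by (simp add: dbl_add dbl_vabs)
  moreover have "norm (divpow (vabs (dbl v) + vabs (dbl u)) N)
      = (\<Sum>K\<le>N. norm (divpow (dbl v) K) * norm (divpow (dbl u) (N - K)))" for N
    unfolding divpow_add divpow_vabs of_real_mult [symmetric] of_real_sum [symmetric] norm_of_real
    by (simp add: sum_nonneg)
  ultimately have "(\<lambda>N. \<Sum>K\<le>N. norm (a N) * norm (divpow (dbl v) K) *
                     norm (divpow (dbl u) (N - K))) summable_on UNIV"
    by (simp add: sum_distrib_left mult.assoc)
  moreover have "(\<Sum>K\<le>N. norm (a N) * norm (divpow (dbl v) K) * norm (divpow (dbl u) (N - K))) =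
      (\<Sum>K\<le>N. norm (a (K + (N - K))) * norm (divpow (dbl v) K) * norm (divpow (dbl u) (N - K)))" for N
    by (intro sum.cong) (auto simp: vec_le_sum_multiindex)
  ultimately show "(\<lambda>N. \<Sum>K\<le>N. norm (a (K + (N - K))) * norm (divpow (dbl v) K) *
                     norm (divpow (dbl u) (N - K))) summable_on UNIV"
    by simp
qed simp

text \<open>One row of the summable double series, divided by the monomial of index I at a small v
  with nonzero coordinates.\<close>

lemma expands_shift_summable:
  assumes a: "expands f a x r" and u: "norm u < r"
  shows "(\<lambda>K. norm (a (I + K)) * norm (divpow (dbl u) K)) summable_on UNIV"
proof -
  obtain t where "0 < t" and t: "norm (\<chi> k. complex_of_real t :: complex ^ 'a) < r - norm u"
    using small_constant_vector [of "r - norm u"] u by auto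
  define v :: "complex ^ 'a" where "v = (\<chi> k. of_real t)"
  have "norm u + norm v < r" using t by (simp add: v_def)
  from expands_pairs_summable [OF a this]
  have *: "(\<lambda>K. norm (a (I + K)) * norm (divpow (dbl v) I) * norm (divpow (dbl u) K)) summable_on UNIV"
    using summable_on_SigmaD1 [of "\<lambda>I K. norm (a (I + K)) * norm (divpow (dbl v) I) * norm (divpow (dbl u) K)" UNIV "\<lambda>_. UNIV" I]
    by simp
  have "dbl v $ i \<noteq> 0" for i
    using \<open>0 < t\<close> by (cases i) (auto simp: v_def)
  then have "norm (divpow (dbl v) I) \<noteq> 0"
    by (simp add: divpow_def mpow_def)
  then show ?thesis
    using summable_on_cmult_right [OF *, of "1 / norm (divpow (dbl v) I)"]
    by (simp add: field_simps)
qed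

text \<open>The derivative of order I of the series with coefficients a, evaluated at displacement
  u; for I = 0 it is the value of the series itself. In this form it also serves to construct
  functions with prescribed coefficients.\<close>

definition recentre :: "(nat ^ ('n + 'n) \<Rightarrow> complex) \<Rightarrow> complex ^ 'n \<Rightarrow> nat ^ ('n + 'n) \<Rightarrow> complex" where
  "recentre a u I = (\<Sum>\<^sub>\<infinity>K\<in>UNIV. a (I + K) * divpow (dbl u) K)"

lemma expands_shift:
  assumes a: "expands f a x r"
  shows "expands (\<lambda>y. recentre a (y - x) I) (\<lambda>K. a (I + K)) x r"
  unfolding expands_def recentre_def
proof (intro allI impI)
  fix u :: "complex ^ 'a" assume "norm u < r"
  then have "(\<lambda>K. a (I + K) * divpow (dbl u) K) summable_on UNIV"
    using expands_shift_summable [OF a] by (simp add: summable_on_iff_abs_summable_on_complex norm_mult)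
  then show "((\<lambda>K. a (I + K) * divpow (dbl u) K) has_sum
      (\<Sum>\<^sub>\<infinity>K. a (I + K) * divpow (dbl (x + u - x)) K)) UNIV"
    by (simp add: has_sum_infsum)
qed

text \<open>The double series over (I, K) is summed in two ways: along antidiagonals it gives the
  value of f at the displacement v + u, by rows it gives the series in v with recentred
  coefficients.\<close>

lemma expands_recentre:
  assumes a: "expands f a x r"
  shows "expands f (recentre a u) (x + u) (r - norm u)"
  unfolding expands_def
proof (intro allI impI)
  fix v :: "complex ^ 'a" assume v: "norm v < r - norm u"
  let ?F = "\<lambda>(I, K). a (I + K) * divpow (dbl v) I * divpow (dbl u) K"
  have "(\<lambda>p. norm (?F p)) summable_on UNIV"
    using expands_pairs_summable [OF a, of u v] v
    by (simp add: norm_mult case_prod_unfold)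
  then have F: "?F summable_on UNIV"
    using abs_summable_summable by blast
  then obtain S where S: "(?F has_sum S) UNIV"
    by (auto simp: summable_on_def)
  have "norm (v + u) < r" using v norm_triangle_ineq [of v u] by simp
  note 1 = expandsD [OF a this]
  have "(\<lambda>N. \<Sum>K\<le>N. a (K + (N - K)) * divpow (dbl v) K * divpow (dbl u) (N - K)) =
        (\<lambda>N. a N * divpow (dbl (v + u)) N)"
  proof
    fix N
    have "(\<Sum>K\<le>N. a (K + (N - K)) * divpow (dbl v) K * divpow (dbl u) (N - K)) =
        (\<Sum>K\<le>N. a N * divpow (dbl v) K * divpow (dbl u) (N - K))"
      by (intro sum.cong) (auto simp: vec_le_sum_multiindex)
    then show "(\<Sum>K\<le>N. a (K + (N - K)) * divpow (dbl v) K * divpow (dbl u) (N - K)) = a N * divpow (dbl (v + u)) N"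
      by (simp add: dbl_add divpow_add sum_distrib_left mult.assoc)
  qed
  with has_sum_antidiagonal [OF S]
  have "((\<lambda>N. a N * divpow (dbl (v + u)) N) has_sum S) UNIV" by simp
  with 1 have S_eq: "S = f (x + (v + u))" by (rule has_sum_unique [symmetric])
  have "((\<lambda>I. \<Sum>\<^sub>\<infinity>K. a (I + K) * divpow (dbl v) I * divpow (dbl u) K) has_sum S) UNIV"
  proof (rule has_sum_SigmaD)
    show "(?F has_sum S) (UNIV \<times> UNIV)" using S by simp
    show "((\<lambda>K. ?F (I, K)) has_sum (\<Sum>\<^sub>\<infinity>K. a (I + K) * divpow (dbl v) I * divpow (dbl u) K)) UNIV" for I
      using summable_on_SigmaD1 [of "\<lambda>I K. a (I + K) * divpow (dbl v) I * divpow (dbl u) K" UNIV "\<lambda>_. UNIV" I]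
        F by simp
  qed
  moreover have "(\<Sum>\<^sub>\<infinity>K. a (I + K) * divpow (dbl v) I * divpow (dbl u) K) = recentre a u I * divpow (dbl v) I" for I
    unfolding recentre_def infsum_cmult_left' [symmetric] by (simp add: mult_ac)
  ultimately show "((\<lambda>N. recentre a u N * divpow (dbl v) N) has_sum f (x + u + v)) UNIV"
    by (simp add: S_eq add_ac)
qed

section \<open>Values and derivatives of expansions\<close>

lemma expands_centre:
  assumes "expands f a x r" "0 < r"
  shows "f x = a 0"
proof -
  have "((\<lambda>N. a N * divpow 0 N) has_sum f x) UNIV"
    using expandsD [OF assms(1), of 0] assms(2) by simp
  moreover have "((\<lambda>N. a N * divpow 0 N) has_sum a 0) UNIV"
    by (rule has_sum_finite_neutralI [of "{0}"]) (auto simp: divpow_0_left)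
  ultimately show ?thesis by (rule has_sum_unique)
qed

text \<open>A term of degree at least 2 at h is at most (|h|/t)^2 times the norm of the same term at
  a vector v whose coordinates all have modulus t. Summing, the remainder after the linear terms is
  O(|h|^2).\<close>

lemma expands_has_derivative:
  assumes a: "expands f a x r" and "0 < r"
  shows "(f has_derivative (\<lambda>h. \<Sum>i\<in>UNIV. a (axis i 1) * dbl h $ i)) (at x)"
proof -
  obtain t where "0 < t" and t: "norm (\<chi> k. complex_of_real t :: complex ^ 'a) < r"
    using small_constant_vector [OF \<open>0 < r\<close>] by auto
  define v :: "complex ^ 'a" where "v = (\<chi> k. of_real t)"
  have v: "norm v < r" using t by (simp add: v_def)
  have norm_v: "norm (dbl v $ i) = t" for i
    using \<open>0 < t\<close> by (cases i) (auto simp: v_def)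
  define C where "C = (\<Sum>\<^sub>\<infinity>N. norm (a N) * norm (divpow (dbl v) N))"
  have sumC: "(\<lambda>N. norm (a N) * norm (divpow (dbl v) N)) summable_on UNIV"
    by (rule expands_abs_summable [OF a v])
  \<comment> \<open>The multiindices of degree at most 1, whose terms form the affine part of the
    series.\<close>
  define A :: "(nat ^ ('a + 'a)) set" where "A = insert 0 (range (\<lambda>i. axis i 1))"
  have A: "2 \<le> mdegree N" if "N \<notin> A" for N
  proof (rule ccontr)
    assume "\<not> 2 \<le> mdegree N"
    have "N \<noteq> 0" using that by (auto simp: A_def)
    then obtain i where i: "N $ i \<noteq> 0" by (auto simp: vec_eq_iff)
    have s: "mdegree N = N $ i + (\<Sum>j\<in>UNIV - {i}. N $ j)"
      unfolding mdegree_def by (rule sum.remove) auto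
    with i \<open>\<not> 2 \<le> mdegree N\<close> have "N $ i = 1" "(\<Sum>j\<in>UNIV - {i}. N $ j) = 0"
      by linarith+
    then have "N $ j = 0" if "j \<noteq> i" for j using that by simp
    with \<open>N $ i = 1\<close> have "N = axis i 1" by (auto simp: vec_eq_iff axis_def)
    then show False using that by (auto simp: A_def)
  qed
  have inj: "inj (\<lambda>i::'a + 'a. axis i (1::nat))"
    by (auto simp: inj_def axis_eq_axis)
  have sumA: "(\<Sum>N\<in>A. a N * divpow w N) = a 0 + (\<Sum>i\<in>UNIV. a (axis i 1) * w $ i)" for w
  proof -
    have "0 \<notin> range (\<lambda>i::'a + 'a. axis i (1::nat))"
      by (metis axis_eq_0_iff imageE zero_neq_one)
    then show ?thesis
      by (simp add: A_def sum.reindex [OF inj] del: One_nat_def)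
  qed
  have bound: "norm (f (x + h) - f x - (\<Sum>i\<in>UNIV. a (axis i 1) * dbl h $ i)) \<le> C / t\<^sup>2 * (norm h)\<^sup>2"
    if h: "norm h \<le> t" "norm h < r" for h
  proof -
    have "finite A" by (simp add: A_def)
    have "((\<lambda>N. a N * divpow (dbl h) N) has_sum (f (x + h) - (\<Sum>N\<in>A. a N * divpow (dbl h) N))) (UNIV - A)"
      by (rule has_sum_Diff [OF expandsD [OF a h(2)] has_sum_finiteI [OF \<open>finite A\<close>]]) auto
    then have 1: "((\<lambda>N. a N * divpow (dbl h) N) has_sum
        (f (x + h) - f x - (\<Sum>i\<in>UNIV. a (axis i 1) * dbl h $ i))) (UNIV - A)"
      by (simp add: sumA expands_centre [OF a \<open>0 < r\<close>] diff_diff_eq)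
    have termwise: "norm (a N * divpow (dbl h) N) \<le> (norm h)\<^sup>2 / t\<^sup>2 * (norm (a N) * norm (divpow (dbl v) N))"
      if N: "N \<in> UNIV - A" for N
    proof -
      have "(\<Prod>k\<in>UNIV. norm (dbl h $ k) ^ (N $ k)) \<le> (\<Prod>k\<in>UNIV. norm h ^ (N $ k))"
        by (intro prod_mono) (auto intro: power_mono norm_dbl_nth_le)
      also have "\<dots> = norm h ^ mdegree N" by (simp add: power_mdegree)
      also have "\<dots> = (norm h)\<^sup>2 * norm h ^ (mdegree N - 2)"
        using A [of N] N by (metis DiffD2 le_add_diff_inverse power_add)
      also have "\<dots> \<le> (norm h)\<^sup>2 * t ^ (mdegree N - 2)"
        using h by (intro mult_left_mono power_mono) auto
      also have "t ^ (mdegree N - 2) = t ^ mdegree N / t\<^sup>2"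
        using A [of N] N \<open>0 < t\<close> by (simp add: power_diff)
      finally have "(\<Prod>k\<in>UNIV. norm (dbl h $ k) ^ (N $ k)) \<le> (norm h)\<^sup>2 / t\<^sup>2 * t ^ mdegree N"
        by simp
      from divide_right_mono [OF this, of "rfact N"]
      have "norm (divpow (dbl h) N) \<le> (norm h)\<^sup>2 / t\<^sup>2 * norm (divpow (dbl v) N)"
        unfolding norm_divpow norm_v by (simp add: power_mdegree)
      from mult_left_mono [OF this norm_ge_zero [of "a N"]]
      show ?thesis by (simp add: norm_mult mult.left_commute)
    qed
    have sum': "(\<lambda>N. (norm h)\<^sup>2 / t\<^sup>2 * (norm (a N) * norm (divpow (dbl v) N))) summable_on UNIV"
      by (intro summable_on_cmult_right sumC)
    have "norm (f (x + h) - f x - (\<Sum>i\<in>UNIV. a (axis i 1) * dbl h $ i))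
        \<le> (\<Sum>\<^sub>\<infinity>N\<in>UNIV - A. (norm h)\<^sup>2 / t\<^sup>2 * (norm (a N) * norm (divpow (dbl v) N)))"
      by (rule norm_infsum_le [OF 1 has_sum_infsum termwise])
         (rule summable_on_subset_banach [OF sum' subset_UNIV])
    also have "\<dots> \<le> (\<Sum>\<^sub>\<infinity>N\<in>UNIV. (norm h)\<^sup>2 / t\<^sup>2 * (norm (a N) * norm (divpow (dbl v) N)))"
      by (intro infsum_mono2 summable_on_subset_banach [OF sum'] sum') auto
    also have "\<dots> = C / t\<^sup>2 * (norm h)\<^sup>2"
      unfolding C_def infsum_cmult_right' by simp
    finally show ?thesis .
  qed
  have lin: "bounded_linear (\<lambda>h. \<Sum>i\<in>UNIV. a (axis i 1) * dbl h $ i)"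
  proof (intro bounded_linear_sum bounded_linear_const_mult)
    fix i :: "'a + 'a"
    show "bounded_linear (\<lambda>h :: complex ^ 'a. dbl h $ i)"
      by (cases i) (auto intro: bounded_linear_vec_nth bounded_linear_compose [OF bounded_linear_cnj])
  qed
  show ?thesis
    unfolding has_derivative_at_within
  proof (intro conjI lin)
    show "((\<lambda>y. ((f y - f x) - (\<Sum>i\<in>UNIV. a (axis i 1) * dbl (y - x) $ i)) /\<^sub>R norm (y - x)) \<longlongrightarrow> 0) (at x)"
    proof (rule Lim_null_comparison)
      have "\<forall>\<^sub>F y in at x. dist y x < min t r"
        using \<open>0 < t\<close> \<open>0 < r\<close> unfolding eventually_at by (intro exI [of _ "min t r"]) auto
      then show "\<forall>\<^sub>F y in at x. norm (((f y - f x) - (\<Sum>i\<in>UNIV. a (axis i 1) * dbl (y - x) $ i)) /\<^sub>R norm (y - x))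
                  \<le> C / t\<^sup>2 * norm (y - x)"
      proof eventually_elim
        case (elim y)
        show ?case
        proof (cases "y = x")
          case False
          have "norm (X /\<^sub>R n) \<le> K * n" if "norm X \<le> K * n\<^sup>2" "0 < n" for X :: complex and n K
            using that by (simp add: divide_simps power2_eq_square mult_ac)
          from this [OF bound [of "y - x"]] False elim
          show ?thesis by (simp add: dist_norm)
        qed simp
      qed
      have "((\<lambda>y. C / t\<^sup>2 * norm (y - x)) \<longlongrightarrow> C / t\<^sup>2 * norm (x - x)) (at x)"
        by (intro tendsto_intros)
      then show "((\<lambda>y. C / t\<^sup>2 * norm (y - x)) \<longlongrightarrow> 0) (at x)" by simp
    qed
  qed
qed

lemma expands_recentre':
  "expands f a x r \<Longrightarrow> expands f (recentre a (y - x)) y (r - norm (y - x))"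
  using expands_recentre [of f a x r "y - x"] by simp

lemma expands_has_derivative':
  assumes "expands f a x r" "norm (y - x) < r"
  shows "(f has_derivative (\<lambda>h. \<Sum>i\<in>UNIV. recentre a (y - x) (axis i 1) * dbl h $ i)) (at y)"
  using assms by (intro expands_has_derivative [OF expands_recentre']) auto

lemma expands_dir_deriv_eq:
  assumes "expands f a x r" "norm (y - x) < r"
  shows "dir_deriv v f y = (\<Sum>i\<in>UNIV. recentre a (y - x) (axis i 1) * dbl v $ i)"
  unfolding dir_deriv_def frechet_derivative_at [OF expands_has_derivative' [OF assms], symmetric] ..

lemma expands_cong:
  assumes "expands f a x r" "\<And>y. norm (y - x) < r \<Longrightarrow> g y = f y"
  shows "expands g a x r"
  using assms by (simp add: expands_def)

lemma expands_add:
  "expands f a x r \<Longrightarrow> expands g b x r \<Longrightarrow> expands (\<lambda>y. f y + g y) (\<lambda>N. a N + b N) x r"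
  by (simp add: expands_def has_sum_add distrib_right)

lemma expands_cmult: "expands f a x r \<Longrightarrow> expands (\<lambda>y. c * f y) (\<lambda>N. c * a N) x r"
  by (simp add: expands_def has_sum_cmult_right mult.assoc)

lemma expands_diff:
  "expands f a x r \<Longrightarrow> expands g b x r \<Longrightarrow> expands (\<lambda>y. f y - g y) (\<lambda>N. a N - b N) x r"
  using expands_add [of f a x r "\<lambda>y. (-1) * g y" "\<lambda>N. (-1) * b N"] expands_cmult [of g b x r "-1"]
  by simp

lemma expands_zero: "expands (\<lambda>_. 0) (\<lambda>_. 0) x r"
  by (simp add: expands_def)

lemma expands_sum:
  "finite A \<Longrightarrow> (\<And>i. i \<in> A \<Longrightarrow> expands (f i) (a i) x r)
    \<Longrightarrow> expands (\<lambda>y. \<Sum>i\<in>A. f i y) (\<lambda>N. \<Sum>i\<in>A. a i N) x r"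
  by (induction A rule: finite_induct) (auto intro: expands_zero expands_add)

lemma expands_dir_deriv:
  assumes "expands f a x r"
  shows "expands (dir_deriv v f) (\<lambda>N. \<Sum>i\<in>UNIV. dbl v $ i * a (axis i 1 + N)) x r"
proof (rule expands_cong)
  show "expands (\<lambda>y. \<Sum>i\<in>UNIV. dbl v $ i * recentre a (y - x) (axis i 1))
          (\<lambda>N. \<Sum>i\<in>UNIV. dbl v $ i * a (axis i 1 + N)) x r"
    by (rule expands_sum, simp, rule expands_cmult, rule expands_shift, rule assms)
qed (simp add: expands_dir_deriv_eq [OF assms] mult.commute)

lemma sum_dbl_axis:
  fixes b :: "'n::finite + 'n \<Rightarrow> complex"
  shows "(\<Sum>i\<in>UNIV. b i * dbl (axis k c) $ i) = b (Inl k) * c + b (Inr k) * cnj c"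
proof -
  have "(\<Sum>j\<in>UNIV. b (Inl j) * axis k c $ j) = b (Inl k) * c"
    using sum.delta [of "UNIV::'n set" k "\<lambda>j. b (Inl j) * c"]
    by (simp add: axis_def if_distrib cong: if_cong)
  moreover have "(\<Sum>j\<in>UNIV. b (Inr j) * cnj (axis k c $ j)) = b (Inr k) * cnj c"
    using sum.delta [of "UNIV::'n set" k "\<lambda>j. b (Inr j) * cnj c"]
    by (simp add: axis_def if_distrib cong: if_cong)
  ultimately show ?thesis by (simp add: sum_UNIV_Plus)
qed

text \<open>Along \<open>axis k c\<close> the derivative is a combination of c and its conjugate;
  combining c = 1 with c = \<i> isolates one of the two coefficients, and this coefficient is a
  shifted expansion.\<close>

lemma expands_wirtinger:
  assumes "expands f a x r"
  shows "expands (wirtinger k f) (\<lambda>N. a (axis (Inl k) 1 + N)) x r"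
    and "expands (wirtinger_bar k f) (\<lambda>N. a (axis (Inr k) 1 + N)) x r"
proof -
  show "expands (wirtinger k f) (\<lambda>N. a (axis (Inl k) 1 + N)) x r"
    by (rule expands_cong [OF expands_shift [OF assms, of "axis (Inl k) 1"]])
       (simp only: wirtinger_def expands_dir_deriv_eq [OF assms] sum_dbl_axis,
        simp add: algebra_simps)
  show "expands (wirtinger_bar k f) (\<lambda>N. a (axis (Inr k) 1 + N)) x r"
    by (rule expands_cong [OF expands_shift [OF assms, of "axis (Inr k) 1"]])
       (simp only: wirtinger_bar_def expands_dir_deriv_eq [OF assms] sum_dbl_axis,
        simp add: algebra_simps)
qed

lemma indices: "distinct (indices :: 'n::finite list)" "set (indices :: 'n list) = UNIV"
  using someI_ex [of "\<lambda>ks :: 'n list. distinct ks \<and> set ks = UNIV"] finite_distinct_list [of "UNIV :: 'n set"]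
  by (auto simp: indices_def)

text \<open>One induction serves both blocks of Wirtinger derivatives; \<open>D\<close> and \<open>c\<close> are instantiated
  with \<^const>\<open>wirtinger\<close> and \<^const>\<open>Inl\<close>, respectively \<^const>\<open>wirtinger_bar\<close> and \<^const>\<open>Inr\<close>.\<close>

lemma expands_foldr:
  fixes D :: "'n::finite \<Rightarrow> (complex ^ 'n \<Rightarrow> complex) \<Rightarrow> complex ^ 'n \<Rightarrow> complex" and c :: "'n \<Rightarrow> 'n + 'n"
  assumes D: "\<And>f a k. expands f a x r \<Longrightarrow> expands (D k f) (\<lambda>N. a (axis (c k) 1 + N)) x r"
    and f: "expands f a x r"
  shows "expands (foldr (\<lambda>k. D k ^^ (R $ k)) ks f)
           (\<lambda>N. a ((\<Sum>k\<leftarrow>ks. axis (c k) (R $ k)) + N)) x r"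
proof (induction ks)
  case (Cons k ks)
  have "expands ((D k ^^ n) g) (\<lambda>N. b (axis (c k) n + N)) x r" if "expands g b x r" for n g b
  proof (induction n)
    case (Suc n)
    have "axis (c k) n + (axis (c k) 1 + N) = axis (c k) (Suc n) + N" for N :: "nat ^ ('n + 'n)"
      by (auto simp: vec_eq_iff axis_def)
    with D [OF Suc, of k] show ?case by (simp del: One_nat_def)
  qed (use that in \<open>simp add: axis_def vec_eq_iff [symmetric] zero_vec_def [symmetric]\<close>)
  from this [OF Cons] show ?case by (simp add: add_ac)
qed (use f in simp)

lemma sum_list_axis:
  "(\<Sum>k\<leftarrow>indices. axis (Inl k) (R $ k)) = mpair R 0"
  "(\<Sum>k\<leftarrow>indices. axis (Inr k) (R $ k)) = mpair 0 R"
proof -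
  have "(\<Sum>k\<leftarrow>indices. axis (c k) (R $ k)) $ i = (\<Sum>k\<in>UNIV. axis (c k) (R $ k) $ i)"
    for c :: "'a \<Rightarrow> 'a + 'a" and i
    by (simp add: sum_list_distinct_conv_sum_set indices)
  then show "(\<Sum>k\<leftarrow>indices. axis (Inl k) (R $ k)) = mpair R 0"
    "(\<Sum>k\<leftarrow>indices. axis (Inr k) (R $ k)) = mpair 0 R"
    by (auto simp: vec_eq_iff mpair_def axis_def split: sum.split)
qed

lemma expands_mderiv:
  assumes "expands f a x r"
  shows "expands (mderiv R S f) (\<lambda>N. a (mpair R S + N)) x r"
proof -
  have "expands (foldr (\<lambda>k. wirtinger_bar k ^^ (S $ k)) indices f) (\<lambda>N. a (mpair 0 S + N)) x r"
    using expands_foldr [where D = wirtinger_bar and c = Inr and R = S and ks = indices, OF expands_wirtinger(2) assms] by (simp add: sum_list_axis)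
  from expands_foldr [where D = wirtinger and c = Inl and R = R and ks = indices, OF expands_wirtinger(1) this]
  have "expands (mderiv R S f) (\<lambda>N. a (mpair 0 S + (mpair R 0 + N))) x r"
    by (simp add: sum_list_axis mderiv_def)
  then show ?thesis by (simp add: mpair_add add.assoc [symmetric])
qed

section \<open>Jets, real-analytic functions and the identity theorem\<close>

definition jet :: "(complex ^ 'n \<Rightarrow> complex) \<Rightarrow> complex ^ 'n \<Rightarrow> nat ^ ('n + 'n) \<Rightarrow> complex" where
  "jet f x N = mderiv (lpart N) (rpart N) f x"

lemma jet_mpair: "jet f x (mpair R S) = mderiv R S f x"
  by (simp add: jet_def)

text \<open>Differentiation of order N shifts the coefficients by N, and at the centre only the
  zeroth coefficient survives. In particular the coefficients are unique.\<close>

lemma expands_imp_jet: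
  assumes "expands f a x r" "0 < r"
  shows "a = jet f x"
proof
  show "a N = jet f x N" for N
    using expands_centre [OF expands_mderiv [OF assms(1)] assms(2), of "lpart N" "rpart N"]
    by (simp add: jet_def)
qed

lemma expands_jet: "expands f a x r \<Longrightarrow> 0 < r \<Longrightarrow> expands f (jet f x) x r"
  using expands_imp_jet by blast

lemma expands_jet_recentre:
  assumes "expands f a x r" "norm (y - x) < r"
  shows "expands f (jet f y) y (r - norm (y - x))" "jet f y = recentre a (y - x)"
  using expands_recentre' [OF assms(1), of y] assms(2) expands_imp_jet by fastforce+

text \<open>The two kinds of series differ only by the bijection between pairs of indices and
  doubled indices and by the factor N! absorbed into the divided powers.\<close>

lemma real_analytic_iff: "real_analytic f \<longleftrightarrow> (\<forall>x. \<exists>r>0. \<exists>a. expands f a x r)"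
proof -
  have 1: "((\<lambda>(R, S). c R S * mpow z R * cnj (mpow z S)) has_sum s) UNIV \<longleftrightarrow>
        ((\<lambda>N. (c (lpart N) (rpart N) * of_nat (mfact N)) * divpow (dbl z) N) has_sum s) UNIV"
    for c :: "nat ^ 'a \<Rightarrow> nat ^ 'a \<Rightarrow> complex" and z s
  proof -
    have "((\<lambda>N. (c (lpart N) (rpart N) * of_nat (mfact N)) * divpow (dbl z) N) has_sum s) UNIV \<longleftrightarrow>
          ((\<lambda>p. (case p of (R, S) \<Rightarrow> c R S * mpow z R * cnj (mpow z S))) has_sum s) UNIV"
      by (subst has_sum_reindex_bij_betw [OF bij_mpair, symmetric])
         (simp add: divpow_def mpow_mpair case_prod_unfold mult.assoc)
    then show ?thesis by simp
  qed
  have 2: "(\<forall>y\<in>ball x r. P y (y - x)) \<longleftrightarrow> (\<forall>u. norm u < r \<longrightarrow> P (x + u) u)"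
    for x :: "complex ^ 'a" and r P
  proof (intro iffI allI impI ballI)
    fix u :: "complex ^ 'a" assume "\<forall>y\<in>ball x r. P y (y - x)" "norm u < r"
    then have "P (x + u) (x + u - x)" by (elim bspec) (simp add: dist_norm)
    then show "P (x + u) u" by simp
  next
    fix y assume *: "\<forall>u. norm u < r \<longrightarrow> P (x + u) u" "y \<in> ball x r"
    then have "norm (y - x) < r" by (simp add: dist_norm norm_minus_commute)
    with * have "P (x + (y - x)) (y - x)" by blast
    then show "P y (y - x)" by simp
  qed
  have 3: "(\<forall>y\<in>ball x r. ((\<lambda>(R, S). c R S * mpow (y - x) R * cnj (mpow (y - x) S)) has_sum f y) UNIV)
      \<longleftrightarrow> expands f (\<lambda>N. c (lpart N) (rpart N) * of_nat (mfact N)) x r" for c x r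
    unfolding 1 expands_def
    by (rule 2 [where P = "\<lambda>y u. ((\<lambda>N. c (lpart N) (rpart N) * of_nat (mfact N) * divpow (dbl u) N) has_sum f y) UNIV"])
  have "(\<exists>c. expands f (\<lambda>N. c (lpart N) (rpart N) * of_nat (mfact N)) x r) \<longleftrightarrow> (\<exists>a. expands f a x r)" for x r
  proof
    assume "\<exists>a. expands f a x r"
    then obtain a where "expands f a x r" by blast
    then show "\<exists>c. expands f (\<lambda>N. c (lpart N) (rpart N) * of_nat (mfact N)) x r"
      by (intro exI [of _ "\<lambda>R S. a (mpair R S) / of_nat (mfact (mpair R S))"]) (simp del: mfact_mpair)
  qed blast
  then show ?thesis unfolding real_analytic_def 3 by simp
qed

lemma real_analytic_diff: "real_analytic f \<Longrightarrow> real_analytic g \<Longrightarrow> real_analytic (\<lambda>x. f x - g x)"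
  unfolding real_analytic_iff
proof
  fix x assume f: "\<forall>x. \<exists>r>0. \<exists>a. expands f a x r" and g: "\<forall>x. \<exists>r>0. \<exists>a. expands g a x r"
  obtain r a s b where "0 < r" "expands f a x r" "0 < s" "expands g b x s" using f g by metis
  then have "0 < min r s" "expands (\<lambda>x. f x - g x) (\<lambda>N. a N - b N) x (min r s)"
    using expands_diff [OF expands_mono [of f a x r "min r s"] expands_mono [of g b x s "min r s"]]
    by auto
  then show "\<exists>r>0. \<exists>a. expands (\<lambda>x. f x - g x) a x r" by blast
qed

text \<open>Directional derivatives of an expansion expand again on the same ball, so iterating them
  never shrinks the radius.\<close>

lemma real_analytic_imp_smooth:
  assumes "real_analytic f"
  shows "smooth f"
  unfolding smooth_def
proof (intro allI)
  fix vs x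
  obtain r a where r: "0 < r" "expands f a x r" using assms unfolding real_analytic_iff by metis
  have "\<exists>b. expands (foldr dir_deriv vs f) b x r"
  proof (induction vs)
    case (Cons v vs)
    then obtain b where "expands (foldr dir_deriv vs f) b x r" by blast
    from expands_dir_deriv [OF this, of v] show ?case by (simp only: foldr_Cons o_apply) (rule exI)
  qed (use r in auto)
  then show "foldr dir_deriv vs f differentiable (at x)"
    using expands_has_derivative r(1) differentiableI by blast
qed

text \<open>The points at which all derivatives vanish form an open and closed set.\<close>

lemma real_analytic_identity:
  fixes f :: "complex ^ 'n \<Rightarrow> complex"
  assumes f: "real_analytic f" and p: "jet f p = (\<lambda>_. 0)"
  shows "f x = 0"
proof -
  define Z where "Z = {x. jet f x = (\<lambda>_. 0)}"
  have near: "f y = 0" "y \<in> Z" if "expands f (jet f x) x r" "x \<in> Z" "norm (y - x) < r" for x y r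
  proof -
    from that have e: "expands f (\<lambda>_. 0) x r" by (simp add: Z_def)
    have "((\<lambda>N :: nat ^ ('n + 'n). 0) has_sum f y) UNIV" using expandsD [OF e that(3)] by simp
    then show "f y = 0" using has_sum_0_simp has_sum_unique by blast
    show "y \<in> Z"
      using expands_jet_recentre(2) [OF e that(3)] by (simp add: Z_def recentre_def fun_eq_iff)
  qed
  have ex: "\<exists>r>0. expands f (jet f x) x r" for x
    using f expands_jet unfolding real_analytic_iff by blast
  have "open Z"
    unfolding open_dist
  proof
    fix x assume "x \<in> Z"
    then show "\<exists>e>0. \<forall>y. dist y x < e \<longrightarrow> y \<in> Z"
      using ex [of x] near(2) by (auto simp: dist_norm)
  qed
  moreover have "open (- Z)"
    unfolding open_dist
  proof
    fix x assume "x \<in> - Z"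
    obtain r where r: "0 < r" "expands f (jet f x) x r" using ex by blast
    \<comment> \<open>The expansion about y has radius greater than 2 r / 3, hence reaches back to
      x; a zero jet at y would therefore give a zero jet at x.\<close>
    have "y \<in> - Z" if "dist y x < r / 3" for y
    proof
      assume "y \<in> Z"
      have "expands f (jet f y) y (r - norm (y - x))"
        using r that by (intro expands_jet_recentre(1)) (auto simp: dist_norm)
      moreover have "norm (x - y) < r - norm (y - x)"
        using that r by (simp add: dist_norm norm_minus_commute)
      ultimately have "x \<in> Z" using near(2) \<open>y \<in> Z\<close> by blast
      with \<open>x \<in> - Z\<close> show False by simp
    qed
    then show "\<exists>e>0. \<forall>y. dist y x < e \<longrightarrow> y \<in> - Z" using r by (intro exI [of _ "r / 3"]) auto
  qed
  moreover have "p \<in> Z" using p by (simp add: Z_def)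
  ultimately have "Z = UNIV"
    using connected_clopen [of "UNIV :: (complex ^ 'n) set"] by (auto simp: closed_def)
  with ex [of x] near(1) [of x _ x] show ?thesis by auto
qed

lemma jet_diff:
  assumes "expands f a x r" "expands g b x r" "0 < r"
  shows "jet (\<lambda>y. f y - g y) x N = jet f x N - jet g x N"
  using expands_imp_jet [OF expands_diff [OF assms(1,2)] assms(3)] expands_imp_jet [OF assms(1,3)]
    expands_imp_jet [OF assms(2,3)] by metis

section \<open>The Wick seminorms\<close>

lemma smooth_differentiable: "smooth f \<Longrightarrow> f differentiable (at x)"
  unfolding smooth_def by (metis foldr_Nil id_apply)

lemma smooth_dir_deriv: "smooth f \<Longrightarrow> smooth (dir_deriv v f)"
  unfolding smooth_def
proof (intro allI)
  fix vs x assume "\<forall>vs x. foldr dir_deriv vs f differentiable (at x)"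
  then have "foldr dir_deriv (vs @ [v]) f differentiable (at x)" by blast
  then show "foldr dir_deriv vs (dir_deriv v f) differentiable (at x)" by simp
qed

lemma dir_deriv_lincomb:
  assumes "\<And>x. f differentiable (at x)" "\<And>x. g differentiable (at x)"
  shows "dir_deriv v (\<lambda>x. c * f x + d * g x) = (\<lambda>x. c * dir_deriv v f x + d * dir_deriv v g x)"
proof
  fix x
  have "((\<lambda>x. c * f x + d * g x) has_derivative
      (\<lambda>h. c * frechet_derivative f (at x) h + d * frechet_derivative g (at x) h)) (at x)"
    using assms by (intro has_derivative_add has_derivative_mult_right)
      (simp_all add: frechet_derivative_works [symmetric])
  from frechet_derivative_at [OF this]
  show "dir_deriv v (\<lambda>x. c * f x + d * g x) x = c * dir_deriv v f x + d * dir_deriv v g x"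
    by (simp add: dir_deriv_def fun_eq_iff)
qed

lemma smooth_lincomb:
  assumes f: "smooth f" and g: "smooth g"
  shows "smooth (\<lambda>x. c * f x + d * g x)"
  unfolding smooth_def
proof (intro allI)
  fix vs x
  have "foldr dir_deriv vs (\<lambda>x. c * f x + d * g x)
      = (\<lambda>x. c * foldr dir_deriv vs f x + d * foldr dir_deriv vs g x)"
  proof (induction vs)
    case (Cons v vs)
    have "dir_deriv v (\<lambda>x. c * foldr dir_deriv vs f x + d * foldr dir_deriv vs g x) =
        (\<lambda>x. c * dir_deriv v (foldr dir_deriv vs f) x + d * dir_deriv v (foldr dir_deriv vs g) x)"
      using f g by (intro dir_deriv_lincomb) (auto simp: smooth_def)
    with Cons show ?case by simp
  qed simp
  then show "foldr dir_deriv vs (\<lambda>x. c * f x + d * g x) differentiable (at x)"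
    using f g by (simp add: smooth_def)
qed

text \<open>Linearity of differentiation holds only on smooth functions, so it is bundled with
  preservation of smoothness; the bundle, unlike linearity alone, is stable under
  composition.\<close>

definition smooth_linear ::
    "((complex ^ 'n \<Rightarrow> complex) \<Rightarrow> complex ^ 'n \<Rightarrow> complex) \<Rightarrow> bool" where
  "smooth_linear D \<longleftrightarrow> (\<forall>f. smooth f \<longrightarrow> smooth (D f)) \<and>
     (\<forall>f g c d. smooth f \<longrightarrow> smooth g \<longrightarrow> D (\<lambda>x. c * f x + d * g x) = (\<lambda>x. c * D f x + d * D g x))"

lemma smooth_linear_comp: "smooth_linear D \<Longrightarrow> smooth_linear E \<Longrightarrow> smooth_linear (\<lambda>f. D (E f))"
  by (simp add: smooth_linear_def)

lemma smooth_linear_id: "smooth_linear (\<lambda>f. f)"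
  by (simp add: smooth_linear_def)

lemma smooth_linear_funpow: "smooth_linear D \<Longrightarrow> smooth_linear (D ^^ n)"
  by (induction n) (auto intro: smooth_linear_comp smooth_linear_id simp: id_def o_def)

lemma smooth_linear_foldr: "(\<And>k. smooth_linear (D k)) \<Longrightarrow> smooth_linear (foldr D ks)"
  by (induction ks) (auto intro: smooth_linear_comp smooth_linear_id simp: id_def o_def)

lemma smooth_linear_wirtinger: "smooth_linear (wirtinger k)" "smooth_linear (wirtinger_bar k)"
proof -
  have 1: "smooth_linear (\<lambda>f x. (1/2) * dir_deriv v f x + b * dir_deriv w f x)"
    for v w :: "complex ^ 'a" and b
    unfolding smooth_linear_def
  proof (intro conjI allI impI)
    fix f g :: "complex ^ 'a \<Rightarrow> complex" and c d
    show "smooth (\<lambda>x. (1/2) * dir_deriv v f x + b * dir_deriv w f x)" if "smooth f"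
      using that by (intro smooth_lincomb smooth_dir_deriv)
    assume "smooth f" "smooth g"
    then have "dir_deriv u (\<lambda>x. c * f x + d * g x) = (\<lambda>x. c * dir_deriv u f x + d * dir_deriv u g x)" for u
      by (intro dir_deriv_lincomb smooth_differentiable)
    then show "(\<lambda>x. (1/2) * dir_deriv v (\<lambda>x. c * f x + d * g x) x + b * dir_deriv w (\<lambda>x. c * f x + d * g x) x)
        = (\<lambda>x. c * ((1/2) * dir_deriv v f x + b * dir_deriv w f x) + d * ((1/2) * dir_deriv v g x + b * dir_deriv w g x))"
      by (simp add: algebra_simps)
  qed
  have eq: "wirtinger k = (\<lambda>f x. (1/2) * dir_deriv (axis k 1) f x + (-\<i>/2) * dir_deriv (axis k \<i>) f x)"
      "wirtinger_bar k = (\<lambda>f x. (1/2) * dir_deriv (axis k 1) f x + (\<i>/2) * dir_deriv (axis k \<i>) f x)"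
    by (auto simp: fun_eq_iff wirtinger_def wirtinger_bar_def field_simps)
  show "smooth_linear (wirtinger k)" "smooth_linear (wirtinger_bar k)"
    unfolding eq by (rule 1)+
qed

lemma mderiv_lincomb:
  assumes "smooth f" "smooth g"
  shows "mderiv R S (\<lambda>x. c * f x + d * g x) x = c * mderiv R S f x + d * mderiv R S g x"
proof -
  have "smooth_linear (mderiv R S)"
    unfolding mderiv_def
    by (rule smooth_linear_comp;
        rule smooth_linear_foldr, rule smooth_linear_funpow, rule smooth_linear_wirtinger)
  then show ?thesis using assms by (simp add: smooth_linear_def)
qed

lemma mderiv_cmult: "smooth f \<Longrightarrow> mderiv R S (\<lambda>x. c * f x) x = c * mderiv R S f x"
  using mderiv_lincomb [of f f R S c 0 x] by simp

section \<open>Sums with values in [0, infinity]\<close>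

lemma infsum_ennreal_eq_SUP:
  fixes f :: "'a \<Rightarrow> ennreal"
  shows "infsum f A = (SUP F\<in>{F. finite F \<and> F \<subseteq> A}. sum f F)"
  by (simp add: nonneg_infsum_complete)

lemma infsum_cmult_ennreal:
  fixes f :: "'a \<Rightarrow> ennreal"
  shows "(\<Sum>\<^sub>\<infinity>x\<in>A. c * f x) = c * infsum f A"
  unfolding infsum_ennreal_eq_SUP sum_distrib_left [symmetric]
  by (rule SUP_mult_left_ennreal [symmetric])

lemma le_infsum_ennreal:
  fixes f :: "'a \<Rightarrow> ennreal"
  assumes "x \<in> A"
  shows "f x \<le> infsum f A"
  using assms unfolding infsum_ennreal_eq_SUP by (intro SUP_upper2 [of "{x}"]) auto

lemma infsum_ennreal:
  assumes "f summable_on A" "\<And>x. x \<in> A \<Longrightarrow> 0 \<le> f x"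
  shows "(\<Sum>\<^sub>\<infinity>x\<in>A. ennreal (f x)) = ennreal (infsum f A)"
proof -
  have "ennreal (infsum f A) = (SUP F\<in>{F. finite F \<and> F \<subseteq> A}. ennreal (sum f F))"
    using assms by (intro infsum_nonneg_is_SUPREMUM_ennreal) auto
  also have "\<dots> = (SUP F\<in>{F. finite F \<and> F \<subseteq> A}. \<Sum>x\<in>F. ennreal (f x))"
    by (intro SUP_cong refl sum_ennreal [symmetric]) (use assms(2) in auto)
  finally show ?thesis by (simp add: infsum_ennreal_eq_SUP)
qed

lemma infsum_le_lincomb_ennreal:
  fixes f g h :: "'a \<Rightarrow> ennreal"
  assumes "\<And>x. x \<in> A \<Longrightarrow> h x \<le> c * f x + d * g x"
  shows "infsum h A \<le> c * infsum f A + d * infsum g A"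
proof -
  have "infsum h A \<le> (\<Sum>\<^sub>\<infinity>x\<in>A. c * f x + d * g x)"
    using assms by (intro infsum_mono nonneg_summable_on_complete) auto
  also have "\<dots> = (\<Sum>\<^sub>\<infinity>x\<in>A. c * f x) + (\<Sum>\<^sub>\<infinity>x\<in>A. d * g x)"
    by (intro infsum_add nonneg_summable_on_complete) auto
  finally show ?thesis by (simp add: infsum_cmult_ennreal)
qed

section \<open>Convexity, homogeneity and the triangle inequality\<close>

lemma ennreal_square_convex:
  assumes "0 < s" "0 < t" "s + t = 1"
  shows "(ennreal s * x + ennreal t * y)\<^sup>2 \<le> ennreal s * x\<^sup>2 + ennreal t * y\<^sup>2"
proof (cases x; cases y)
  fix a b :: real
  assume ab: "0 \<le> a" "x = ennreal a" "0 \<le> b" "y = ennreal b"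
  have "s * a\<^sup>2 + t * b\<^sup>2 - (s * a + t * b)\<^sup>2 = s * t * (a - b)\<^sup>2"
  proof -
    have t: "t = 1 - s" using assms(3) by simp
    show ?thesis unfolding t by (simp add: power2_eq_square algebra_simps)
  qed
  then have "(s * a + t * b)\<^sup>2 \<le> s * a\<^sup>2 + t * b\<^sup>2"
    using assms by (smt (verit) mult_nonneg_nonneg zero_le_power2)
  then show ?thesis
    using ab assms
    by (simp add: ennreal_mult [symmetric] ennreal_plus [symmetric] ennreal_power ennreal_leI del: ennreal_plus)
qed (use assms in \<open>auto simp: ennreal_mult_top ennreal_mult_eq_top_iff power2_eq_square\<close>)

text \<open>Each recursion step forms sums with nonnegative coefficients and squares; these are
  monotone and respect the convexity inequality, which therefore passes from one level to the next.
  Subadditivity of h itself is not to be expected, since h has degree 2^(m+1) in f.\<close>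

lemma wick_h_convex:
  fixes p :: "complex ^ 'n"
  assumes fg: "smooth f" "smooth g" and st: "0 < s" "0 < t" "s + t = 1" and hbar: "0 < hbar"
  shows "wick_h p hbar (\<lambda>x. of_real s * f x + of_real t * g x) m l R S
           \<le> ennreal s * wick_h p hbar f m l R S + ennreal t * wick_h p hbar g m l R S"
proof (induction m arbitrary: l R S)
  case 0
  have "ennreal ((2 * hbar) ^ d / rfact N *
          (norm (of_real s * mderiv R (N + S) f p + of_real t * mderiv R (N + S) g p))\<^sup>2)
      \<le> ennreal s * ennreal ((2 * hbar) ^ d / rfact N * (norm (mderiv R (N + S) f p))\<^sup>2)
       + ennreal t * ennreal ((2 * hbar) ^ d / rfact N * (norm (mderiv R (N + S) g p))\<^sup>2)"
    (is "ennreal (?w * _) \<le> ennreal s * ennreal (?w * ?a\<^sup>2) + ennreal t * ennreal (?w * ?b\<^sup>2)")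
    for N :: "nat ^ 'n" and d
  proof -
    have "norm (of_real s * mderiv R (N + S) f p + of_real t * mderiv R (N + S) g p) \<le> s * ?a + t * ?b"
      using st by (intro norm_triangle_le) (simp add: norm_mult)
    then have "(norm (of_real s * mderiv R (N + S) f p + of_real t * mderiv R (N + S) g p))\<^sup>2
        \<le> (s * ?a + t * ?b)\<^sup>2"
      by (intro power_mono) auto
    then have "?w * (norm (of_real s * mderiv R (N + S) f p + of_real t * mderiv R (N + S) g p))\<^sup>2
        \<le> ?w * (s * ?a + t * ?b)\<^sup>2"
      using hbar by (intro mult_left_mono) auto
    then have "ennreal (?w * (norm (of_real s * mderiv R (N + S) f p + of_real t * mderiv R (N + S) g p))\<^sup>2)
        \<le> ennreal ?w * (ennreal s * ennreal ?a + ennreal t * ennreal ?b)\<^sup>2"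
      using st hbar
      by (simp add: ennreal_mult [symmetric] ennreal_plus [symmetric] ennreal_power ennreal_leI
           del: ennreal_plus)
    also have "\<dots> \<le> ennreal ?w * (ennreal s * (ennreal ?a)\<^sup>2 + ennreal t * (ennreal ?b)\<^sup>2)"
      by (intro mult_left_mono ennreal_square_convex st) auto
    also have "\<dots> = ennreal s * ennreal (?w * ?a\<^sup>2) + ennreal t * ennreal (?w * ?b\<^sup>2)"
    proof -
      have "0 \<le> ?w" using hbar by simp
      then show ?thesis
        unfolding ennreal_mult [OF \<open>0 \<le> ?w\<close> zero_le_power2] ennreal_power [OF norm_ge_zero]
        by (simp only: distrib_left mult_ac)
    qed
    finally show ?thesis .
  qed
  then show ?case
    unfolding wick_h.simps mderiv_lincomb [OF fg] by (intro infsum_le_lincomb_ennreal)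
next
  case (Suc m)
  let ?h = "\<lambda>k I J. if even l then wick_h p hbar k m (l div 2) I J else wick_h p hbar k m ((l - 1) div 2) J I"
  let ?k = "\<lambda>x. of_real s * f x + of_real t * g x"
  let ?T = "\<lambda>k N. \<Sum>I\<le>R. \<Sum>J\<le>N + S. of_nat (mbinom R I * mbinom (N + S) J) * ?h k I J"
  have h: "?h ?k I J \<le> ennreal s * ?h f I J + ennreal t * ?h g I J" for I J
    using Suc by simp
  have "ennreal (1 / rfact N) * (?T ?k N)\<^sup>2
      \<le> ennreal s * (ennreal (1 / rfact N) * (?T f N)\<^sup>2)
       + ennreal t * (ennreal (1 / rfact N) * (?T g N)\<^sup>2)" for N
  proof -
    have "?T ?k N \<le> (\<Sum>I\<le>R. \<Sum>J\<le>N + S. of_nat (mbinom R I * mbinom (N + S) J) *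
              (ennreal s * ?h f I J + ennreal t * ?h g I J))"
      by (intro sum_mono mult_left_mono h) auto
    also have "\<dots> = ennreal s * ?T f N + ennreal t * ?T g N"
      by (simp only: distrib_left sum.distrib sum_distrib_left mult.left_commute)
    finally have "(?T ?k N)\<^sup>2 \<le> (ennreal s * ?T f N + ennreal t * ?T g N)\<^sup>2"
      by (intro power_mono) auto
    also have "\<dots> \<le> ennreal s * (?T f N)\<^sup>2 + ennreal t * (?T g N)\<^sup>2"
      by (intro ennreal_square_convex st)
    finally have "ennreal (1 / rfact N) * (?T ?k N)\<^sup>2
        \<le> ennreal (1 / rfact N) * (ennreal s * (?T f N)\<^sup>2 + ennreal t * (?T g N)\<^sup>2)"
      by (intro mult_left_mono) auto
    then show ?thesis by (simp only: distrib_left mult.left_commute)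
  qed
  then show ?case
    unfolding wick_h.simps by (intro infsum_le_lincomb_ennreal)
qed

lemma wick_h_cmult:
  fixes p :: "complex ^ 'n"
  assumes f: "smooth f" and hbar: "0 < hbar"
  shows "wick_h p hbar (\<lambda>x. c * f x) m l R S = ennreal (norm c ^ 2 ^ Suc m) * wick_h p hbar f m l R S"
proof (induction m arbitrary: l R S)
  case 0
  have "ennreal ((2 * hbar) ^ d / rfact N * (norm (c * mderiv R (N + S) f p))\<^sup>2)
      = ennreal ((norm c)\<^sup>2) * ennreal ((2 * hbar) ^ d / rfact N * (norm (mderiv R (N + S) f p))\<^sup>2)"
    for N :: "nat ^ 'n" and d
    using hbar by (simp add: ennreal_mult [symmetric] norm_mult power_mult_distrib)
  then show ?case
    by (simp add: mderiv_cmult [OF f] infsum_cmult_ennreal)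
next
  case (Suc m)
  let ?c = "ennreal (norm c ^ 2 ^ Suc m)"
  let ?h = "\<lambda>k I J. if even l then wick_h p hbar k m (l div 2) I J else wick_h p hbar k m ((l - 1) div 2) J I"
  let ?T = "\<lambda>k N. \<Sum>I\<le>R. \<Sum>J\<le>N + S. of_nat (mbinom R I * mbinom (N + S) J) * ?h k I J"
  have "?h (\<lambda>x. c * f x) I J = ?c * ?h f I J" for I J
    using Suc by simp
  then have T: "?T (\<lambda>x. c * f x) N = ?c * ?T f N" for N
    by (simp only: sum_distrib_left mult.left_commute)
  have "?c\<^sup>2 = ennreal (norm c ^ 2 ^ Suc (Suc m))"
    by (simp add: ennreal_power power_mult [symmetric] mult.commute)
  then show ?case
    unfolding wick_h.simps T power_mult_distrib infsum_cmult_ennreal [symmetric]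
    by (simp only: mult.left_commute)
qed

lemma wick_indices_iff: "(m, l, R, S) \<in> wick_indices \<longleftrightarrow> l < 2 ^ m"
  by (simp add: wick_indices_def)

lemma wick_functions_iff:
  "f \<in> wick_functions p hbar \<longleftrightarrow> smooth f \<and> (\<forall>m l R S. l < 2 ^ m \<longrightarrow> wick_h p hbar f m l R S < \<infinity>)"
  by (auto simp: wick_functions_def wick_indices_def)

lemma wick_functions_smooth: "f \<in> wick_functions p hbar \<Longrightarrow> smooth f"
  by (simp add: wick_functions_iff)

lemma wick_seminorm_cmult:
  assumes "smooth f" "0 < hbar"
  shows "wick_seminorm p hbar i (\<lambda>x. c * f x) = norm c * wick_seminorm p hbar i f"
proof -
  obtain m l R S where i: "i = (m, l, R, S)" by (metis surj_pair)
  have "(norm c ^ 2 ^ Suc m) powr (1 / 2 ^ (m + 1)) = norm c"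
    by (cases "c = 0") (simp_all add: powr_realpow [symmetric] powr_powr del: power_Suc)
  then show ?thesis
    by (simp add: i wick_seminorm_def wick_h_cmult [OF assms] enn2real_mult powr_mult del: power_Suc)
qed

lemma wick_h_le_seminorm:
  assumes "wick_h p hbar f m l R S < \<infinity>" "wick_seminorm p hbar (m, l, R, S) f \<le> x" "0 < x"
  shows "wick_h p hbar f m l R S \<le> ennreal (x ^ 2 ^ Suc m)"
proof -
  obtain h where h: "wick_h p hbar f m l R S = ennreal h" "0 \<le> h"
    using assms(1) by (cases "wick_h p hbar f m l R S") auto
  have "h = (h powr (1 / 2 ^ Suc m)) powr (2 ^ Suc m)"
    using h by (simp add: powr_powr del: power_Suc)
  also have "\<dots> \<le> x powr (2 ^ Suc m)"
    using assms h by (intro powr_mono2) (auto simp: wick_seminorm_def)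
  also have "\<dots> = x ^ 2 ^ Suc m"
    using powr_realpow [OF assms(3), of "2 ^ Suc m"] by simp
  finally show ?thesis by (simp add: h ennreal_leI del: power_Suc)
qed

lemma wick_seminorm_le:
  assumes "wick_h p hbar f m l R S \<le> ennreal (x ^ 2 ^ Suc m)" "0 \<le> x"
  shows "wick_seminorm p hbar (m, l, R, S) f \<le> x"
proof -
  have "enn2real (wick_h p hbar f m l R S) \<le> x ^ 2 ^ Suc m"
    using assms enn2real_mono [OF assms(1)] by simp
  then have "wick_seminorm p hbar (m, l, R, S) f \<le> (x ^ 2 ^ Suc m) powr (1 / 2 ^ Suc m)"
    by (simp add: wick_seminorm_def powr_mono2)
  also have "\<dots> = x"
    using assms(2) by (cases "x = 0") (simp_all add: powr_realpow [symmetric] powr_powr del: power_Suc)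
  finally show ?thesis .
qed

text \<open>The Minkowski functional argument: f / x and g / y have h at most 1, hence so has their
  convex combination with weights x / (x + y) and y / (x + y); this combination times x + y is f +
  g.\<close>

lemma wick_add_le:
  assumes f: "f \<in> wick_functions p hbar" and g: "g \<in> wick_functions p hbar" and hbar: "0 < hbar"
    and l: "l < 2 ^ m" and x: "wick_seminorm p hbar (m, l, R, S) f \<le> x" "0 < x"
    and y: "wick_seminorm p hbar (m, l, R, S) g \<le> y" "0 < y"
  shows "wick_h p hbar (\<lambda>z. f z + g z) m l R S \<le> ennreal ((x + y) ^ 2 ^ Suc m)"
proof -
  define s t where "s = x / (x + y)" and "t = y / (x + y)"
  have st: "0 < s" "0 < t" "s + t = 1" using x y by (auto simp: s_def t_def add_divide_distrib [symmetric])
  note [simp] = wick_functions_smooth [OF f] wick_functions_smooth [OF g]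
  have scaled: "wick_h p hbar (\<lambda>z. of_real (1 / r) * k z) m l R S \<le> 1"
    if "smooth k" "wick_h p hbar k m l R S \<le> ennreal (r ^ 2 ^ Suc m)" "0 < r" for k r
  proof -
    have "wick_h p hbar (\<lambda>z. of_real (1 / r) * k z) m l R S
        \<le> ennreal ((1 / r) ^ 2 ^ Suc m) * ennreal (r ^ 2 ^ Suc m)"
      unfolding wick_h_cmult [OF that(1) hbar] norm_of_real abs_of_pos [OF divide_pos_pos [OF zero_less_one that(3)]]
      using that by (intro mult_left_mono) auto
    also have "\<dots> = ennreal (((1 / r) * r) ^ 2 ^ Suc m)"
      using that by (subst ennreal_mult [symmetric]) (simp_all add: power_mult_distrib [symmetric] del: power_Suc)
    finally show ?thesis using that by simp
  qed
  have fin: "wick_h p hbar f m l R S < \<infinity>" "wick_h p hbar g m l R S < \<infinity>"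
    using f g l by (auto simp: wick_functions_iff)
  have sm: "smooth (\<lambda>z. of_real (1 / x) * f z)" "smooth (\<lambda>z. of_real (1 / y) * g z)"
    using smooth_lincomb [of f f "of_real (1 / x)" 0] smooth_lincomb [of g g "of_real (1 / y)" 0] by auto
  let ?k = "\<lambda>z. of_real s * (of_real (1 / x) * f z) + of_real t * (of_real (1 / y) * g z)"
  have k: "wick_h p hbar ?k m l R S \<le> ennreal s * 1 + ennreal t * 1"
    by (rule order_trans [OF wick_h_convex [OF sm st hbar]])
       (intro add_mono mult_left_mono scaled wick_h_le_seminorm fin x y; simp)
  have "smooth ?k" by (rule smooth_lincomb [OF sm])
  have "wick_h p hbar (\<lambda>z. of_real (x + y) * ?k z) m l R S \<le> ennreal ((x + y) ^ 2 ^ Suc m) * (ennreal s * 1 + ennreal t * 1)"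
    unfolding wick_h_cmult [OF \<open>smooth ?k\<close> hbar] norm_of_real abs_of_pos [OF add_pos_pos [OF x(2) y(2)]]
    by (intro mult_left_mono k) auto
  also have "ennreal s * 1 + ennreal t * 1 = 1"
    using st by (simp add: ennreal_plus [symmetric] del: ennreal_plus)
  also have "(\<lambda>z. of_real (x + y) * ?k z) = (\<lambda>z. f z + g z)"
  proof
    fix z
    have "complex_of_real (x + y) * (of_real s * of_real (1 / x)) = 1"
        "complex_of_real (x + y) * (of_real t * of_real (1 / y)) = 1"
      using x y unfolding of_real_mult [symmetric] s_def t_def by auto
    then show "of_real (x + y) * ?k z = f z + g z"
      by (metis distrib_left mult.assoc mult_1)
  qed
  finally show ?thesis by simp
qed

lemma wick_seminorm_add:
  assumes f: "f \<in> wick_functions p hbar" and g: "g \<in> wick_functions p hbar" and hbar: "0 < hbar"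
    and i: "i \<in> wick_indices"
  shows "wick_seminorm p hbar i (\<lambda>x. f x + g x) \<le> wick_seminorm p hbar i f + wick_seminorm p hbar i g"
proof (rule field_le_epsilon)
  fix e :: real assume "0 < e"
  obtain m l R S where [simp]: "i = (m, l, R, S)" by (metis surj_pair)
  have l: "l < 2 ^ m" using i by (simp add: wick_indices_iff)
  have nn: "0 \<le> wick_seminorm p hbar i k" for k by (simp add: wick_seminorm_def)
  \<comment> \<open>The scaling argument divides by the two bounds, which must be positive even if a
    seminorm is zero; hence e / 2 is added to each.\<close>
  have pos: "0 < wick_seminorm p hbar i k + e / 2" for k
    using nn [of k] \<open>0 < e\<close> by (intro add_nonneg_pos) auto
  have "wick_seminorm p hbar i (\<lambda>x. f x + g x)
      \<le> (wick_seminorm p hbar i f + e / 2) + (wick_seminorm p hbar i g + e / 2)"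
    using pos [of f] pos [of g] \<open>0 < e\<close> unfolding \<open>i = (m, l, R, S)\<close>
    by (intro wick_seminorm_le [OF wick_add_le [OF f g hbar l]]) auto
  then show "wick_seminorm p hbar i (\<lambda>x. f x + g x) \<le> wick_seminorm p hbar i f + wick_seminorm p hbar i g + e"
    by simp
qed

section \<open>Bounds on the jet control every seminorm\<close>

definition jet_bound ::
    "complex ^ 'n \<Rightarrow> (complex ^ 'n \<Rightarrow> complex) \<Rightarrow> real \<Rightarrow> real \<Rightarrow> bool" where
  "jet_bound p f A e \<longleftrightarrow> (\<forall>N. norm (jet f p N) \<le> A * rfact N powr e)"

lemma mdegree_mono: "K \<le> N \<Longrightarrow> mdegree K \<le> mdegree N"
  by (auto simp: vec_le_sum_multiindex)

lemma mfact_mono: "K \<le> N \<Longrightarrow> mfact K \<le> mfact N"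
proof -
  assume "K \<le> N"
  then obtain L where N: "N = K + L" by (auto simp: vec_le_sum_multiindex)
  have "mfact K * 1 \<le> mfact K * mfact L"
    by (intro mult_left_mono) (simp_all add: Suc_leI)
  from order_trans [OF this mfact_mult_le] show ?thesis by (simp add: N)
qed

lemma mfact_add_powr_le:
  assumes "0 \<le> e" "e \<le> 1"
  shows "rfact (N + K) powr e \<le> 2 ^ (mdegree N + mdegree K) * (rfact N powr e * rfact K powr e)"
proof -
  have "rfact (N + K) \<le> 2 ^ mdegree (N + K) * (rfact N * rfact K)"
    using mfact_add_le [of N K] by (metis of_nat_le_iff of_nat_mult of_nat_numeral of_nat_power)
  then have "rfact (N + K) powr e \<le> (2 ^ mdegree (N + K) * (rfact N * rfact K)) powr e"
    using assms by (intro powr_mono2) auto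
  also have "\<dots> = (2 ^ mdegree (N + K)) powr e * (rfact N powr e * rfact K powr e)"
    by (simp add: powr_mult)
  also have "(2 ^ mdegree (N + K) :: real) powr e \<le> (2 ^ mdegree (N + K)) powr 1"
    using assms by (intro powr_mono) auto
  finally show ?thesis
    by (simp add: mult_right_mono)
qed

text \<open>This carries out the sum over N of one recursion step. As t is at most 1/2, splitting (N
  + S)! leaves at most (N!)^(-1/2) times an exponential in N. The constant W depends on G only, so
  the same W serves all R and S.\<close>

lemma infsum_weight_le:
  fixes R S :: "nat ^ 'n"
  assumes "1 \<le> G"
  obtains W where "1 \<le> W"
    "\<And>B t (R :: nat ^ 'n) S X. \<lbrakk>0 \<le> B; 0 \<le> t; t \<le> 1 / 2;
        \<And>N :: nat ^ 'n. X N \<le> ennreal (B * G ^ (mdegree R + mdegree S + mdegree N)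
           * (rfact R * rfact (N + S)) powr t / rfact N)\<rbrakk>
      \<Longrightarrow> infsum X UNIV \<le> ennreal (B * W ^ (1 + mdegree R + mdegree S) * (rfact R * rfact S) powr t)"
proof -
  let ?w = "\<lambda>N :: nat ^ 'n. (2 * G) ^ mdegree N * rfact N powr (- 1 / 2)"
  have w: "?w summable_on UNIV"
    using assms by (intro summable_power_mfact_powr) auto
  \<comment> \<open>In the exponent \<open>1 + mdegree R + mdegree S\<close> the 1 pays for the
    value of the sum, the remaining powers pay for the powers of \<open>2 * G\<close>.\<close>
  define W where "W = max (infsum ?w UNIV) (2 * G)"
  have W: "1 \<le> W" "infsum ?w UNIV \<le> W" "2 * G \<le> W" using assms by (auto simp: W_def)
  have "infsum X UNIV \<le> ennreal (B * W ^ (1 + mdegree R + mdegree S) * (rfact R * rfact S) powr t)"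
    if B: "0 \<le> B" and t: "0 \<le> t" "t \<le> 1 / 2"
      and X: "\<And>N :: nat ^ 'n. X N \<le> ennreal (B * G ^ (mdegree R + mdegree S + mdegree N)
           * (rfact R * rfact (N + S)) powr t / rfact N)"
    for B t X and R S :: "nat ^ 'n"
  proof -
    define D where "D = B * (2 * G) ^ (mdegree R + mdegree S) * (rfact R * rfact S) powr t"
    have "0 \<le> D" using B assms by (simp add: D_def)
    have "B * G ^ (mdegree R + mdegree S + mdegree N) * (rfact R * rfact (N + S)) powr t / rfact N
        \<le> D * ?w N" for N
    proof -
      have "rfact N powr t \<le> rfact N powr (1 / 2)"
        using t mfact_ge_1 by (intro powr_mono) auto
      also have "\<dots> = rfact N powr (- 1 / 2) * rfact N"
        using powr_add [of "rfact N" "- 1 / 2" 1] by simp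
      finally have 1: "rfact N powr t \<le> rfact N powr (- 1 / 2) * rfact N" .
      have "(rfact R * rfact (N + S)) powr t = rfact R powr t * rfact (N + S) powr t"
        by (simp add: powr_mult)
      also have "\<dots> \<le> rfact R powr t *
          (2 ^ (mdegree N + mdegree S) * (rfact N powr t * rfact S powr t))"
        using t by (intro mult_left_mono mfact_add_powr_le) auto
      also have "\<dots> \<le> rfact R powr t *
          (2 ^ (mdegree N + mdegree S) * ((rfact N powr (- 1 / 2) * rfact N) * rfact S powr t))"
        by (intro mult_left_mono mult_right_mono 1) auto
      also have "\<dots> \<le> rfact R powr t *
          (2 ^ (mdegree R + mdegree S + mdegree N) * ((rfact N powr (- 1 / 2) * rfact N) * rfact S powr t))"
        by (intro mult_left_mono mult_right_mono power_increasing) auto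
      finally have "B * G ^ (mdegree R + mdegree S + mdegree N) * (rfact R * rfact (N + S)) powr t
          \<le> B * G ^ (mdegree R + mdegree S + mdegree N) * (rfact R powr t *
          (2 ^ (mdegree R + mdegree S + mdegree N) * ((rfact N powr (- 1 / 2) * rfact N) * rfact S powr t)))"
        using B assms by (intro mult_left_mono) auto
      also have "\<dots> = D * ?w N * rfact N"
        by (simp add: D_def powr_mult power_mult_distrib power_add mult_ac)
      finally show ?thesis by (simp add: field_simps)
    qed
    then have "infsum X UNIV \<le> (\<Sum>\<^sub>\<infinity>N\<in>UNIV. ennreal (D * ?w N))"
      by (intro infsum_mono nonneg_summable_on_complete) (auto intro: order_trans [OF X] ennreal_leI)
    also have "\<dots> = ennreal (D * infsum ?w UNIV)"
      using \<open>0 \<le> D\<close> assms w by (subst infsum_ennreal) (auto simp: infsum_cmult_right' intro: summable_on_cmult_right)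
    also have "D * infsum ?w UNIV \<le> D * W"
      using \<open>0 \<le> D\<close> W by (intro mult_left_mono) auto
    also have "D * W \<le> B * W ^ (mdegree R + mdegree S) * (rfact R * rfact S) powr t * W"
      unfolding D_def using B W assms by (intro mult_right_mono mult_left_mono power_mono) auto
    finally show ?thesis by (simp add: mult_ac ennreal_leI)
  qed
  with W(1) show thesis by (rule that)
qed

text \<open>Squaring doubles the degree in A and the exponent of the factorials, and row sums of
  binomial coefficients contribute only powers of 2. The restriction
  \<open>e \<le> 1 / 2 ^ (m + 2)\<close> keeps the factorial exponent at most 1/2 up to the last sum
  over N. It matters that C is chosen before f, A, R and S.\<close>

lemma wick_h_le:
  fixes p :: "complex ^ 'n"
  assumes hbar: "0 < hbar"
  shows "\<exists>C\<ge>1. \<forall>f l A e R S. 0 \<le> A \<longrightarrow> 0 \<le> e \<longrightarrow> e \<le> 1 / 2 ^ (m + 2) \<longrightarrow> jet_bound p f A e \<longrightarrow>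
           wick_h p hbar f m l R S \<le> ennreal (A ^ 2 ^ Suc m * C ^ (1 + mdegree R + mdegree S) *
             (rfact R * rfact S) powr (2 ^ Suc m * e))"
proof (induction m)
  case 0
  define G where "G = max 1 (2 * hbar)"
  have G: "1 \<le> G" "2 * hbar \<le> G" by (auto simp: G_def)
  obtain W where W: "1 \<le> W" and sum: "\<And>B t (R :: nat ^ 'n) S X. \<lbrakk>0 \<le> B; 0 \<le> t; t \<le> 1 / 2;
        \<And>N :: nat ^ 'n. X N \<le> ennreal (B * G ^ (mdegree R + mdegree S + mdegree N)
           * (rfact R * rfact (N + S)) powr t / rfact N)\<rbrakk>
      \<Longrightarrow> infsum X UNIV \<le> ennreal (B * W ^ (1 + mdegree R + mdegree S) * (rfact R * rfact S) powr t)"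
    using infsum_weight_le [OF G(1)] by metis
  have main: "wick_h p hbar f 0 l R S \<le> ennreal (A\<^sup>2 * W ^ (1 + mdegree R + mdegree S) *
             (rfact R * rfact S) powr (2 * e))"
    if A: "0 \<le> A" and e: "0 \<le> e" "e \<le> 1 / 4" and f: "jet_bound p f A e" for f l A e R S
    unfolding wick_h.simps
  proof (rule sum)
    fix N
    have "norm (mderiv R (N + S) f p) \<le> A * real (mfact (mpair R (N + S))) powr e"
      using f by (metis jet_bound_def jet_mpair)
    then have "(norm (mderiv R (N + S) f p))\<^sup>2 \<le> (A * real (mfact (mpair R (N + S))) powr e)\<^sup>2"
      by (intro power_mono) auto
    also have "\<dots> = A\<^sup>2 * (rfact R * rfact (N + S)) powr (2 * e)"
      by (simp add: power_mult_distrib powr_powr powr_realpow [symmetric] mult.commute [of e] flip: powr_numeral)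
    finally have "(2 * hbar) ^ (mdegree R + mdegree S + mdegree N) / rfact N * (norm (mderiv R (N + S) f p))\<^sup>2
        \<le> G ^ (mdegree R + mdegree S + mdegree N) / rfact N *
          (A\<^sup>2 * (rfact R * rfact (N + S)) powr (2 * e))"
      using hbar G by (intro mult_mono divide_right_mono power_mono) auto
    then show "ennreal ((2 * hbar) ^ (mdegree R + mdegree S + mdegree N) / rfact N * (norm (mderiv R (N + S) f p))\<^sup>2)
        \<le> ennreal (A\<^sup>2 * G ^ (mdegree R + mdegree S + mdegree N)
           * (rfact R * rfact (N + S)) powr (2 * e) / rfact N)"
      by (intro ennreal_leI) (simp add: mult_ac)
  qed (use A e in auto)
  have eq: "2 ^ Suc 0 = (2::nat)" "2 ^ Suc 0 = (2::real)" "1 / 2 ^ (0 + 2) = (1 / 4 :: real)" by simp_all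
  show ?case
    unfolding eq using main W by blast
next
  case (Suc m)
  then obtain C where C: "1 \<le> C" and IH: "\<And>f l A e R S. \<lbrakk>0 \<le> A; 0 \<le> e; e \<le> 1 / 2 ^ (m + 2); jet_bound p f A e\<rbrakk> \<Longrightarrow>
           wick_h p hbar f m l R S \<le> ennreal (A ^ 2 ^ Suc m * C ^ (1 + mdegree R + mdegree S) *
             (rfact R * rfact S) powr (2 ^ Suc m * e))"
    by metis
  \<comment> \<open>The factor 2 stems from the row sums of binomial coefficients, the square from
    the recursion.\<close>
  define G where "G = (2 * C)\<^sup>2"
  have G: "1 \<le> G" unfolding G_def using C by (intro one_le_power) simp
  obtain W where W: "1 \<le> W" and sum: "\<And>B t (R :: nat ^ 'n) S X. \<lbrakk>0 \<le> B; 0 \<le> t; t \<le> 1 / 2;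
        \<And>N :: nat ^ 'n. X N \<le> ennreal (B * G ^ (mdegree R + mdegree S + mdegree N)
           * (rfact R * rfact (N + S)) powr t / rfact N)\<rbrakk>
      \<Longrightarrow> infsum X UNIV \<le> ennreal (B * W ^ (1 + mdegree R + mdegree S) * (rfact R * rfact S) powr t)"
    using infsum_weight_le [OF G] by metis
  have main: "wick_h p hbar f (Suc m) l R S \<le> ennreal ((A ^ 2 ^ Suc m * C)\<^sup>2 * W ^ (1 + mdegree R + mdegree S) *
             (rfact R * rfact S) powr (2 ^ Suc (Suc m) * e))"
    if A: "0 \<le> A" and e: "0 \<le> e" "e \<le> 1 / 2 ^ (Suc m + 2)" and f: "jet_bound p f A e" for f l A e R S
    unfolding wick_h.simps
  proof (rule sum)
    let ?t = "2 ^ Suc m * e"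
    let ?h = "\<lambda>I J. if even l then wick_h p hbar f m (l div 2) I J else wick_h p hbar f m ((l - 1) div 2) J I"
    fix N
    define Y where "Y = A ^ 2 ^ Suc m * C ^ (1 + mdegree R + mdegree (N + S)) *
             (rfact R * rfact (N + S)) powr ?t"
    have "0 \<le> Y" using A C by (simp add: Y_def)
    have e': "e \<le> 1 / 2 ^ (m + 2)" using e by (simp add: field_simps)
    have h: "?h I J \<le> ennreal Y" if "I \<le> R" "J \<le> N + S" for I J
    proof -
      have "?h I J \<le> ennreal (A ^ 2 ^ Suc m * C ^ (1 + mdegree I + mdegree J) *
             (rfact I * rfact J) powr ?t)"
        using IH [OF A e(1) e' f, of "l div 2" I J] IH [OF A e(1) e' f, of "(l - 1) div 2" J I]
        by (simp add: mult.commute [of "rfact I"] add.commute [of "mdegree I"] del: power_Suc)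
      also have "\<dots> \<le> ennreal Y"
      proof -
        have 1: "C ^ (1 + mdegree I + mdegree J) \<le> C ^ (1 + mdegree R + mdegree (N + S))"
          using that C by (intro power_increasing add_mono mdegree_mono) auto
        have 2: "(rfact I * rfact J) powr ?t \<le> (rfact R * rfact (N + S)) powr ?t"
          using that e by (intro powr_mono2 mult_mono of_nat_mono mfact_mono) auto
        show ?thesis
          unfolding Y_def using A C by (intro ennreal_leI mult_mono [OF mult_left_mono [OF 1] 2]) auto
      qed
      finally show ?thesis .
    qed
    have "(\<Sum>I\<le>R. \<Sum>J\<le>N + S. of_nat (mbinom R I * mbinom (N + S) J) * ?h I J)
        \<le> (\<Sum>I\<le>R. \<Sum>J\<le>N + S. of_nat (mbinom R I * mbinom (N + S) J) * ennreal Y)"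
      by (intro sum_mono mult_left_mono h) auto
    also have "\<dots> = (\<Sum>I\<le>R. \<Sum>J\<le>N + S. ennreal (real (mbinom R I) * real (mbinom (N + S) J) * Y))"
      using \<open>0 \<le> Y\<close> by (simp add: ennreal_mult ennreal_of_nat_eq_real_of_nat)
    also have "\<dots> = ennreal (\<Sum>I\<le>R. \<Sum>J\<le>N + S. real (mbinom R I) * real (mbinom (N + S) J) * Y)"
      using \<open>0 \<le> Y\<close> by (simp add: sum_nonneg)
    also have "(\<Sum>I\<le>R. \<Sum>J\<le>N + S. real (mbinom R I) * real (mbinom (N + S) J) * Y)
        = (\<Sum>I\<le>R. real (mbinom R I)) * (\<Sum>J\<le>N + S. real (mbinom (N + S) J)) * Y"
      unfolding sum_product by (simp only: sum_distrib_right)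
    also have "\<dots> = 2 ^ (mdegree R + mdegree (N + S)) * Y"
      by (simp add: sum_mbinom power_add)
    finally have "(\<Sum>I\<le>R. \<Sum>J\<le>N + S. of_nat (mbinom R I * mbinom (N + S) J) * ?h I J)\<^sup>2
        \<le> (ennreal (2 ^ (mdegree R + mdegree (N + S)) * Y))\<^sup>2"
      by (intro power_mono) auto
    also have "\<dots> = ennreal ((2 ^ (mdegree R + mdegree (N + S)) * Y)\<^sup>2)"
      using \<open>0 \<le> Y\<close> by (simp add: ennreal_power)
    finally have "ennreal (1 / rfact N) *
            (\<Sum>I\<le>R. \<Sum>J\<le>N + S. of_nat (mbinom R I * mbinom (N + S) J) * ?h I J)\<^sup>2
        \<le> ennreal (1 / rfact N) * ennreal ((2 ^ (mdegree R + mdegree (N + S)) * Y)\<^sup>2)"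
      by (intro mult_left_mono) auto
    also have "\<dots> = ennreal (1 / rfact N * (2 ^ (mdegree R + mdegree (N + S)) * Y)\<^sup>2)"
      by (intro ennreal_mult [symmetric]) auto
    also have "1 / rfact N * (2 ^ (mdegree R + mdegree (N + S)) * Y)\<^sup>2 =
        (A ^ 2 ^ Suc m * C)\<^sup>2 * G ^ (mdegree R + mdegree S + mdegree N)
           * (rfact R * rfact (N + S)) powr (2 ^ Suc (Suc m) * e) / rfact N"
    proof -
      have "((rfact R * rfact (N + S)) powr ?t)\<^sup>2
          = (rfact R * rfact (N + S)) powr (2 ^ Suc (Suc m) * e)"
        by (simp add: powr_powr powr_realpow [symmetric] mult_ac flip: powr_numeral)
      moreover have "(2 ^ (mdegree R + mdegree (N + S)) * C ^ (1 + mdegree R + mdegree (N + S)))\<^sup>2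
          = C\<^sup>2 * G ^ (mdegree R + mdegree S + mdegree N)"
      proof -
        have "2 ^ (mdegree R + mdegree (N + S)) * C ^ (1 + mdegree R + mdegree (N + S))
            = (2 * C) ^ (mdegree R + mdegree S + mdegree N) * C"
          by (simp add: power_mult_distrib add_ac mult_ac)
        moreover have "((2 * C) ^ (mdegree R + mdegree S + mdegree N))\<^sup>2 = G ^ (mdegree R + mdegree S + mdegree N)"
          unfolding G_def by (simp only: power_mult [symmetric] mult.commute)
        ultimately show ?thesis by (simp only: power_mult_distrib mult.commute)
      qed
      ultimately show ?thesis
        unfolding Y_def by (simp add: power_mult_distrib mult_ac del: power_Suc)
    qed
    finally show "ennreal (1 / rfact N) *
            (\<Sum>I\<le>R. \<Sum>J\<le>N + S. of_nat (mbinom R I * mbinom (N + S) J) * ?h I J)\<^sup>2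
        \<le> ennreal ((A ^ 2 ^ Suc m * C)\<^sup>2 * G ^ (mdegree R + mdegree S + mdegree N)
           * (rfact R * rfact (N + S)) powr (2 ^ Suc (Suc m) * e) / rfact N)" .
  qed (use A e in \<open>auto simp: field_simps\<close>)
  \<comment> \<open>The leftover constant C^2 is absorbed into the power of the witness, because the
    exponent \<open>1 + mdegree R + mdegree S\<close> is at least 1.\<close>
  show ?case
  proof (intro exI [of _ "C\<^sup>2 * W"] conjI allI impI)
    show "1 \<le> C\<^sup>2 * W" using C W mult_mono [of 1 "C\<^sup>2" 1 W] by simp
    fix f :: "complex ^ 'n \<Rightarrow> complex" and l A e and R S :: "nat ^ 'n"
    assume *: "0 \<le> A" "0 \<le> e" "e \<le> 1 / 2 ^ (Suc m + 2)" "jet_bound p f A e"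
    have "C\<^sup>2 * W ^ (1 + mdegree R + mdegree S) \<le> (C\<^sup>2 * W) ^ (1 + mdegree R + mdegree S)"
    proof -
      have "C\<^sup>2 ^ 1 \<le> C\<^sup>2 ^ (1 + mdegree R + mdegree S)" using C by (intro power_increasing) auto
      then show ?thesis unfolding power_mult_distrib using W by (intro mult_right_mono) auto
    qed
    then have "A ^ 2 ^ Suc (Suc m) * (C\<^sup>2 * W ^ (1 + mdegree R + mdegree S)) * (rfact R * rfact S) powr (2 ^ Suc (Suc m) * e)
        \<le> A ^ 2 ^ Suc (Suc m) * (C\<^sup>2 * W) ^ (1 + mdegree R + mdegree S) * (rfact R * rfact S) powr (2 ^ Suc (Suc m) * e)"
      using * by (intro mult_right_mono mult_left_mono) auto
    moreover have "(A ^ 2 ^ Suc m * C)\<^sup>2 = A ^ 2 ^ Suc (Suc m) * C\<^sup>2"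
      by (simp add: power_mult_distrib power_mult [symmetric] mult.commute)
    ultimately show "wick_h p hbar f (Suc m) l R S \<le> ennreal (A ^ 2 ^ Suc (Suc m) * (C\<^sup>2 * W) ^ (1 + mdegree R + mdegree S) *
             (rfact R * rfact S) powr (2 ^ Suc (Suc m) * e))"
      using main [OF *, of l R S] by (elim order_trans) (simp add: ennreal_leI mult.assoc del: power_Suc)
  qed
qed

text \<open>The bound on h is homogeneous of degree 2^(m+1) in A, so the root in the seminorm makes
  it linear in A; for a fixed index the remaining factors are constants.\<close>

lemma wick_seminorm_le_jet_bound:
  fixes p :: "complex ^ 'n"
  assumes hbar: "0 < hbar" and i: "i \<in> wick_indices"
  obtains e C where "0 < e" "0 < C" "\<And>f A. 0 \<le> A \<Longrightarrow> jet_bound p f A e \<Longrightarrow> wick_seminorm p hbar i f \<le> C * A"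
proof -
  obtain m l R S where i: "i = (m, l, R, S)" by (metis surj_pair)
  obtain C where C: "1 \<le> C" and h: "\<And>f l A e R S. \<lbrakk>0 \<le> A; 0 \<le> e; e \<le> 1 / 2 ^ (m + 2); jet_bound p f A e\<rbrakk> \<Longrightarrow>
           wick_h p hbar f m l R S \<le> ennreal (A ^ 2 ^ Suc m * C ^ (1 + mdegree R + mdegree S) *
             (rfact R * rfact S) powr (2 ^ Suc m * e))"
    using wick_h_le [OF hbar, of m p] by metis
  define e :: real where "e = 1 / 2 ^ (m + 2)"
  define D where "D = C ^ (1 + mdegree R + mdegree S) * (rfact R * rfact S) powr (2 ^ Suc m * e)"
  have "1 \<le> rfact R * rfact S"
    using mult_mono [OF mfact_ge_1 [of R] mfact_ge_1 [of S]] by simp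
  then have "1 \<le> (rfact R * rfact S) powr (2 ^ Suc m * e)"
    by (rule ge_one_powr_ge_zero) (simp add: e_def)
  then have D: "1 \<le> D"
    unfolding D_def using C by (intro mult_ge1_I one_le_power)
  have e: "0 \<le> e" "e \<le> 1 / 2 ^ (m + 2)" by (simp_all add: e_def)
  have "wick_seminorm p hbar i f \<le> D * A" if "0 \<le> A" "jet_bound p f A e" for f A
  proof -
    \<comment> \<open>Since D is at least 1, it may be replaced by its power, so no root of D has to
      be taken.\<close>
    have "D \<le> D ^ 2 ^ Suc m" using self_le_power [OF D, of "2 ^ Suc m"] by simp
    then have "D * A ^ 2 ^ Suc m \<le> D ^ 2 ^ Suc m * A ^ 2 ^ Suc m"
      using that by (intro mult_right_mono) auto
    then have "A ^ 2 ^ Suc m * D \<le> (D * A) ^ 2 ^ Suc m"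
      unfolding power_mult_distrib by (simp only: mult.commute)
    then have "wick_h p hbar f m l R S \<le> ennreal ((D * A) ^ 2 ^ Suc m)"
      unfolding D_def mult.assoc
      by (intro order_trans [OF h [OF that(1) e that(2)]]) (simp only: ennreal_leI mult.assoc)
    then show ?thesis using D that unfolding i by (intro wick_seminorm_le) auto
  qed
  then show thesis using D by (intro that [of e D]) (auto simp: e_def)
qed

lemma wick_functionsI:
  fixes p :: "complex ^ 'n"
  assumes hbar: "0 < hbar" and "smooth f" and bound: "\<And>e. 0 < e \<Longrightarrow> \<exists>A\<ge>0. jet_bound p f A e"
  shows "f \<in> wick_functions p hbar"
  unfolding wick_functions_iff
proof (intro conjI allI impI \<open>smooth f\<close>)
  fix m l R S
  obtain C where h: "\<And>f l A e R S. \<lbrakk>0 \<le> A; 0 \<le> e; e \<le> 1 / 2 ^ (m + 2); jet_bound p f A e\<rbrakk> \<Longrightarrow>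
           wick_h p hbar f m l R S \<le> ennreal (A ^ 2 ^ Suc m * C ^ (1 + mdegree R + mdegree S) *
             (rfact R * rfact S) powr (2 ^ Suc m * e))"
    using wick_h_le [OF hbar, of m p] by metis
  obtain A where "0 \<le> A" "jet_bound p f A (1 / 2 ^ (m + 2))"
    using bound [of "1 / 2 ^ (m + 2)"] by auto
  from h [OF this(1) _ _ this(2), of l R S] show "wick_h p hbar f m l R S < \<infinity>"
    by (simp add: le_less_trans ennreal_less_top del: power_Suc)
qed

section \<open>Functions with subfactorial jets\<close>

lemma mbinom_self [simp]: "mbinom N N = 1"
  by (simp add: mbinom_def)

text \<open>All terms are nonnegative; only the chosen N and, inside the square, I = R and J = N + S
  are kept, where both binomial coefficients are 1.\<close>

lemma wick_h_Suc_ge: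
  "ennreal (1 / rfact N) *
     (if even l then wick_h p hbar f m (l div 2) R (N + S) else wick_h p hbar f m ((l - 1) div 2) (N + S) R)\<^sup>2
   \<le> wick_h p hbar f (Suc m) l R S"
proof -
  let ?h = "\<lambda>I J. if even l then wick_h p hbar f m (l div 2) I J else wick_h p hbar f m ((l - 1) div 2) J I"
  have "of_nat (mbinom R R * mbinom (N + S) (N + S)) * ?h R (N + S)
      \<le> (\<Sum>J\<le>N + S. of_nat (mbinom R R * mbinom (N + S) J) * ?h R J)"
    by (rule member_le_sum) auto
  also have "\<dots> \<le> (\<Sum>I\<le>R. \<Sum>J\<le>N + S. of_nat (mbinom R I * mbinom (N + S) J) * ?h I J)"
    by (rule member_le_sum) auto
  finally have "?h R (N + S) \<le> (\<Sum>I\<le>R. \<Sum>J\<le>N + S. of_nat (mbinom R I * mbinom (N + S) J) * ?h I J)"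
    by simp
  then have "ennreal (1 / rfact N) * (?h R (N + S))\<^sup>2
      \<le> ennreal (1 / rfact N) * (\<Sum>I\<le>R. \<Sum>J\<le>N + S. of_nat (mbinom R I * mbinom (N + S) J) * ?h I J)\<^sup>2"
    by (intro mult_left_mono power_mono) auto
  also have "\<dots> \<le> wick_h p hbar f (Suc m) l R S"
    unfolding wick_h.simps
    by (rule le_infsum_ennreal [of N UNIV "\<lambda>N. ennreal (1 / rfact N) * (\<Sum>I\<le>R. \<Sum>J\<le>N + S. of_nat (mbinom R I * mbinom (N + S) J) * ?h I J)\<^sup>2"]) simp
  finally show ?thesis .
qed

text \<open>A real-valued version for calculating with powers. It is faithful only where h is
  finite, as on \<open>wick_functions\<close>, because \<open>enn2real\<close> sends infinity to
  0.\<close>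

definition wick_hr ::
    "complex ^ 'n \<Rightarrow> real \<Rightarrow> (complex ^ 'n \<Rightarrow> complex) \<Rightarrow>
     nat \<Rightarrow> nat \<Rightarrow> nat ^ 'n \<Rightarrow> nat ^ 'n \<Rightarrow> real" where
  "wick_hr p hbar f m l R S = enn2real (wick_h p hbar f m l R S)"

lemma wick_hr_nonneg [simp]: "0 \<le> wick_hr p hbar f m l R S"
  by (simp add: wick_hr_def)

lemma ennreal_wick_hr:
  assumes "f \<in> wick_functions p hbar" "l < 2 ^ m"
  shows "ennreal (wick_hr p hbar f m l R S) = wick_h p hbar f m l R S"
  using assms by (simp add: wick_hr_def wick_functions_iff)

lemma wick_hr_Suc_ge:
  assumes f: "f \<in> wick_functions p hbar" and l: "l < 2 ^ Suc m"
  shows "(if even l then wick_hr p hbar f m (l div 2) R (N + S) else wick_hr p hbar f m (l div 2) (N + S) R)\<^sup>2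
   \<le> rfact N * wick_hr p hbar f (Suc m) l R S"
proof -
  have l': "l div 2 < 2 ^ m" using l by auto
  have eq: "(l - 1) div 2 = l div 2" if "odd l" using that by presburger
  let ?x = "if even l then wick_hr p hbar f m (l div 2) R (N + S) else wick_hr p hbar f m (l div 2) (N + S) R"
  have "ennreal (1 / rfact N) * (ennreal ?x)\<^sup>2 \<le> ennreal (wick_hr p hbar f (Suc m) l R S)"
    using wick_h_Suc_ge [of N l p hbar f m R S] eq
    by (auto simp: ennreal_wick_hr [OF f l] ennreal_wick_hr [OF f l'] simp del: wick_h.simps)
  then have "1 / rfact N * ?x\<^sup>2 \<le> wick_hr p hbar f (Suc m) l R S"
    by (simp add: ennreal_power ennreal_mult [symmetric] del: wick_h.simps split: if_splits)
  then show ?thesis by (simp add: field_simps split: if_splits)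
qed

lemma wick_hr_0_ge:
  assumes f: "f \<in> wick_functions p hbar" and hbar: "0 < hbar"
  shows "(2 * hbar) ^ (mdegree R + mdegree S) * (norm (mderiv R S f p))\<^sup>2 \<le> wick_hr p hbar f 0 0 R S"
proof -
  have "ennreal ((2 * hbar) ^ (mdegree R + mdegree S) * (norm (mderiv R S f p))\<^sup>2) \<le> wick_h p hbar f 0 0 R S"
    using le_infsum_ennreal [of 0 UNIV "\<lambda>N. ennreal ((2 * hbar) ^ (mdegree R + mdegree S + mdegree N) / rfact N
                       * (norm (mderiv R (N + S) f p))\<^sup>2)"] by simp
  then show ?thesis
    using ennreal_wick_hr [OF f, of 0 0 R S, symmetric] by (simp del: wick_h.simps)
qed

text \<open>
  An even step gives \<open>h(R, S)\<^sup>2 \<le> S! h(R, 0)\<close>, a following odd step \<open>h(R, 0)\<^sup>2 \<le> R! h(0, 0)\<close>; the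
  first \<open>m\<close> steps only square \<open>h(R, S)\<close> repeatedly.
\<close>

lemma wick_hr_ge_power:
  assumes f: "f \<in> wick_functions p hbar" and hbar: "0 < hbar"
  shows "((2 * hbar) ^ (mdegree R + mdegree S) * (norm (mderiv R S f p))\<^sup>2) ^ 2 ^ (m + 2)
    \<le> (rfact R * rfact S)\<^sup>2 * wick_hr p hbar f (m + 2) 1 0 0"
proof -
  define x where "x = (2 * hbar) ^ (mdegree R + mdegree S) * (norm (mderiv R S f p))\<^sup>2"
  have "0 \<le> x" using hbar by (simp add: x_def)
  have 1: "x ^ 2 ^ m \<le> wick_hr p hbar f m 0 R S"
  proof (induction m)
    case (Suc m)
    have "x ^ 2 ^ Suc m = (x ^ 2 ^ m)\<^sup>2" by (simp add: power_mult [symmetric] mult.commute)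
    also have "\<dots> \<le> (wick_hr p hbar f m 0 R S)\<^sup>2" using Suc \<open>0 \<le> x\<close> by (intro power_mono) auto
    also have "\<dots> \<le> wick_hr p hbar f (Suc m) 0 R S"
      using wick_hr_Suc_ge [OF f, of 0 m R 0 S] by simp
    finally show ?case .
  qed (use wick_hr_0_ge [OF f hbar] in \<open>simp add: x_def\<close>)
  define y where "y = wick_hr p hbar f m 0 R S"
  define z where "z = wick_hr p hbar f (Suc m) 0 R 0"
  have "y\<^sup>2 \<le> rfact S * z"
    using wick_hr_Suc_ge [OF f, of 0 m R S 0] by (simp add: y_def z_def)
  \<comment> \<open>The index 1 is odd at the last step and becomes 0 at the previous level, so all
    earlier steps are even. The odd step swaps the indices; here the summation index is R and both
    remaining indices are 0.\<close>
  have "z\<^sup>2 \<le> rfact R * wick_hr p hbar f (m + 2) 1 0 0"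
  proof -
    have "1 < (2::nat) ^ Suc (Suc m)" by (rule one_less_power) simp_all
    from wick_hr_Suc_ge [OF f this, of 0 R 0] show ?thesis by (simp add: z_def)
  qed
  have "x ^ 2 ^ (m + 2) = ((x ^ 2 ^ m)\<^sup>2)\<^sup>2"
    by (simp add: power_mult [symmetric] mult.commute)
  also have "\<dots> \<le> (y\<^sup>2)\<^sup>2"
    using 1 \<open>0 \<le> x\<close> by (intro power_mono) (auto simp: y_def)
  also have "\<dots> \<le> (rfact S * z)\<^sup>2"
    using \<open>y\<^sup>2 \<le> _\<close> by (intro power_mono) auto
  also have "\<dots> = (rfact S)\<^sup>2 * z\<^sup>2" by (simp add: power_mult_distrib)
  also have "\<dots> \<le> (rfact S)\<^sup>2 * (rfact R * wick_hr p hbar f (m + 2) 1 0 0)"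
    using \<open>z\<^sup>2 \<le> _\<close> by (intro mult_left_mono) auto
  \<comment> \<open>R! is weakened to its square, so that the bound depends only on the factorial of
    the pair (R, S).\<close>
  also have "\<dots> \<le> (rfact S)\<^sup>2 * ((rfact R)\<^sup>2 * wick_hr p hbar f (m + 2) 1 0 0)"
    using mfact_ge_1 [of R] self_le_power [of "rfact R" 2]
    by (intro mult_left_mono mult_right_mono) auto
  finally show ?thesis by (simp add: x_def power_mult_distrib mult_ac)
qed

text \<open>The root of order 2^(m+3) turns the squared factorial into the exponent 1 / 2^(m+2).
  Removing the power of hbar costs the same exponent once more, and the total 1 / 2^(m+1) is at most
  e by the choice of m.\<close>

lemma jet_bound_wick_seminorm:
  fixes p :: "complex ^ 'n"
  assumes hbar: "0 < hbar" and "0 < e"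
  obtains i C where "i \<in> wick_indices" "0 < C"
    "\<And>f. f \<in> wick_functions p hbar \<Longrightarrow> jet_bound p f (C * wick_seminorm p hbar i f) e"
proof -
  obtain m where "(1 / 2) ^ m < e"
    using real_arch_pow_inv [OF \<open>0 < e\<close>, of "1/2"] by auto
  then have m: "1 / 2 ^ (m + 1) \<le> e"
    by (simp add: power_one_over field_simps)
  obtain C where C: "0 < C" "\<And>N :: nat ^ ('n + 'n). (1 / sqrt (2 * hbar)) ^ mdegree N \<le> C * rfact N powr (1 / 2 ^ (m + 2))"
    by (rule power_mdegree_le_mfact_powr [of "1 / 2 ^ (m + 2)" "1 / sqrt (2 * hbar)"]) (use hbar in auto)
  let ?i = "(m + 2, 1, 0, 0) :: 'n wick_index"
  have "jet_bound p f (C * wick_seminorm p hbar ?i f) e" if f: "f \<in> wick_functions p hbar" for f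
    unfolding jet_bound_def
  proof
    fix N :: "nat ^ ('n + 'n)"
    define R S where "R = lpart N" and "S = rpart N"
    have N: "N = mpair R S" by (simp add: R_def S_def)
    define Q where "Q = wick_seminorm p hbar ?i f"
    define H where "H = wick_hr p hbar f (m + 2) 1 0 0"
    define M where "M = rfact N"
    define b where "b = sqrt (2 * hbar) ^ mdegree N * norm (jet f p N)"
    have "0 \<le> H" "0 < M" "0 \<le> b" using hbar by (auto simp: H_def M_def b_def)
    have "0 \<le> Q" by (simp add: Q_def wick_seminorm_def)
    have Q: "Q = H powr (1 / 2 ^ (m + 3))"
      by (simp add: Q_def wick_seminorm_def H_def wick_hr_def add.commute power_add mult.commute del: wick_h.simps)
    have "b\<^sup>2 = (2 * hbar) ^ (mdegree R + mdegree S) * (norm (mderiv R S f p))\<^sup>2"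
    proof -
      have "(sqrt (2 * hbar) ^ d)\<^sup>2 = ((sqrt (2 * hbar))\<^sup>2) ^ d" for d
        by (simp only: power_mult [symmetric] mult.commute)
      then show ?thesis
        using hbar by (simp add: b_def N jet_mpair power_mult_distrib [of "sqrt (2 * hbar) ^ _"])
    qed
    then have "(b\<^sup>2) ^ 2 ^ (m + 2) \<le> M\<^sup>2 * H"
      using wick_hr_ge_power [OF f hbar, of R S m] by (simp add: H_def M_def N)
    moreover have "(b\<^sup>2) ^ 2 ^ (m + 2) = b ^ 2 ^ (m + 3)"
      by (simp add: power_mult [symmetric] power_add mult.commute)
    ultimately have "b ^ 2 ^ (m + 3) \<le> M\<^sup>2 * H" by simp
    then have "(b ^ 2 ^ (m + 3)) powr (1 / 2 ^ (m + 3)) \<le> (M\<^sup>2 * H) powr (1 / 2 ^ (m + 3))"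
      using \<open>0 \<le> b\<close> by (intro powr_mono2) auto
    moreover have "(b ^ 2 ^ (m + 3)) powr (1 / 2 ^ (m + 3)) = b"
      using \<open>0 \<le> b\<close> by (cases "b = 0") (simp_all add: powr_realpow [symmetric] powr_powr)
    moreover have "(M\<^sup>2 * H) powr (1 / 2 ^ (m + 3)) = M powr (1 / 2 ^ (m + 2)) * Q"
    proof -
      have "M\<^sup>2 = M powr 2" using \<open>0 < M\<close> by simp
      moreover have "2 * (1 / 2 ^ (m + 3)) = (1 / 2 ^ (m + 2) :: real)" by (simp add: power_add)
      ultimately show ?thesis
        using \<open>0 < M\<close> \<open>0 \<le> H\<close> by (simp only: Q powr_mult powr_powr)
    qed
    ultimately have b: "b \<le> M powr (1 / 2 ^ (m + 2)) * Q" by simp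
    have "norm (jet f p N) = (1 / sqrt (2 * hbar)) ^ mdegree N * b"
      using hbar by (simp add: b_def power_one_over)
    also have "\<dots> \<le> (C * M powr (1 / 2 ^ (m + 2))) * (M powr (1 / 2 ^ (m + 2)) * Q)"
      using C b \<open>0 \<le> b\<close> by (intro mult_mono) (auto simp: M_def)
    also have "\<dots> = C * Q * M powr (1 / 2 ^ (m + 1))"
      by (simp add: powr_add [symmetric])
    also have "\<dots> \<le> C * Q * M powr e"
      using C m \<open>0 \<le> Q\<close> mfact_ge_1 [of N] by (intro mult_left_mono powr_mono) (auto simp: M_def)
    finally show "norm (jet f p N) \<le> C * wick_seminorm p hbar ?i f * rfact N powr e"
      by (simp add: Q_def M_def)
  qed
  moreover have "?i \<in> wick_indices"
    using one_less_power [of "2::nat" "m + 2"] by (simp add: wick_indices_iff)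
  ultimately show thesis using that C by blast
qed

section \<open>Subfactorial coefficients and everywhere convergent expansions\<close>

definition subfactorial :: "(nat ^ 'm \<Rightarrow> complex) \<Rightarrow> bool" where
  "subfactorial a \<longleftrightarrow> (\<forall>e>0. \<exists>A\<ge>0. \<forall>N. norm (a N) \<le> A * rfact N powr e)"

lemma subfactorialE:
  assumes "subfactorial a" "0 < e"
  obtains A where "0 \<le> A" "\<And>N. norm (a N) \<le> A * rfact N powr e"
  using assms unfolding subfactorial_def by blast

lemma divpow_le:
  "norm (divpow w N) \<le> (\<Sum>i\<in>UNIV. norm (w $ i)) ^ mdegree N / rfact N"
  unfolding norm_divpow power_mdegree
  by (intro divide_right_mono prod_mono) (auto intro!: power_mono member_le_sum)

text \<open>Splitting (I + K)! separates the indices: the summable majorant W depends on w only, and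
  the dependence on I is the explicit factor in front. Hence sums over K inherit growth bounds in
  I.\<close>

lemma subfactorial_shift_summable:
  fixes w :: "complex ^ 'm"
  assumes bound: "\<And>N. norm (a N) \<le> A * rfact N powr e" and A: "0 \<le> A" and e: "0 \<le> e" "e \<le> 1 / 2"
  defines "W \<equiv> \<lambda>K :: nat ^ 'm. (2 * (\<Sum>i\<in>UNIV. norm (w $ i))) ^ mdegree K * rfact K powr (- 1 / 2)"
  shows "W summable_on UNIV"
    and "norm (a (I + K)) * norm (divpow w K) \<le> (A * 2 ^ mdegree I * rfact I powr e) * W K"
proof -
  let ?r = "\<Sum>i\<in>UNIV. norm (w $ i)"
  have r: "0 \<le> ?r" by (simp add: sum_nonneg)
  show "W summable_on UNIV"
    unfolding W_def using r by (intro summable_power_mfact_powr) auto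
  have "norm (a (I + K)) \<le> A * (2 ^ (mdegree I + mdegree K) * (rfact I powr e * rfact K powr e))"
    using e A by (intro order_trans [OF bound] mult_left_mono mfact_add_powr_le) auto
  also have "\<dots> \<le> A * (2 ^ (mdegree I + mdegree K) * (rfact I powr e * rfact K powr (1 / 2)))"
    using e A mfact_ge_1 by (intro mult_left_mono powr_mono) auto
  finally have "norm (a (I + K)) * norm (divpow w K) \<le>
      A * (2 ^ (mdegree I + mdegree K) * (rfact I powr e * rfact K powr (1 / 2))) * (?r ^ mdegree K / rfact K)"
    using A by (intro mult_mono divpow_le) auto
  also have "rfact K powr (1 / 2) = rfact K powr (- 1 / 2) * rfact K"
    using powr_add [of "rfact K" "- 1 / 2" 1] by simp
  finally show "norm (a (I + K)) * norm (divpow w K) \<le> (A * 2 ^ mdegree I * rfact I powr e) * W K"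
    by (simp add: W_def power_add power_mult_distrib mult_ac)
qed

definition entire_expansion ::
    "(complex ^ 'n \<Rightarrow> complex) \<Rightarrow> (nat ^ ('n + 'n) \<Rightarrow> complex) \<Rightarrow> complex ^ 'n \<Rightarrow> bool" where
  "entire_expansion f a x \<longleftrightarrow> (\<forall>u. ((\<lambda>N. a N * divpow (dbl u) N) has_sum f (x + u)) UNIV)"

lemma entire_expansion_expands: "entire_expansion f a x \<Longrightarrow> expands f a x r"
  by (simp add: entire_expansion_def expands_def)

lemma entire_expansion_iff: "entire_expansion f a x \<longleftrightarrow> (\<forall>r. expands f a x r)"
  unfolding entire_expansion_def expands_def using linordered_field_no_ub by blast

lemma entire_expansion_jet: "entire_expansion f a x \<Longrightarrow> jet f x = a"
  using expands_imp_jet [OF entire_expansion_expands, of f a x 1] by simp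

lemma entire_expansion_recentre:
  assumes "entire_expansion f a x"
  shows "entire_expansion f (recentre a (y - x)) y"
  unfolding entire_expansion_iff
proof
  fix r
  show "expands f (recentre a (y - x)) y r"
    using expands_recentre' [OF entire_expansion_expands [OF assms], of y "r + norm (y - x)"] by simp
qed

lemma entire_expansion_real_analytic:
  assumes "entire_expansion f a x"
  shows "real_analytic f"
  unfolding real_analytic_iff
proof
  fix y
  have "expands f (recentre a (y - x)) y 1"
    by (rule entire_expansion_expands [OF entire_expansion_recentre [OF assms]])
  then show "\<exists>r>0. \<exists>a. expands f a y r" by (intro exI [of _ 1]) auto
qed

lemma subfactorial_recentre:
  assumes "subfactorial a"
  shows "subfactorial (recentre a u)"
  unfolding subfactorial_def
proof (intro allI impI)
  fix e :: real assume "0 < e"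
  \<comment> \<open>Half of the exponent is spent on a, the other half on the factor 2^|I| that the
    shift produces; the cap 1/2 keeps the sum over K convergent.\<close>
  define d where "d = min (e / 2) (1 / 2)"
  have d: "0 < d" "d \<le> 1 / 2" "d + d \<le> e" using \<open>0 < e\<close> by (auto simp: d_def)
  obtain A where A: "0 \<le> A" "\<And>N. norm (a N) \<le> A * rfact N powr d"
    using subfactorialE [OF assms d(1)] by blast
  obtain C where C: "0 < C" "\<And>N :: nat ^ ('a + 'a). 2 ^ mdegree N \<le> C * rfact N powr d"
    by (rule power_mdegree_le_mfact_powr [of d 2]) (use d in auto)
  let ?W = "\<lambda>K :: nat ^ ('a + 'a). (2 * (\<Sum>i\<in>UNIV. norm (dbl u $ i))) ^ mdegree K * rfact K powr (- 1 / 2)"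
  note W = subfactorial_shift_summable [OF A(2) A(1) less_imp_le [OF d(1)] d(2), where w = "dbl u"]
  have "norm (recentre a u I) \<le> (A * C * infsum ?W UNIV) * rfact I powr e" for I
  proof -
    have 0: "0 \<le> infsum ?W UNIV" by (intro infsum_nonneg) (auto simp: sum_nonneg)
    have "norm (recentre a u I) \<le> (A * 2 ^ mdegree I * rfact I powr d) * infsum ?W UNIV"
      unfolding recentre_def infsum_cmult_right' [symmetric]
    proof (rule norm_infsum_bound [THEN order_trans])
      have s: "(\<lambda>K. norm (a (I + K) * divpow (dbl u) K)) summable_on UNIV"
        by (rule summable_on_comparison_test [OF summable_on_cmult_right [OF W(1)]])
           (use W(2) in \<open>auto simp: norm_mult\<close>)
      then show "(\<lambda>K. norm (a (I + K) * divpow (dbl u) K)) summable_on UNIV" .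
      show "(\<Sum>\<^sub>\<infinity>K. norm (a (I + K) * divpow (dbl u) K)) \<le> (\<Sum>\<^sub>\<infinity>K. A * 2 ^ mdegree I * rfact I powr d * ?W K)"
        by (intro infsum_mono s summable_on_cmult_right [OF W(1)]) (use W(2) in \<open>simp add: norm_mult\<close>)
    qed
    also have "\<dots> \<le> (A * (C * rfact I powr d) * rfact I powr d) * infsum ?W UNIV"
      using A 0 C by (intro mult_right_mono mult_left_mono) auto
    also have "\<dots> = (A * C * infsum ?W UNIV) * rfact I powr (d + d)"
      by (simp only: powr_add mult_ac)
    also have "\<dots> \<le> (A * C * infsum ?W UNIV) * rfact I powr e"
      using A 0 C d mfact_ge_1 by (intro mult_left_mono powr_mono) auto
    finally show ?thesis .
  qed
  moreover have "0 \<le> A * C * infsum ?W UNIV"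
    using A C by (intro mult_nonneg_nonneg infsum_nonneg) (auto simp: sum_nonneg)
  ultimately show "\<exists>A\<ge>0. \<forall>N. norm (recentre a u N) \<le> A * rfact N powr e" by blast
qed

text \<open>Every subfactorial family is the jet at p of a function given by one power series on the
  whole space; this supplies the analytic representatives and the limits of Cauchy
  sequences.\<close>

lemma subfactorial_entire_expansion:
  assumes "subfactorial a"
  shows "entire_expansion (\<lambda>x. recentre a (x - p) 0) a p"
  unfolding entire_expansion_def
proof
  fix u
  obtain A where A: "0 \<le> A" "\<And>N. norm (a N) \<le> A * rfact N powr (1 / 2)"
    using subfactorialE [OF assms, of "1 / 2"] by auto
  note W = subfactorial_shift_summable [OF A(2) A(1), where w = "dbl u"]
  have "(\<lambda>K. norm (a K * divpow (dbl u) K)) summable_on UNIV"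
    by (rule summable_on_comparison_test [OF summable_on_cmult_right [OF W(1)]])
       (use W(2) [of 0] in \<open>auto simp: norm_mult\<close>)
  then have "(\<lambda>K. a K * divpow (dbl u) K) summable_on UNIV" by (rule abs_summable_summable)
  then show "((\<lambda>N. a N * divpow (dbl u) N) has_sum recentre a (p + u - p) 0) UNIV"
    by (simp add: recentre_def)
qed

text \<open>
  In terms of growth, these are the entire functions of \<open>(z, cnj z)\<close> of order at most one.
\<close>

definition order_one :: "(complex ^ 'n \<Rightarrow> complex) \<Rightarrow> bool" where
  "order_one f \<longleftrightarrow> (\<forall>x. entire_expansion f (jet f x) x \<and> subfactorial (jet f x))"

text \<open>Recentring preserves both convergence everywhere and the growth condition, so a single
  centre suffices.\<close>

lemma order_oneI:
  assumes "entire_expansion f a p" "subfactorial a"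
  shows "order_one f"
  unfolding order_one_def
proof
  fix x
  have "entire_expansion f (recentre a (x - p)) x" "subfactorial (recentre a (x - p))"
    using assms by (auto intro: entire_expansion_recentre subfactorial_recentre)
  then show "entire_expansion f (jet f x) x \<and> subfactorial (jet f x)"
    using entire_expansion_jet by metis
qed

lemma wick_functions_subfactorial:
  assumes "0 < hbar" "f \<in> wick_functions p hbar"
  shows "subfactorial (jet f p)"
  unfolding subfactorial_def
proof (intro allI impI)
  fix e :: real assume "0 < e"
  then obtain i C where "0 < C" "jet_bound p f (C * wick_seminorm p hbar i f) e"
    using jet_bound_wick_seminorm [OF assms(1)] assms(2) by metis
  moreover have "0 \<le> C * wick_seminorm p hbar i f"
    using \<open>0 < C\<close> by (simp add: wick_seminorm_def split: prod.split)
  ultimately show "\<exists>A\<ge>0. \<forall>N. norm (jet f p N) \<le> A * rfact N powr e"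
    unfolding jet_bound_def by blast
qed

text \<open>A real-analytic f is compared with the sum of its Taylor series at p, which converges
  everywhere by the growth of its jet; the identity theorem makes them equal. Conversely the growth
  condition makes every h finite.\<close>

lemma carrier_wick_algebra:
  assumes hbar: "0 < hbar"
  shows "carrier (wick_algebra p hbar) = Collect order_one"
proof (intro equalityI subsetI)
  fix f assume "f \<in> carrier (wick_algebra p hbar)"
  then have f: "f \<in> wick_functions p hbar" "real_analytic f" by (auto simp: wick_algebra_def)
  let ?g = "\<lambda>x. recentre (jet f p) (x - p) 0"
  have a: "subfactorial (jet f p)" by (rule wick_functions_subfactorial [OF hbar f(1)])
  then have g: "entire_expansion ?g (jet f p) p" by (rule subfactorial_entire_expansion)
  obtain r where r: "0 < r" "expands f (jet f p) p r"
    using f(2) expands_jet unfolding real_analytic_iff by metis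
  have "jet (\<lambda>x. f x - ?g x) p = (\<lambda>_. 0)"
    using expands_imp_jet [OF expands_diff [OF r(2) entire_expansion_expands [OF g]] r(1)] by simp
  then have "f x - ?g x = 0" for x
    by (rule real_analytic_identity [OF real_analytic_diff [OF f(2) entire_expansion_real_analytic [OF g]]])
  then have "f = ?g" by auto
  then show "f \<in> Collect order_one"
    using order_oneI [OF g a] by simp
next
  fix f :: "complex ^ 'a \<Rightarrow> complex" assume "f \<in> Collect order_one"
  then have f: "entire_expansion f (jet f p) p" "subfactorial (jet f p)"
    by (auto simp: order_one_def)
  then have "real_analytic f" by (blast intro: entire_expansion_real_analytic)
  moreover have "f \<in> wick_functions p hbar"
    using f(2) hbar real_analytic_imp_smooth [OF \<open>real_analytic f\<close>]
    by (intro wick_functionsI) (auto simp: subfactorial_def jet_bound_def)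
  ultimately show "f \<in> carrier (wick_algebra p hbar)" by (simp add: wick_algebra_def)
qed

section \<open>The Wick product\<close>

lemma has_sum_product_complex:
  fixes x :: "'a \<Rightarrow> complex" and y :: "'b \<Rightarrow> complex"
  assumes x: "(x has_sum X) UNIV" and y: "(y has_sum Y) UNIV"
  shows "((\<lambda>(i, j). x i * y j) has_sum X * Y) UNIV"
proof -
  have "((\<lambda>(i, j). x i * y j) has_sum X * Y) (UNIV \<times> UNIV)"
  proof (rule has_sum_SigmaI)
    show "((\<lambda>j. (\<lambda>(i, j). x i * y j) (i, j)) has_sum x i * Y) UNIV" for i
      using has_sum_cmult_right [OF y, of "x i"] by simp
    show "((\<lambda>i. x i * Y) has_sum X * Y) UNIV" by (rule has_sum_cmult_left [OF x])
    have "(\<lambda>i. norm (x i)) summable_on UNIV" "(\<lambda>j. norm (y j)) summable_on UNIV"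
      using has_sum_imp_summable [OF x] has_sum_imp_summable [OF y]
      by (simp_all add: summable_on_iff_abs_summable_on_complex)
    from summable_on_times [OF this]
    have "(\<lambda>p. norm ((\<lambda>(i, j). x i * y j) p)) summable_on UNIV"
      by (simp add: norm_mult case_prod_unfold)
    then show "(\<lambda>(i, j). x i * y j) summable_on UNIV \<times> UNIV"
      using abs_summable_summable by simp blast
  qed
  then show ?thesis by simp
qed

text \<open>Leibniz' rule applied to a star product yields this shape: a finite sum over the
  splittings of N, and inside it the infinite sum over contractions M.\<close>

lemma has_sum_antidiagonal_inner:
  fixes P :: "nat ^ 'm \<Rightarrow> nat ^ 'm \<Rightarrow> 'b \<Rightarrow> complex"
  assumes "((\<lambda>((K, L), M). P K L M) has_sum s) UNIV"
  shows "((\<lambda>N. \<Sum>K\<le>N. \<Sum>\<^sub>\<infinity>M. P K (N - K) M) has_sum s) UNIV"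
proof (rule has_sum_antidiagonal)
  show "((\<lambda>(K, L). \<Sum>\<^sub>\<infinity>M. P K L M) has_sum s) UNIV"
  proof (rule has_sum_SigmaD)
    show 1: "((\<lambda>((K, L), M). P K L M) has_sum s) (UNIV \<times> UNIV)" using assms by simp
    fix KL :: "(nat ^ 'm) \<times> (nat ^ 'm)"
    have "(\<lambda>M. P (fst KL) (snd KL) M) summable_on UNIV"
      using summable_on_SigmaD1 [of "\<lambda>KL M. P (fst KL) (snd KL) M" UNIV "\<lambda>_. UNIV" KL]
        has_sum_imp_summable [OF 1] by (simp add: case_prod_unfold)
    then show "((\<lambda>M. (\<lambda>((K, L), M). P K L M) (KL, M)) has_sum (case KL of (K, L) \<Rightarrow> \<Sum>\<^sub>\<infinity>M. P K L M)) UNIV"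
      by (simp add: case_prod_unfold has_sum_infsum)
  qed
qed

text \<open>
  The Wick product with the powers \<open>(2 \<alpha>)^d\<close> replaced by a general weight \<open>t d\<close>: its linearity in
  \<open>t\<close> reduces holomorphy in \<open>\<alpha>\<close> to estimates for the weights.
\<close>

definition weighted_term ::
    "(nat \<Rightarrow> complex) \<Rightarrow> (complex ^ 'n \<Rightarrow> complex) \<Rightarrow> (complex ^ 'n \<Rightarrow> complex) \<Rightarrow>
     complex ^ 'n \<Rightarrow> nat ^ 'n \<Rightarrow> complex" where
  "weighted_term t f g x M = t (mdegree M) / of_nat (mfact M) * mderiv M 0 f x * mderiv 0 M g x"

definition weighted_star ::
    "(nat \<Rightarrow> complex) \<Rightarrow> (complex ^ 'n \<Rightarrow> complex) \<Rightarrow> (complex ^ 'n \<Rightarrow> complex) \<Rightarrow>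
     complex ^ 'n \<Rightarrow> complex" where
  "weighted_star t f g x = (\<Sum>\<^sub>\<infinity>M\<in>UNIV. weighted_term t f g x M)"

text \<open>Leibniz' rule for the derivative of order N of the weighted product: K falls on the
  first factor, N - K on the second, and M counts the contractions between them.\<close>

definition star_coeff ::
    "(nat \<Rightarrow> complex) \<Rightarrow> (nat ^ ('n::finite + 'n) \<Rightarrow> complex) \<Rightarrow> (nat ^ ('n + 'n) \<Rightarrow> complex) \<Rightarrow>
     nat ^ ('n + 'n) \<Rightarrow> complex" where
  "star_coeff t a b N = (\<Sum>K\<le>N. of_nat (mbinom N K) *
     (\<Sum>\<^sub>\<infinity>M\<in>UNIV. t (mdegree M) / of_nat (mfact M) * a (mpair M 0 + K) * b (mpair 0 M + (N - K))))"

lemma summable_root_weight: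
  "0 \<le> c \<Longrightarrow> (\<lambda>N :: nat ^ 'm. c ^ mdegree N * rfact N powr (- 1 / 2)) summable_on UNIV"
  by (intro summable_power_mfact_powr) auto

lemma mfact_powr_half: "rfact M powr (- 1 / 2) = rfact M powr (1 / 2) / rfact M"
  using powr_add [of "rfact M" "- 1 / 2" 1] by (simp add: field_simps)

text \<open>The origin of the threshold 1/4: two factors with this growth, divided by M!, still
  leave a factor that beats every exponential.\<close>

lemma mfact_powr_quarter:
  assumes "e \<le> 1 / 4"
  shows "rfact M powr e * rfact M powr e / rfact M \<le> rfact M powr (- 1 / 2)"
proof -
  have "rfact M powr e * rfact M powr e \<le> rfact M powr (1 / 2)"
    unfolding powr_add [symmetric] using assms mfact_ge_1 by (intro powr_mono) auto
  then show ?thesis unfolding mfact_powr_half by (intro divide_right_mono) auto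
qed

context
  fixes t :: "nat \<Rightarrow> complex" and a b :: "nat ^ ('n::finite + 'n) \<Rightarrow> complex" and T \<rho> A B e :: real
  assumes t: "\<And>d. norm (t d) \<le> T * \<rho> ^ d" and nonneg: "0 \<le> T" "0 \<le> \<rho>" "0 \<le> A" "0 \<le> B"
    and a: "\<And>N. norm (a N) \<le> A * rfact N powr e" and b: "\<And>N. norm (b N) \<le> B * rfact N powr e"
    and e: "0 \<le> e" "e \<le> 1 / 4"
begin

text \<open>Splitting (M + K)! and (M + L)! separates the three indices; each splitting contributes
  2^|M|, whence the 4 in front of \<rho>.\<close>

lemma norm_star_summand_le:
  "norm (t (mdegree M) / of_nat (mfact M) * a (mpair M 0 + K) * b (mpair 0 M + L))
    \<le> (T * A * B * (2 ^ mdegree K * rfact K powr e) * (2 ^ mdegree L * rfact L powr e)) *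
      ((4 * \<rho>) ^ mdegree M * rfact M powr (- 1 / 2))"
proof -
  have a': "norm (a (mpair M 0 + K)) \<le> A * (2 ^ (mdegree M + mdegree K) * (rfact M powr e * rfact K powr e))"
    using mfact_add_powr_le [of e "mpair M 0" K] e nonneg
    by (intro order_trans [OF a] mult_left_mono) auto
  have b': "norm (b (mpair 0 M + L)) \<le> B * (2 ^ (mdegree M + mdegree L) * (rfact M powr e * rfact L powr e))"
    using mfact_add_powr_le [of e "mpair 0 M" L] e nonneg
    by (intro order_trans [OF b] mult_left_mono) auto
  have "norm (t (mdegree M) / of_nat (mfact M) * a (mpair M 0 + K) * b (mpair 0 M + L))
      = norm (t (mdegree M)) / rfact M * norm (a (mpair M 0 + K)) * norm (b (mpair 0 M + L))"
    by (simp add: norm_mult norm_divide)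
  also have "\<dots> \<le> T * \<rho> ^ mdegree M / rfact M *
      (A * (2 ^ (mdegree M + mdegree K) * (rfact M powr e * rfact K powr e))) *
      (B * (2 ^ (mdegree M + mdegree L) * (rfact M powr e * rfact L powr e)))"
    using a' b' t nonneg by (intro mult_mono divide_right_mono) auto
  also have "\<dots> = (T * A * B * (2 ^ mdegree K * rfact K powr e) * (2 ^ mdegree L * rfact L powr e)) *
      ((4 * \<rho>) ^ mdegree M * (rfact M powr e * rfact M powr e / rfact M))"
  proof -
    have "(4::real) ^ d = 2 ^ d * 2 ^ d" for d by (simp flip: power_mult_distrib)
    then show ?thesis by (simp add: power_add power_mult_distrib mult_ac)
  qed
  also have "\<dots> \<le> (T * A * B * (2 ^ mdegree K * rfact K powr e) * (2 ^ mdegree L * rfact L powr e)) *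
      ((4 * \<rho>) ^ mdegree M * rfact M powr (- 1 / 2))"
    using nonneg e by (intro mult_left_mono mfact_powr_quarter) auto
  finally show ?thesis .
qed

lemma star_summand_summable:
  "(\<lambda>M. norm (t (mdegree M) / of_nat (mfact M) * a (mpair M 0 + K) * b (mpair 0 M + L))) summable_on UNIV"
  by (rule summable_on_comparison_test [OF summable_on_cmult_right [OF summable_root_weight [of "4 * \<rho>"]]])
     (use norm_star_summand_le nonneg in auto)

text \<open>The separated factorials recombine through K! L! \<le> N!. One factor 2^|N| comes from
  the splittings and one from the sum of the binomial coefficients, together 4^|N|. The exponent e
  itself does not grow.\<close>

lemma norm_star_coeff_le:
  "norm (star_coeff t a b N) \<le> T * A * B *
     (\<Sum>\<^sub>\<infinity>M\<in>(UNIV :: (nat ^ 'n) set). (4 * \<rho>) ^ mdegree M * rfact M powr (- 1 / 2)) *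
     4 ^ mdegree N * rfact N powr e"
proof -
  let ?V = "\<lambda>M :: nat ^ 'n. (4 * \<rho>) ^ mdegree M * rfact M powr (- 1 / 2)"
  have V: "?V summable_on UNIV" using nonneg by (intro summable_root_weight) auto
  have "norm (\<Sum>\<^sub>\<infinity>M. t (mdegree M) / of_nat (mfact M) * a (mpair M 0 + K) * b (mpair 0 M + (N - K)))
      \<le> T * A * B * 2 ^ mdegree N * rfact N powr e * infsum ?V UNIV" if KN: "K \<le> N" for K
  proof -
    obtain L where N: "N = K + L" using KN unfolding vec_le_sum_multiindex by blast
    let ?c = "T * A * B * (2 ^ mdegree K * rfact K powr e) * (2 ^ mdegree L * rfact L powr e)"
    have "norm (\<Sum>\<^sub>\<infinity>M. t (mdegree M) / of_nat (mfact M) * a (mpair M 0 + K) * b (mpair 0 M + L))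
        \<le> (\<Sum>\<^sub>\<infinity>M. ?c * ?V M)"
      by (rule norm_infsum_le [OF has_sum_infsum [OF abs_summable_summable [OF star_summand_summable]]
            has_sum_infsum [OF summable_on_cmult_right [OF V]] norm_star_summand_le])
    also have "\<dots> = (T * A * B * 2 ^ mdegree N * (rfact K powr e * rfact L powr e)) * infsum ?V UNIV"
      unfolding infsum_cmult_right' N by (simp add: power_add mult_ac)
    also have "rfact K powr e * rfact L powr e = (real (mfact K * mfact L)) powr e"
      by (simp add: powr_mult)
    also have "\<dots> \<le> rfact N powr e"
      using e mfact_mult_le [of K L] unfolding N by (intro powr_mono2) (auto simp flip: of_nat_mult)
    finally show ?thesis
      using nonneg by (simp add: N mult_left_mono mult_right_mono infsum_nonneg)
  qed
  then have "norm (star_coeff t a b N) \<le> (\<Sum>K\<le>N. real (mbinom N K) *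
      (T * A * B * 2 ^ mdegree N * rfact N powr e * infsum ?V UNIV))"
    unfolding star_coeff_def by (intro sum_norm_le) (auto simp: norm_mult intro!: mult_left_mono)
  also have "\<dots> = 2 ^ mdegree N * (T * A * B * 2 ^ mdegree N * rfact N powr e * infsum ?V UNIV)"
    by (simp add: sum_distrib_right [symmetric] sum_mbinom)
  also have "\<dots> = T * A * B * infsum ?V UNIV * 4 ^ mdegree N * rfact N powr e"
  proof -
    have "(4::real) ^ d = 2 ^ d * 2 ^ d" for d by (simp flip: power_mult_distrib)
    then show ?thesis by (simp add: mult_ac)
  qed
  finally show ?thesis .
qed

text \<open>The majorant is a product of one function of M, one of K and one of L, each of them
  summable.\<close>

lemma star_triple_summable:
  fixes w :: "complex ^ ('n + 'n)"
  shows "(\<lambda>(M, K, L). t (mdegree M) / of_nat (mfact M) * a (mpair M 0 + K) * b (mpair 0 M + L)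
            * divpow w K * divpow w L) summable_on UNIV"
proof -
  let ?V = "\<lambda>M :: nat ^ 'n. (4 * \<rho>) ^ mdegree M * rfact M powr (- 1 / 2)"
  let ?Y = "\<lambda>K :: nat ^ ('n + 'n). (2 ^ mdegree K * rfact K powr e) * norm (divpow w K)"
  let ?r = "\<Sum>i\<in>UNIV. norm (w $ i)"
  have V: "?V summable_on UNIV" using nonneg by (intro summable_root_weight) auto
  have "?Y K \<le> (2 * ?r) ^ mdegree K * rfact K powr (- 1 / 2)" for K
  proof -
    have "?Y K \<le> (2 ^ mdegree K * rfact K powr (1 / 2)) * (?r ^ mdegree K / rfact K)"
      using e mfact_ge_1 by (intro mult_mono mult_left_mono powr_mono divpow_le) auto
    also have "\<dots> = (2 * ?r) ^ mdegree K * rfact K powr (- 1 / 2)"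
      unfolding mfact_powr_half by (simp add: power_mult_distrib)
    finally show ?thesis .
  qed
  moreover have "0 \<le> 2 * ?r" by (simp add: sum_nonneg)
  ultimately have Y: "?Y summable_on UNIV"
    by (intro summable_on_comparison_test [OF summable_root_weight [of "2 * ?r"]]) auto
  have "(\<lambda>(M, K, L). ?V M * (?Y K * ?Y L)) summable_on UNIV"
    using summable_on_times [OF V summable_on_times [OF Y Y]] nonneg
    by (auto simp: case_prod_unfold)
  from summable_on_cmult_right [OF this, of "T * A * B"]
  have "(\<lambda>p. norm (case p of (M, K, L) \<Rightarrow> t (mdegree M) / of_nat (mfact M) * a (mpair M 0 + K) * b (mpair 0 M + L)
            * divpow w K * divpow w L)) summable_on UNIV"
  proof (rule summable_on_comparison_test)
    fix p :: "(nat ^ 'n) \<times> (nat ^ ('n + 'n)) \<times> (nat ^ ('n + 'n))"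
    obtain M K L where p: "p = (M, K, L)" by (metis surj_pair)
    have "norm (t (mdegree M) / of_nat (mfact M) * a (mpair M 0 + K) * b (mpair 0 M + L)) *
          (norm (divpow w K) * norm (divpow w L))
        \<le> (T * A * B * (2 ^ mdegree K * rfact K powr e) * (2 ^ mdegree L * rfact L powr e)) *
        ?V M * (norm (divpow w K) * norm (divpow w L))"
      by (intro mult_right_mono norm_star_summand_le) auto
    then show "norm (case p of (M, K, L) \<Rightarrow> t (mdegree M) / of_nat (mfact M) * a (mpair M 0 + K) * b (mpair 0 M + L)
            * divpow w K * divpow w L) \<le> T * A * B * (case p of (M, K, L) \<Rightarrow> ?V M * (?Y K * ?Y L))"
      by (simp add: p norm_mult norm_divide mult_ac)
  qed auto
  then show ?thesis by (rule abs_summable_summable)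
qed

end

lemma mbinom_divpow:
  assumes "K \<le> N"
  shows "divpow w K * divpow w (N - K) = of_nat (mbinom N K) * divpow w N"
  using assms by (auto simp: vec_le_sum_multiindex divpow_mult_divpow)

text \<open>The triple series is summed in two orders. With (K, L) innermost it reproduces the
  derivatives of f and g at x + u, hence the product there; with M innermost and (K, L) along
  antidiagonals it is a power series about x with coefficients \<open>star_coeff\<close>.\<close>

lemma weighted_star_has_sum:
  fixes f g :: "complex ^ 'n \<Rightarrow> complex"
  assumes f: "order_one f" and g: "order_one g"
    and t: "\<And>d. norm (t d) \<le> T * \<rho> ^ d" and nonneg: "0 \<le> T" "0 \<le> \<rho>"
  shows "(weighted_term t f g (x + u) has_sum weighted_star t f g (x + u)) UNIV"
    and "((\<lambda>N. star_coeff t (jet f x) (jet g x) N * divpow (dbl u) N) has_sum weighted_star t f g (x + u)) UNIV"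
proof -
  let ?a = "jet f x" and ?b = "jet g x" and ?w = "dbl u"
  let ?s = "\<lambda>M K L. t (mdegree M) / of_nat (mfact M) * ?a (mpair M 0 + K) * ?b (mpair 0 M + L)"
  have fx: "entire_expansion f ?a x" "subfactorial ?a" and gx: "entire_expansion g ?b x" "subfactorial ?b"
    using f g by (auto simp: order_one_def)
  obtain A where A: "0 \<le> A" "\<And>N. norm (?a N) \<le> A * rfact N powr (1 / 4)"
    using subfactorialE [OF fx(2), of "1 / 4"] by auto
  obtain B where B: "0 \<le> B" "\<And>N. norm (?b N) \<le> B * rfact N powr (1 / 4)"
    using subfactorialE [OF gx(2), of "1 / 4"] by auto
  have "(\<lambda>(M, K, L). ?s M K L * divpow ?w K * divpow ?w L) summable_on UNIV"
    by (rule star_triple_summable [OF t nonneg A(1) B(1) A(2) B(2)]) auto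
  then obtain S where S: "((\<lambda>(M, K, L). ?s M K L * divpow ?w K * divpow ?w L) has_sum S) UNIV"
    by (auto simp: summable_on_def)
  have 1: "(weighted_term t f g (x + u) has_sum S) UNIV"
  proof (rule has_sum_SigmaD)
    show "((\<lambda>(M, K, L). ?s M K L * divpow ?w K * divpow ?w L) has_sum S) (UNIV \<times> UNIV)"
      using S by simp
    fix M :: "nat ^ 'n"
    have "((\<lambda>K. ?a (mpair M 0 + K) * divpow ?w K) has_sum mderiv M 0 f (x + u)) UNIV"
        "((\<lambda>K. ?b (mpair 0 M + K) * divpow ?w K) has_sum mderiv 0 M g (x + u)) UNIV"
      using expandsD [OF expands_mderiv [OF entire_expansion_expands [OF fx(1)]], of u "norm u + 1"]
        expandsD [OF expands_mderiv [OF entire_expansion_expands [OF gx(1)]], of u "norm u + 1"]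
      by simp_all
    from has_sum_cmult_right [OF has_sum_product_complex [OF this], of "t (mdegree M) / of_nat (mfact M)"]
    show "((\<lambda>y. (\<lambda>(M, K, L). ?s M K L * divpow ?w K * divpow ?w L) (M, y)) has_sum weighted_term t f g (x + u) M) UNIV"
      by (simp add: weighted_term_def case_prod_unfold mult_ac)
  qed
  then have S_eq: "S = weighted_star t f g (x + u)"
    by (simp add: weighted_star_def infsumI)
  with 1 show "(weighted_term t f g (x + u) has_sum weighted_star t f g (x + u)) UNIV" by simp
  have "((\<lambda>((K, L), M). ?s M K L * divpow ?w K * divpow ?w L) has_sum S) UNIV"
    using S by (subst has_sum_reindex_bij_witness [where j = "\<lambda>(P, M). (M, P)" and i = "\<lambda>(M, P). (P, M)"
        and T = UNIV and h = "\<lambda>(M, K, L). ?s M K L * divpow ?w K * divpow ?w L" and s' = S]) auto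
  from has_sum_antidiagonal_inner [OF this]
  have "((\<lambda>N. \<Sum>K\<le>N. \<Sum>\<^sub>\<infinity>M. ?s M K (N - K) * divpow ?w K * divpow ?w (N - K)) has_sum S) UNIV" .
  moreover have "(\<Sum>K\<le>N. \<Sum>\<^sub>\<infinity>M. ?s M K (N - K) * divpow ?w K * divpow ?w (N - K))
      = star_coeff t ?a ?b N * divpow ?w N" for N
    unfolding star_coeff_def sum_distrib_right
  proof (rule sum.cong [OF refl])
    fix K assume "K \<in> {..N}"
    then have 1: "divpow ?w K * divpow ?w (N - K) = of_nat (mbinom N K) * divpow ?w N"
      by (simp add: mbinom_divpow)
    have 2: "(\<Sum>\<^sub>\<infinity>M. h M * x * y) = infsum h UNIV * (x * y)" for h :: "nat ^ 'n \<Rightarrow> complex" and x y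
      by (simp add: mult.assoc infsum_cmult_left')
    show "(\<Sum>\<^sub>\<infinity>M. ?s M K (N - K) * divpow ?w K * divpow ?w (N - K))
        = of_nat (mbinom N K) * (\<Sum>\<^sub>\<infinity>M. ?s M K (N - K)) * divpow ?w N"
      unfolding 2 1 by (simp only: mult_ac)
  qed
  ultimately show "((\<lambda>N. star_coeff t ?a ?b N * divpow ?w N) has_sum weighted_star t f g (x + u)) UNIV"
    by (simp add: S_eq)
qed

lemma subfactorial_star_coeff:
  assumes a: "subfactorial a" and b: "subfactorial b"
    and t: "\<And>d. norm (t d) \<le> T * \<rho> ^ d" and nonneg: "0 \<le> T" "0 \<le> \<rho>"
  shows "subfactorial (star_coeff t a (b :: nat ^ ('n::finite + 'n) \<Rightarrow> complex))"
  unfolding subfactorial_def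
proof (intro allI impI)
  fix e :: real assume "0 < e"
  \<comment> \<open>Half of the exponent is reserved for absorbing 4^|N|, and 1/4 is the threshold
    for convergence in M.\<close>
  define d where "d = min (e / 2) (1 / 4)"
  have d: "0 < d" "d \<le> 1 / 4" "d + d \<le> e" using \<open>0 < e\<close> by (auto simp: d_def)
  obtain A where A: "0 \<le> A" "\<And>N. norm (a N) \<le> A * rfact N powr d"
    using subfactorialE [OF a d(1)] by auto
  obtain B where B: "0 \<le> B" "\<And>N. norm (b N) \<le> B * rfact N powr d"
    using subfactorialE [OF b d(1)] by auto
  obtain C where C: "0 < C" "\<And>N :: nat ^ ('n + 'n). 4 ^ mdegree N \<le> C * rfact N powr d"
    by (rule power_mdegree_le_mfact_powr [of d 4]) (use d in auto)
  define V where "V = (\<Sum>\<^sub>\<infinity>M\<in>(UNIV :: (nat ^ 'n) set). (4 * \<rho>) ^ mdegree M * rfact M powr (- 1 / 2))"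
  have V: "0 \<le> V" unfolding V_def using nonneg by (intro infsum_nonneg) auto
  have D: "0 \<le> T * A * B * V" using nonneg A B V by simp
  have "norm (star_coeff t a b N) \<le> (T * A * B * V * C) * rfact N powr e" for N
  proof -
    have "norm (star_coeff t a b N) \<le> T * A * B * V * 4 ^ mdegree N * rfact N powr d"
      unfolding V_def by (rule norm_star_coeff_le [OF t nonneg A(1) B(1) A(2) B(2) less_imp_le [OF d(1)] d(2)])
    also have "\<dots> \<le> T * A * B * V * (C * rfact N powr d) * rfact N powr d"
      using D C by (intro mult_right_mono mult_left_mono) auto
    also have "\<dots> = (T * A * B * V * C) * rfact N powr (d + d)"
      by (simp only: powr_add mult_ac)
    also have "\<dots> \<le> (T * A * B * V * C) * rfact N powr e"
      using D C d mfact_ge_1 by (intro mult_left_mono powr_mono) auto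
    finally show ?thesis .
  qed
  moreover have "0 \<le> T * A * B * V * C" using D C by simp
  ultimately show "\<exists>A\<ge>0. \<forall>N. norm (star_coeff t a b N) \<le> A * rfact N powr e" by blast
qed

context
  fixes f g :: "complex ^ 'n \<Rightarrow> complex" and t :: "nat \<Rightarrow> complex" and T \<rho> :: real
  assumes f: "order_one f" and g: "order_one g"
    and t: "\<And>d. norm (t d) \<le> T * \<rho> ^ d" and nonneg: "0 \<le> T" "0 \<le> \<rho>"
begin

lemma weighted_star_expansion:
  "entire_expansion (weighted_star t f g) (star_coeff t (jet f x) (jet g x)) x"
  using weighted_star_has_sum(2) [OF f g t nonneg] by (simp add: entire_expansion_def)

lemma order_one_weighted_star: "order_one (weighted_star t f g)"
  using f g by (intro order_oneI [OF weighted_star_expansion [of 0]] subfactorial_star_coeff [OF _ _ t nonneg])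
     (auto simp: order_one_def)

lemma jet_weighted_star: "jet (weighted_star t f g) x = star_coeff t (jet f x) (jet g x)"
  by (rule entire_expansion_jet [OF weighted_star_expansion])

end

section \<open>Linear structure and seminorm estimates for weighted products\<close>

lemma order_one_expands: "order_one f \<Longrightarrow> expands f (jet f x) x r"
  by (auto simp: order_one_def intro: entire_expansion_expands)

lemma order_one_smooth: "order_one f \<Longrightarrow> smooth f"
  by (auto simp: order_one_def intro: real_analytic_imp_smooth entire_expansion_real_analytic)

lemma order_one_lincomb:
  assumes f: "order_one f" and g: "order_one g"
  shows "order_one (\<lambda>x. c * f x + d * g x)"
proof (rule order_oneI [where p = 0])
  show "entire_expansion (\<lambda>x. c * f x + d * g x) (\<lambda>N. c * jet f 0 N + d * jet g 0 N) 0"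
    unfolding entire_expansion_iff
    by (intro allI expands_add expands_cmult order_one_expands f g)
  show "subfactorial (\<lambda>N. c * jet f 0 N + d * jet g 0 N)"
    unfolding subfactorial_def
  proof (intro allI impI)
    fix e :: real assume "0 < e"
    obtain A where A: "0 \<le> A" "\<And>N. norm (jet f 0 N) \<le> A * rfact N powr e"
      using f subfactorialE [OF _ \<open>0 < e\<close>] unfolding order_one_def by metis
    obtain B where B: "0 \<le> B" "\<And>N. norm (jet g 0 N) \<le> B * rfact N powr e"
      using g subfactorialE [OF _ \<open>0 < e\<close>] unfolding order_one_def by metis
    have "norm (c * jet f 0 N + d * jet g 0 N) \<le> (norm c * A + norm d * B) * rfact N powr e" for N
    proof -
      have "norm (c * jet f 0 N + d * jet g 0 N) \<le> norm c * norm (jet f 0 N) + norm d * norm (jet g 0 N)"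
        by (rule norm_triangle_le) (simp add: norm_mult)
      also have "\<dots> \<le> norm c * (A * rfact N powr e) + norm d * (B * rfact N powr e)"
        using A B by (intro add_mono mult_left_mono) auto
      finally show ?thesis by (simp add: algebra_simps)
    qed
    moreover have "0 \<le> norm c * A + norm d * B" using A B by simp
    ultimately show "\<exists>A\<ge>0. \<forall>N. norm (c * jet f 0 N + d * jet g 0 N) \<le> A * rfact N powr e" by blast
  qed
qed

lemma order_one_wick_functions: "0 < hbar \<Longrightarrow> order_one f \<Longrightarrow> f \<in> wick_functions p hbar"
  using carrier_wick_algebra [of hbar p] by (auto simp: wick_algebra_def)

text \<open>The seminorm is bounded by the jet of the product, this by the jets of the factors, and
  these by one seminorm j. For fixed \<rho>, neither j nor C depends on the weight; the linear
  dependence on T is what later makes the remainder of a difference quotient small.\<close>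

lemma wick_seminorm_weighted_star:
  fixes p :: "complex ^ 'n"
  assumes hbar: "0 < hbar" and i: "i \<in> wick_indices" and \<rho>: "0 \<le> \<rho>"
  shows "\<exists>j\<in>wick_indices. \<exists>C. \<forall>t T f g. 0 \<le> T \<longrightarrow> (\<forall>d. norm (t d) \<le> T * \<rho> ^ d) \<longrightarrow>
       order_one f \<longrightarrow> order_one g \<longrightarrow>
       wick_seminorm p hbar i (weighted_star t f g) \<le> C * T * wick_seminorm p hbar j f * wick_seminorm p hbar j g"
proof -
  obtain e0 C0 where e0: "0 < e0" "0 < C0"
    and sem: "\<And>f A. 0 \<le> A \<Longrightarrow> jet_bound p f A e0 \<Longrightarrow> wick_seminorm p hbar i f \<le> C0 * A"
    using wick_seminorm_le_jet_bound [OF hbar i] by metis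
  define e where "e = min (e0 / 2) (1 / 4)"
  have e: "0 < e" "e \<le> 1 / 4" "e + e \<le> e0" using e0 by (auto simp: e_def)
  obtain j C1 where j: "j \<in> wick_indices" and C1: "0 < C1"
    and jet: "\<And>f. f \<in> wick_functions p hbar \<Longrightarrow> jet_bound p f (C1 * wick_seminorm p hbar j f) e"
    using jet_bound_wick_seminorm [OF hbar e(1)] by metis
  obtain C2 where C2: "0 < C2" "\<And>N :: nat ^ ('n + 'n). 4 ^ mdegree N \<le> C2 * rfact N powr e"
    by (rule power_mdegree_le_mfact_powr [of e 4]) (use e in auto)
  define V where "V = (\<Sum>\<^sub>\<infinity>M\<in>(UNIV :: (nat ^ 'n) set). (4 * \<rho>) ^ mdegree M * rfact M powr (- 1 / 2))"
  have V: "0 \<le> V" unfolding V_def using \<rho> by (intro infsum_nonneg) auto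
  have "wick_seminorm p hbar i (weighted_star t f g)
      \<le> (C0 * C1 * C1 * V * C2) * T * wick_seminorm p hbar j f * wick_seminorm p hbar j g"
    if T: "0 \<le> T" and t: "\<And>d. norm (t d) \<le> T * \<rho> ^ d" and f: "order_one f" and g: "order_one g" for t T f g
  proof -
    define A where "A = C1 * wick_seminorm p hbar j f"
    define B where "B = C1 * wick_seminorm p hbar j g"
    have AB: "0 \<le> A" "0 \<le> B"
      using C1 by (auto simp: A_def B_def wick_seminorm_def split: prod.split)
    have a: "norm (jet f p N) \<le> A * rfact N powr e" and b: "norm (jet g p N) \<le> B * rfact N powr e" for N
      using jet [OF order_one_wick_functions [OF hbar f]] jet [OF order_one_wick_functions [OF hbar g]]
      by (auto simp: jet_bound_def A_def B_def)
    have D: "0 \<le> T * A * B * V" using T AB V by simp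
    have jb: "jet_bound p (weighted_star t f g) (T * A * B * V * C2) e0"
      unfolding jet_bound_def jet_weighted_star [OF f g t T \<rho>]
    proof
      fix N
      have "norm (star_coeff t (jet f p) (jet g p) N) \<le> T * A * B * V * 4 ^ mdegree N * rfact N powr e"
        unfolding V_def by (rule norm_star_coeff_le [OF t T \<rho> AB a b less_imp_le [OF e(1)] e(2)])
      also have "\<dots> \<le> T * A * B * V * (C2 * rfact N powr e) * rfact N powr e"
        using D C2 by (intro mult_right_mono mult_left_mono) auto
      also have "\<dots> = (T * A * B * V * C2) * rfact N powr (e + e)"
        by (simp only: powr_add mult_ac)
      also have "\<dots> \<le> (T * A * B * V * C2) * rfact N powr e0"
        using D C2 e mfact_ge_1 by (intro mult_left_mono powr_mono) auto
      finally show "norm (star_coeff t (jet f p) (jet g p) N) \<le> T * A * B * V * C2 * rfact N powr e0" .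
    qed
    have "0 \<le> T * A * B * V * C2" using D C2 by simp
    from sem [OF this jb] show ?thesis by (simp add: A_def B_def mult_ac)
  qed
  with j show ?thesis by (intro bexI [of _ j] exI [of _ "C0 * C1 * C1 * V * C2"]) auto
qed

lemma has_sum_lincomb:
  fixes F G :: "'a \<Rightarrow> complex"
  assumes "(F has_sum s) A" "(G has_sum s') A"
  shows "((\<lambda>x. c * F x + d * G x) has_sum c * s + d * s') A"
  using assms by (intro has_sum_add has_sum_cmult_right)

context
  fixes t :: "nat \<Rightarrow> complex" and T \<rho> :: real
  assumes t: "\<And>d. norm (t d) \<le> T * \<rho> ^ d" and nonneg: "0 \<le> T" "0 \<le> \<rho>"
begin

lemma weighted_term_has_sum:
  "order_one f \<Longrightarrow> order_one g \<Longrightarrow> (weighted_term t f g x has_sum weighted_star t f g x) UNIV"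
  using weighted_star_has_sum(1) [OF _ _ t nonneg, of f g x 0] by simp

lemma weighted_star_lincomb_left:
  assumes "order_one f" "order_one f'" "order_one g"
  shows "weighted_star t (\<lambda>x. c * f x + d * f' x) g = (\<lambda>x. c * weighted_star t f g x + d * weighted_star t f' g x)"
proof
  fix x
  have eq: "weighted_term t (\<lambda>x. c * f x + d * f' x) g x = (\<lambda>M. c * weighted_term t f g x M + d * weighted_term t f' g x M)"
    using assms by (intro ext) (simp add: weighted_term_def mderiv_lincomb order_one_smooth algebra_simps)
  show "weighted_star t (\<lambda>x. c * f x + d * f' x) g x = c * weighted_star t f g x + d * weighted_star t f' g x"
    unfolding weighted_star_def [of t "\<lambda>x. c * f x + d * f' x"] eq
    by (intro infsumI has_sum_lincomb weighted_term_has_sum assms)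
qed

lemma weighted_star_lincomb_right:
  assumes "order_one f" "order_one g" "order_one g'"
  shows "weighted_star t f (\<lambda>x. c * g x + d * g' x) = (\<lambda>x. c * weighted_star t f g x + d * weighted_star t f g' x)"
proof
  fix x
  have eq: "weighted_term t f (\<lambda>x. c * g x + d * g' x) x = (\<lambda>M. c * weighted_term t f g x M + d * weighted_term t f g' x M)"
    using assms by (intro ext) (simp add: weighted_term_def mderiv_lincomb order_one_smooth algebra_simps)
  show "weighted_star t f (\<lambda>x. c * g x + d * g' x) x = c * weighted_star t f g x + d * weighted_star t f g' x"
    unfolding weighted_star_def [of t f "\<lambda>x. c * g x + d * g' x"] eq
    by (intro infsumI has_sum_lincomb weighted_term_has_sum assms)
qed

end

text \<open>Through this, a difference quotient of the product in \<alpha>, minus its expected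
  limit, becomes one weighted product to which a single estimate applies.\<close>

lemma weighted_star_lincomb_weight:
  assumes "order_one f" "order_one g"
    and t: "\<And>d. norm (t d) \<le> T * \<rho> ^ d" and s: "\<And>d. norm (s d) \<le> T' * \<rho>' ^ d"
    and nonneg: "0 \<le> T" "0 \<le> \<rho>" "0 \<le> T'" "0 \<le> \<rho>'"
  shows "weighted_star (\<lambda>k. c * t k + d * s k) f g = (\<lambda>x. c * weighted_star t f g x + d * weighted_star s f g x)"
proof
  fix x
  have eq: "weighted_term (\<lambda>k. c * t k + d * s k) f g x = (\<lambda>M. c * weighted_term t f g x M + d * weighted_term s f g x M)"
    by (intro ext) (simp add: weighted_term_def add_divide_distrib algebra_simps)
  show "weighted_star (\<lambda>k. c * t k + d * s k) f g x = c * weighted_star t f g x + d * weighted_star s f g x"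
    unfolding weighted_star_def [of "\<lambda>k. c * t k + d * s k"] eq
    by (intro infsumI has_sum_lincomb weighted_term_has_sum [OF t nonneg(1,2)]
          weighted_term_has_sum [OF s nonneg(3,4)] assms(1,2))
qed

section \<open>The Wick product as a weighted product, and its associativity\<close>

lemma wick_term_eq: "wick_term \<alpha> f g x = weighted_term (\<lambda>d. (2 * \<alpha>) ^ d) f g x"
  by (simp add: fun_eq_iff wick_term_def weighted_term_def)

lemma wick_star_eq: "wick_star \<alpha> f g = weighted_star (\<lambda>d. (2 * \<alpha>) ^ d) f g"
  by (simp add: fun_eq_iff wick_star_def weighted_star_def wick_term_eq)

lemma geometric_weight: "norm ((2 * \<alpha>) ^ d) \<le> 1 * norm (2 * \<alpha>) ^ d" for \<alpha> :: complex
  by (simp only: norm_power mult_1 order_refl)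

lemma order_one_wick_star: "order_one f \<Longrightarrow> order_one g \<Longrightarrow> order_one (wick_star \<alpha> f g)"
  unfolding wick_star_eq by (rule order_one_weighted_star [OF _ _ geometric_weight]) auto

lemma jet_wick_star:
  "order_one f \<Longrightarrow> order_one g \<Longrightarrow> jet (wick_star \<alpha> f g) x = star_coeff (\<lambda>d. (2 * \<alpha>) ^ d) (jet f x) (jet g x)"
  unfolding wick_star_eq by (rule jet_weighted_star [OF _ _ geometric_weight]) auto

lemma wick_term_has_sum:
  "order_one f \<Longrightarrow> order_one g \<Longrightarrow> (wick_term \<alpha> f g x has_sum wick_star \<alpha> f g x) UNIV"
  unfolding wick_star_eq wick_term_eq by (rule weighted_term_has_sum [OF geometric_weight]) auto

text \<open>Since \<open>0 ^ 0 = 1\<close>, exactly the term N = 0 survives, and its iterated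
  derivatives are identities.\<close>

lemma wick_star_0: "wick_star 0 f g = (\<lambda>x. f x * g x)"
proof
  fix x
  have "mdegree N = 0 \<longleftrightarrow> N = 0" for N :: "nat ^ 'a"
    by (auto simp: mdegree_def vec_eq_iff)
  then have "(\<Sum>\<^sub>\<infinity>N\<in>UNIV. wick_term 0 f g x N) = (\<Sum>\<^sub>\<infinity>N\<in>{0}. wick_term 0 f g x N)"
    by (intro infsum_cong_neutral) (auto simp: wick_term_def power_0_left)
  moreover have "foldr (\<lambda>k. id) ks h = h" for ks :: "'a list" and h :: "complex ^ 'a \<Rightarrow> complex"
    by (induction ks) auto
  ultimately show "wick_star 0 f g x = f x * g x"
    by (simp add: wick_star_def wick_term_def mderiv_def)
qed

lemma sum_atMost_mpair:
  fixes F :: "nat ^ ('n::finite + 'n) \<Rightarrow> 'b::comm_monoid_add"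
  shows "sum F {..mpair N 0} = (\<Sum>K\<le>N. F (mpair K 0))" "sum F {..mpair 0 N} = (\<Sum>K\<le>N. F (mpair 0 K))"
proof -
  have le: "mpair R S \<le> mpair R' S' \<longleftrightarrow> R \<le> R' \<and> S \<le> S'" for R S R' S' :: "nat ^ 'n"
    by (auto simp: vec_le_iff mpair_def split: sum.split)
  have 0: "R \<le> 0 \<longleftrightarrow> R = 0" for R :: "nat ^ 'n" by (auto simp: vec_le_iff vec_eq_iff)
  have ex: "\<exists>R S. K = mpair R S" for K :: "nat ^ ('n + 'n)" by (metis parts_mpair(3))
  have "{..mpair N 0} = (\<lambda>K. mpair K 0) ` {..N}" "{..mpair 0 N} = mpair 0 ` {..N}"
  proof -
    have "K \<le> mpair N 0 \<longleftrightarrow> (\<exists>R\<le>N. K = mpair R 0)" "K \<le> mpair 0 N \<longleftrightarrow> (\<exists>R\<le>N. K = mpair 0 R)" for K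
      using ex [of K] le 0 by auto
    then show "{..mpair N 0} = (\<lambda>K. mpair K 0) ` {..N}" "{..mpair 0 N} = mpair 0 ` {..N}"
      by (auto simp: image_iff)
  qed
  moreover have "inj_on (\<lambda>K. mpair K 0) {..N}" "inj_on (mpair 0) {..N}"
    by (auto intro: inj_on_inverseI [where g = lpart] inj_on_inverseI [where g = rpart])
  ultimately show "sum F {..mpair N 0} = (\<Sum>K\<le>N. F (mpair K 0))" "sum F {..mpair 0 N} = (\<Sum>K\<le>N. F (mpair 0 K))"
    by (simp_all add: sum.reindex)
qed

lemma mbinom_mpair: "mbinom (mpair R S) (mpair R' S') = mbinom R R' * mbinom S S'"
  by (simp add: mbinom_def prod_UNIV_Plus)

lemma mpair_diff: "mpair R S - mpair R' S' = mpair (R - R') (S - S')"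
  by (auto simp: vec_eq_iff mpair_def split: sum.split)

text \<open>The outer product differentiates its left factor in z only and its right factor in the
  conjugate variables only, so associativity needs just these two kinds of derivatives of an inner
  product. All splittings then stay within the same block of variables.\<close>

lemma star_coeff_mpair:
  "star_coeff t a b (mpair N 0) = (\<Sum>K\<le>N. of_nat (mbinom N K) *
     (\<Sum>\<^sub>\<infinity>M\<in>UNIV. t (mdegree M) / of_nat (mfact M) * a (mpair (M + K) 0) * b (mpair (N - K) M)))"
  "star_coeff t a b (mpair 0 N) = (\<Sum>K\<le>N. of_nat (mbinom N K) *
     (\<Sum>\<^sub>\<infinity>M\<in>UNIV. t (mdegree M) / of_nat (mfact M) * a (mpair M K) * b (mpair 0 (M + (N - K)))))"
  by (simp_all add: star_coeff_def sum_atMost_mpair mbinom_mpair mpair_diff mpair_add)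

text \<open>
  Both bracketings of a triple product are, by Leibniz' rule, the sum over \<open>(K, L, M)\<close> of the terms
  \<open>P K L M\<close> below, up to a permutation of the three indices.
\<close>

lemma wick_star_assoc:
  fixes f g h :: "complex ^ 'n \<Rightarrow> complex"
  assumes f: "order_one f" and g: "order_one g" and h: "order_one h"
  shows "wick_star \<alpha> (wick_star \<alpha> f g) h = wick_star \<alpha> f (wick_star \<alpha> g h)"
proof
  fix x
  define \<tau> where "\<tau> = 2 * \<alpha>"
  let ?a = "jet f x" and ?b = "jet g x" and ?c = "jet h x"
  \<comment> \<open>The indices count contractions between pairs of factors: K between f and h, L
    between g and h, M between f and g.\<close>
  define P where "P K L M = \<tau> ^ (mdegree K + mdegree L + mdegree M) / of_nat (mfact K * mfact L * mfact M) *
      ?a (mpair (M + K) 0) * ?b (mpair L M) * ?c (mpair 0 (K + L))" for K L M :: "nat ^ 'n"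
  let ?V = "\<lambda>M :: nat ^ 'n. (4 * norm \<tau>) ^ mdegree M * rfact M powr (- 1 / 2)"
  have V: "?V summable_on UNIV" by (intro summable_root_weight) auto
  obtain A where A: "0 \<le> A" "\<And>N. norm (?a N) \<le> A * rfact N powr (1 / 4)"
    using f subfactorialE [of ?a "1 / 4"] by (auto simp: order_one_def)
  obtain B where B: "0 \<le> B" "\<And>N. norm (?b N) \<le> B * rfact N powr (1 / 4)"
    using g subfactorialE [of ?b "1 / 4"] by (auto simp: order_one_def)
  obtain C where C: "0 \<le> C" "\<And>N. norm (?c N) \<le> C * rfact N powr (1 / 4)"
    using h subfactorialE [of ?c "1 / 4"] by (auto simp: order_one_def)
  have bound: "norm (P K L M) \<le> A * B * C * ((?V K * ?V L) * ?V M)" for K L M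
  proof -
    define k l m where "k = rfact K" and "l = rfact L" and "m = rfact M"
    have pos: "0 < k" "0 < l" "0 < m" by (auto simp: k_def l_def m_def)
    have a: "norm (?a (mpair (M + K) 0)) \<le> A * (2 ^ (mdegree M + mdegree K) * (m powr (1 / 4) * k powr (1 / 4)))"
      using A mfact_add_powr_le [of "1 / 4" M K]
      by (intro order_trans [OF A(2)] mult_left_mono) (auto simp: k_def m_def)
    have c: "norm (?c (mpair 0 (K + L))) \<le> C * (2 ^ (mdegree K + mdegree L) * (k powr (1 / 4) * l powr (1 / 4)))"
      using C mfact_add_powr_le [of "1 / 4" K L]
      by (intro order_trans [OF C(2)] mult_left_mono) (auto simp: k_def l_def)
    have b: "norm (?b (mpair L M)) \<le> B * (2 ^ (mdegree L + mdegree M) * (l powr (1 / 4) * m powr (1 / 4)))"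
    proof -
      have "norm (?b (mpair L M)) \<le> B * (1 * (l powr (1 / 4) * m powr (1 / 4)))"
        using B(2) [of "mpair L M"] by (simp add: l_def m_def powr_mult)
      also have "\<dots> \<le> B * (2 ^ (mdegree L + mdegree M) * (l powr (1 / 4) * m powr (1 / 4)))"
        using B by (intro mult_left_mono mult_right_mono) auto
      finally show ?thesis .
    qed
    have half: "y powr (- 1 / 2) = y powr (1 / 4) * y powr (1 / 4) / y" if "0 < y" for y :: real
      using that powr_diff [of y "1 / 2" 1] by (simp add: powr_add [symmetric])
    have "norm (P K L M) = norm \<tau> ^ (mdegree K + mdegree L + mdegree M) / (k * l * m) *
        norm (?a (mpair (M + K) 0)) * norm (?b (mpair L M)) * norm (?c (mpair 0 (K + L)))"
      by (simp add: P_def norm_mult norm_divide norm_power k_def l_def m_def)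
    also have "\<dots> \<le> norm \<tau> ^ (mdegree K + mdegree L + mdegree M) / (k * l * m) *
        (A * (2 ^ (mdegree M + mdegree K) * (m powr (1 / 4) * k powr (1 / 4)))) *
        (B * (2 ^ (mdegree L + mdegree M) * (l powr (1 / 4) * m powr (1 / 4)))) *
        (C * (2 ^ (mdegree K + mdegree L) * (k powr (1 / 4) * l powr (1 / 4))))"
      using a b c pos A B C by (intro mult_mono) auto
    also have "\<dots> = A * B * C * ((((4 * norm \<tau>) ^ mdegree K * (k powr (1 / 4) * k powr (1 / 4) / k)) *
        ((4 * norm \<tau>) ^ mdegree L * (l powr (1 / 4) * l powr (1 / 4) / l))) *
        ((4 * norm \<tau>) ^ mdegree M * (m powr (1 / 4) * m powr (1 / 4) / m)))"
    proof -
      have "(4::real) ^ d = 2 ^ d * 2 ^ d" for d by (simp flip: power_mult_distrib)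
      then show ?thesis by (simp add: power_add power_mult_distrib mult_ac)
    qed
    finally show ?thesis
      unfolding half [OF pos(1), symmetric] half [OF pos(2), symmetric] half [OF pos(3), symmetric]
      by (simp only: k_def l_def m_def)
  qed
  have "(\<lambda>((K, L), M). (?V K * ?V L) * ?V M) summable_on UNIV"
    using summable_on_times [OF summable_on_times [OF V V] V] by (simp add: case_prod_unfold)
  from summable_on_cmult_right [OF this, of "A * B * C"]
  have "(\<lambda>p. norm ((\<lambda>((K, L), M). P K L M) p)) summable_on UNIV"
    by (rule summable_on_comparison_test) (use bound in \<open>auto simp: case_prod_unfold\<close>)
  then have "(\<lambda>((K, L), M). P K L M) summable_on UNIV" by (rule abs_summable_summable)
  then obtain S where S: "((\<lambda>((K, L), M). P K L M) has_sum S) UNIV"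
    by (auto simp: summable_on_def)
  \<comment> \<open>In the right bracketing the outer index counts all contractions of f, split
    between g and h, so the three indices appear cyclically permuted.\<close>
  have S': "((\<lambda>((K, L), M). P L M K) has_sum S) UNIV"
    using S by (subst has_sum_reindex_bij_witness [where j = "\<lambda>((K, L), M). ((L, M), K)"
        and i = "\<lambda>((L, M), K). ((K, L), M)" and T = UNIV and h = "\<lambda>((K, L), M). P K L M" and s' = S]) auto
  have binom: "of_nat (mbinom (K + L) K) / of_nat (mfact (K + L)) = 1 / (of_nat (mfact K) * of_nat (mfact L) :: complex)"
    for K L :: "nat ^ 'n"
  proof -
    have "complex_of_real (real (mbinom (K + L) K) * (mfact K * mfact L)) = of_real (rfact (K + L))"
      by (simp only: mbinom_eq)
    then show ?thesis by (simp add: field_simps)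
  qed
  have left: "wick_term \<alpha> (wick_star \<alpha> f g) h x N = (\<Sum>K\<le>N. \<Sum>\<^sub>\<infinity>M. P K (N - K) M)" for N
  proof -
    have "wick_term \<alpha> (wick_star \<alpha> f g) h x N =
        (\<Sum>K\<le>N. \<tau> ^ mdegree N * (of_nat (mbinom N K) / of_nat (mfact N)) * ?c (mpair 0 N) *
          (\<Sum>\<^sub>\<infinity>M. \<tau> ^ mdegree M / of_nat (mfact M) * ?a (mpair (M + K) 0) * ?b (mpair (N - K) M)))"
      unfolding wick_term_def jet_mpair [symmetric] jet_wick_star [OF f g] star_coeff_mpair \<tau>_def [symmetric]
        sum_distrib_left sum_distrib_right
      by (intro sum.cong refl) (simp add: mult_ac)
    also have "\<dots> = (\<Sum>K\<le>N. \<Sum>\<^sub>\<infinity>M. P K (N - K) M)"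
    proof (intro sum.cong refl)
      fix K assume "K \<in> {..N}"
      then obtain L where N: "N = K + L" using vec_le_sum_multiindex by auto
      show "\<tau> ^ mdegree N * (of_nat (mbinom N K) / of_nat (mfact N)) * ?c (mpair 0 N) *
          (\<Sum>\<^sub>\<infinity>M. \<tau> ^ mdegree M / of_nat (mfact M) * ?a (mpair (M + K) 0) * ?b (mpair (N - K) M))
          = (\<Sum>\<^sub>\<infinity>M. P K (N - K) M)"
        unfolding N binom infsum_cmult_right' [symmetric]
        by (intro infsum_cong) (simp add: P_def power_add mult_ac)
    qed
    finally show ?thesis .
  qed
  have right: "wick_term \<alpha> f (wick_star \<alpha> g h) x N = (\<Sum>K\<le>N. \<Sum>\<^sub>\<infinity>M. P (N - K) M K)" for N
  proof -
    have "wick_term \<alpha> f (wick_star \<alpha> g h) x N =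
        (\<Sum>K\<le>N. \<tau> ^ mdegree N * (of_nat (mbinom N K) / of_nat (mfact N)) * ?a (mpair N 0) *
          (\<Sum>\<^sub>\<infinity>M. \<tau> ^ mdegree M / of_nat (mfact M) * ?b (mpair M K) * ?c (mpair 0 (M + (N - K)))))"
      unfolding wick_term_def jet_mpair [symmetric] jet_wick_star [OF g h] star_coeff_mpair \<tau>_def [symmetric]
        sum_distrib_left sum_distrib_right
      by (intro sum.cong refl) (simp add: mult_ac)
    also have "\<dots> = (\<Sum>K\<le>N. \<Sum>\<^sub>\<infinity>M. P (N - K) M K)"
    proof (intro sum.cong refl)
      fix K assume "K \<in> {..N}"
      then obtain L where N: "N = K + L" using vec_le_sum_multiindex by auto
      show "\<tau> ^ mdegree N * (of_nat (mbinom N K) / of_nat (mfact N)) * ?a (mpair N 0) *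
          (\<Sum>\<^sub>\<infinity>M. \<tau> ^ mdegree M / of_nat (mfact M) * ?b (mpair M K) * ?c (mpair 0 (M + (N - K))))
          = (\<Sum>\<^sub>\<infinity>M. P (N - K) M K)"
        unfolding N binom infsum_cmult_right' [symmetric]
        by (intro infsum_cong) (simp add: P_def power_add mult_ac add_ac)
    qed
    finally show ?thesis .
  qed
  have "(wick_term \<alpha> (wick_star \<alpha> f g) h x has_sum S) UNIV"
    using has_sum_antidiagonal_inner [OF S] unfolding left [symmetric] .
  moreover have "(wick_term \<alpha> f (wick_star \<alpha> g h) x has_sum S) UNIV"
    using has_sum_antidiagonal_inner [OF S'] unfolding right [symmetric] .
  ultimately show "wick_star \<alpha> (wick_star \<alpha> f g) h x = wick_star \<alpha> f (wick_star \<alpha> g h) x"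
    unfolding wick_star_def [of _ "wick_star \<alpha> f g"] wick_star_def [of _ f "wick_star \<alpha> g h"]
    by (simp add: infsumI)
qed

section \<open>The holomorphic deformation\<close>

lemma wick_algebra_simps:
  "mult (wick_algebra p hbar) f g = (\<lambda>x. f x * g x)" "one (wick_algebra p hbar) = (\<lambda>x. 1)"
  "zero (wick_algebra p hbar) = (\<lambda>x. 0)" "add (wick_algebra p hbar) f g = (\<lambda>x. f x + g x)"
  "smult (wick_algebra p hbar) c f = (\<lambda>x. c * f x)"
  by (simp_all add: wick_algebra_def)

lemma order_one_zero: "order_one (\<lambda>x. 0)"
  by (rule order_oneI [where p = 0 and a = "\<lambda>_. 0"]) (auto simp: entire_expansion_def subfactorial_def)

lemma order_one_add: "order_one f \<Longrightarrow> order_one g \<Longrightarrow> order_one (\<lambda>x. f x + g x)"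
  using order_one_lincomb [of f g 1 1] by simp

lemma order_one_cmult: "order_one f \<Longrightarrow> order_one (\<lambda>x. c * f x)"
  using order_one_lincomb [of f f c 0] by simp

context
  fixes p :: "complex ^ 'n" and hbar :: real
  assumes hbar: "0 < hbar"
begin

abbreviation (input) "\<A> \<equiv> wick_algebra p hbar"
abbreviation (input) "\<Q> \<equiv> wick_seminorm p hbar"

section \<open>The Frechet space underlying the Wick algebra\<close>

lemma module_wick_algebra: "module complex_ring \<A>"
proof (rule moduleI)
  show "abelian_group \<A>"
  proof (rule abelian_groupI)
    fix f assume "f \<in> carrier \<A>"
    then have "order_one (\<lambda>x. (-1) * f x)"
      by (intro order_one_cmult) (simp add: carrier_wick_algebra [OF hbar])
    then show "\<exists>g\<in>carrier \<A>. g \<oplus>\<^bsub>\<A>\<^esub> f = \<zero>\<^bsub>\<A>\<^esub>"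
      by (intro bexI [of _ "\<lambda>x. (-1) * f x"]) (auto simp: carrier_wick_algebra [OF hbar] wick_algebra_simps)
  qed (auto simp: carrier_wick_algebra [OF hbar] wick_algebra_simps order_one_add order_one_zero add_ac)
qed (auto simp: cring_complex_ring carrier_wick_algebra [OF hbar] wick_algebra_simps order_one_cmult algebra_simps)

lemma seminormed_space_wick_algebra:
  "seminormed_space \<A> wick_indices \<Q>"
proof (intro seminormed_space.intro seminormed_space_axioms.intro module_wick_algebra)
  fix i :: "'n wick_index" and f g c
  assume i: "i \<in> wick_indices" and f: "f \<in> carrier \<A>"
  then have f': "f \<in> wick_functions p hbar" by (simp add: wick_algebra_def)
  then show "\<Q> i (c \<odot>\<^bsub>\<A>\<^esub> f) = norm c * \<Q> i f"
    unfolding wick_algebra_simps by (intro wick_seminorm_cmult hbar wick_functions_smooth)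
  assume "g \<in> carrier \<A>"
  then have "g \<in> wick_functions p hbar" by (simp add: wick_algebra_def)
  then show "\<Q> i (f \<oplus>\<^bsub>\<A>\<^esub> g) \<le> \<Q> i f + \<Q> i g"
    unfolding wick_algebra_simps by (intro wick_seminorm_add f' hbar i)
qed

interpretation W: seminormed_space "\<A>" wick_indices "\<Q>"
  by (rule seminormed_space_wick_algebra)

lemma wick_algebra_minus:
  assumes "order_one f" "order_one g"
  shows "f \<ominus>\<^bsub>\<A>\<^esub> g = (\<lambda>x. f x - g x)"
  using assms by (subst W.minus_eq_smult) (auto simp: carrier_wick_algebra [OF hbar] wick_algebra_simps)

lemma order_one_diff: "order_one f \<Longrightarrow> order_one g \<Longrightarrow> order_one (\<lambda>x. f x - g x)"
  using order_one_lincomb [of f g 1 "-1"] by simp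

lemma jet_diff_order_one:
  assumes "order_one f" "order_one g"
  shows "jet (\<lambda>x. f x - g x) p N = jet f p N - jet g p N"
  using jet_diff [OF order_one_expands [OF assms(1), of p 1] order_one_expands [OF assms(2), of p 1]] by simp

lemma order_one_eqI:
  assumes f: "order_one f" and g: "order_one g" and "jet f p = jet g p"
  shows "f = g"
proof
  fix x
  have "((\<lambda>N. jet f p N * divpow (dbl (x - p)) N) has_sum f x) UNIV"
       "((\<lambda>N. jet f p N * divpow (dbl (x - p)) N) has_sum g x) UNIV"
    using expandsD [OF order_one_expands [OF f], of "x - p" "norm (x - p) + 1" p]
      expandsD [OF order_one_expands [OF g], of "x - p" "norm (x - p) + 1" p] assms(3) by simp_all
  then show "f x = g x" by (rule has_sum_unique)
qed

text \<open>Being Cauchy in all seminorms means that the jets at p are Cauchy uniformly in N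
  relative to (N!)^e, for every e > 0. The coefficientwise limit is again subfactorial and so is the
  jet of an element, to which the sequence converges because jet bounds control the
  seminorms.\<close>

lemma wick_algebra_complete:
  assumes s: "\<And>j :: nat. order_one (s j)"
    and Cauchy: "\<And>i e. i \<in> wick_indices \<Longrightarrow> 0 < e \<Longrightarrow>
      \<exists>N. \<forall>j\<ge>N. \<forall>k\<ge>N. \<Q> i (\<lambda>x. s j x - s k x) < e"
  obtains f where "order_one f"
    "\<And>i. i \<in> wick_indices \<Longrightarrow> (\<lambda>j. \<Q> i (\<lambda>x. s j x - f x)) \<longlonglongrightarrow> 0"
proof -
  have unif: "\<exists>n0. \<forall>j\<ge>n0. \<forall>k\<ge>n0. \<forall>N. norm (jet (s j) p N - jet (s k) p N) \<le> d * rfact N powr e"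
    if "0 < e" "0 < d" for e d
  proof -
    obtain i C where i: "i \<in> wick_indices" and C: "0 < C"
      and jb: "\<And>f. f \<in> wick_functions p hbar \<Longrightarrow> jet_bound p f (C * \<Q> i f) e"
      using jet_bound_wick_seminorm [OF hbar \<open>0 < e\<close>] by metis
    obtain n0 where n0: "\<And>j k. j \<ge> n0 \<Longrightarrow> k \<ge> n0 \<Longrightarrow> \<Q> i (\<lambda>x. s j x - s k x) < d / C"
      using Cauchy [OF i, of "d / C"] C \<open>0 < d\<close> by auto
    have "norm (jet (s j) p N - jet (s k) p N) \<le> d * rfact N powr e" if "j \<ge> n0" "k \<ge> n0" for j k N
    proof -
      have "norm (jet (\<lambda>x. s j x - s k x) p N) \<le> C * \<Q> i (\<lambda>x. s j x - s k x) * rfact N powr e"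
        using jb [OF order_one_wick_functions [OF hbar order_one_diff [OF s s]], of j k]
        by (simp add: jet_bound_def)
      also have "\<dots> \<le> C * (d / C) * rfact N powr e"
        using C n0 [OF that] by (intro mult_right_mono mult_left_mono) auto
      finally show ?thesis using C by (simp add: jet_diff_order_one [OF s s])
    qed
    then show ?thesis by blast
  qed
  have "convergent (\<lambda>j. jet (s j) p N)" for N
  proof (rule Cauchy_convergent, rule metric_CauchyI)
    fix e :: real assume "0 < e"
    define d where "d = e / (2 * rfact N powr 1)"
    have "0 < d" using \<open>0 < e\<close> by (simp add: d_def)
    obtain n0 where "\<And>j k. j \<ge> n0 \<Longrightarrow> k \<ge> n0 \<Longrightarrow> norm (jet (s j) p N - jet (s k) p N) \<le> d * rfact N powr 1"
      using unif [of 1 d] \<open>0 < d\<close> by auto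
    moreover have "d * rfact N powr 1 < e" using \<open>0 < e\<close> by (simp add: d_def)
    ultimately show "\<exists>M. \<forall>m\<ge>M. \<forall>n\<ge>M. dist (jet (s m) p N) (jet (s n) p N) < e"
      unfolding dist_norm by (meson le_less_trans)
  qed
  then obtain a where a: "\<And>N. (\<lambda>j. jet (s j) p N) \<longlonglongrightarrow> a N"
    unfolding convergent_def by metis
  have lim: "\<exists>n0. \<forall>j\<ge>n0. \<forall>N. norm (jet (s j) p N - a N) \<le> d * rfact N powr e" if ed: "0 < e" "0 < d" for e d
  proof -
    obtain n0 where n0: "\<And>j k N. j \<ge> n0 \<Longrightarrow> k \<ge> n0 \<Longrightarrow> norm (jet (s j) p N - jet (s k) p N) \<le> d * rfact N powr e"
      using unif [OF ed] by blast
    have "norm (jet (s j) p N - a N) \<le> d * rfact N powr e" if "j \<ge> n0" for j N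
    proof (rule LIMSEQ_le_const2)
      show "(\<lambda>k. norm (jet (s j) p N - jet (s k) p N)) \<longlonglongrightarrow> norm (jet (s j) p N - a N)"
        by (intro tendsto_intros a)
      show "\<exists>M. \<forall>k\<ge>M. norm (jet (s j) p N - jet (s k) p N) \<le> d * rfact N powr e"
        using n0 [OF that] by blast
    qed
    then show ?thesis by blast
  qed
  \<comment> \<open>One member of the sequence, within weighted distance 1 of a, passes its growth
    on to the limit.\<close>
  have sub: "subfactorial a"
    unfolding subfactorial_def
  proof (intro allI impI)
    fix e :: real assume "0 < e"
    obtain j where j: "\<And>N. norm (jet (s j) p N - a N) \<le> 1 * rfact N powr e"
      using lim [OF \<open>0 < e\<close>, of 1] by auto
    obtain A where A: "0 \<le> A" "\<And>N. norm (jet (s j) p N) \<le> A * rfact N powr e"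
      using s [of j] subfactorialE [OF _ \<open>0 < e\<close>] unfolding order_one_def by metis
    have "norm (a N) \<le> (A + 1) * rfact N powr e" for N
      using norm_triangle_ineq4 [of "jet (s j) p N" "jet (s j) p N - a N"] j [of N] A(2) [of N]
      by (simp add: algebra_simps)
    then show "\<exists>A\<ge>0. \<forall>N. norm (a N) \<le> A * rfact N powr e"
      using A(1) by (intro exI [of _ "A + 1"]) auto
  qed
  define f where "f = (\<lambda>x. recentre a (x - p) 0)"
  have exp: "entire_expansion f a p" unfolding f_def by (rule subfactorial_entire_expansion [OF sub])
  have f: "order_one f" by (rule order_oneI [OF exp sub])
  have jet_f: "jet f p = a" by (rule entire_expansion_jet [OF exp])
  have "(\<lambda>j. \<Q> i (\<lambda>x. s j x - f x)) \<longlonglongrightarrow> 0" if i: "i \<in> wick_indices" for i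
  proof (rule LIMSEQ_I)
    fix r :: real assume "0 < r"
    obtain e C where e: "0 < e" "0 < C"
      and sem: "\<And>f A. 0 \<le> A \<Longrightarrow> jet_bound p f A e \<Longrightarrow> \<Q> i f \<le> C * A"
      using wick_seminorm_le_jet_bound [OF hbar i] by metis
    define d where "d = r / (2 * C)"
    have d: "0 < d" "C * d < r" using e \<open>0 < r\<close> by (auto simp: d_def)
    obtain n0 where n0: "\<And>j N. j \<ge> n0 \<Longrightarrow> norm (jet (s j) p N - a N) \<le> d * rfact N powr e"
      using lim [OF e(1) d(1)] by blast
    have "norm (\<Q> i (\<lambda>x. s j x - f x) - 0) < r" if "j \<ge> n0" for j
    proof -
      have "jet_bound p (\<lambda>x. s j x - f x) d e"
        using n0 [OF that] by (simp add: jet_bound_def jet_diff_order_one [OF s f] jet_f)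
      then have "\<Q> i (\<lambda>x. s j x - f x) \<le> C * d" using d by (intro sem) auto
      moreover have "0 \<le> \<Q> i (\<lambda>x. s j x - f x)"
        by (simp add: wick_seminorm_def split: prod.split)
      ultimately show ?thesis using d by simp
    qed
    then show "\<exists>no. \<forall>n\<ge>no. norm (\<Q> i (\<lambda>x. s n x - f x) - 0) < r" by blast
  qed
  with f show thesis by (rule that)
qed

lemma frechet_space_wick_algebra:
  "frechet_space \<A> wick_indices \<Q>"
proof (intro frechet_space.intro frechet_space_axioms.intro seminormed_space_wick_algebra)
  show "countable (wick_indices :: 'n wick_index set)" by (rule countable_subset [OF subset_UNIV]) simp
next
  fix f assume "f \<in> carrier \<A>" and 0: "\<forall>i\<in>wick_indices. \<Q> i f = 0"
  then have f: "order_one f" by (simp add: carrier_wick_algebra [OF hbar])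
  \<comment> \<open>One seminorm already separates points: if it vanishes, the jet bound forces the
    whole jet at p to be zero.\<close>
  obtain i C where i: "i \<in> wick_indices" and "jet_bound p f (C * \<Q> i f) 1"
    using jet_bound_wick_seminorm [OF hbar, of 1] order_one_wick_functions [OF hbar f] by (metis zero_less_one)
  then have "jet f p = (\<lambda>_. 0)" using 0 by (auto simp: jet_bound_def)
  moreover have "jet (\<lambda>x. 0) p = (\<lambda>_. 0)"
    by (rule entire_expansion_jet) (simp add: entire_expansion_def)
  ultimately have "f = (\<lambda>x. 0)" by (intro order_one_eqI f order_one_zero) simp
  then show "f = \<zero>\<^bsub>\<A>\<^esub>" by (simp add: wick_algebra_simps)
next
  fix s :: "nat \<Rightarrow> complex ^ 'n \<Rightarrow> complex"
  assume "range s \<subseteq> carrier \<A>"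
    and *: "\<forall>i\<in>wick_indices. \<forall>e>0. \<exists>N. \<forall>j\<ge>N. \<forall>k\<ge>N. \<Q> i (s j \<ominus>\<^bsub>\<A>\<^esub> s k) < e"
  then have s: "order_one (s j)" for j by (auto simp: carrier_wick_algebra [OF hbar])
  have cauchy: "\<exists>N. \<forall>j\<ge>N. \<forall>k\<ge>N. \<Q> i (\<lambda>x. s j x - s k x) < e"
    if "i \<in> wick_indices" "0 < e" for i e
    using * that unfolding wick_algebra_minus [OF s s] by blast
  obtain f where f: "order_one f"
    and lim: "\<And>i. i \<in> wick_indices \<Longrightarrow> (\<lambda>j. \<Q> i (\<lambda>x. s j x - f x)) \<longlonglongrightarrow> 0"
    using wick_algebra_complete [OF s cauchy] by blast
  then show "\<exists>f. limitin (seminorm_topology \<A> wick_indices \<Q>) s f sequentially"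
    unfolding W.limitin_seminorm_topology
    by (intro exI [of _ f]) (auto simp: carrier_wick_algebra [OF hbar] s wick_algebra_minus)
qed

text \<open>The derivative in \<open>\<alpha>\<close> is obtained by differentiating the weights \<open>(2 \<alpha>)^d\<close>.\<close>

lemma wick_star_entire:
  assumes f: "order_one f" and g: "order_one g"
  shows "(\<lambda>\<alpha>. wick_star \<alpha> f g) \<in> entire_functions \<A> wick_indices \<Q>"
  unfolding entire_functions_def mem_Collect_eq
proof (intro conjI allI)
  show "range (\<lambda>\<alpha>. wick_star \<alpha> f g) \<subseteq> carrier \<A>"
    using order_one_wick_star [OF f g] by (auto simp: carrier_wick_algebra [OF hbar])
  fix \<alpha> :: complex
  \<comment> \<open>K bounds both z and z + 2 h for \<open>norm h \<le> 1\<close>, and it is at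
    least 1, so that its powers increase.\<close>
  define K where "K = 2 * norm \<alpha> + 2"
  define z where "z = 2 * \<alpha>"
  \<comment> \<open>The derivative of \<open>(2 * \<alpha>) ^ d\<close>. For d = 0 the truncated
    exponent is harmless, since the factor \<open>of_nat d\<close> vanishes.\<close>
  define t where "t d = 2 * (of_nat d * z ^ (d - Suc 0))" for d
  define s where "s h d = inverse h * ((2 * (\<alpha> + h)) ^ d - z ^ d) - t d" for h :: complex and d
  have K: "1 \<le> K" "norm z \<le> K" by (auto simp: K_def z_def norm_mult)
  have two: "real n \<le> 2 ^ n" for n by (simp add: less_imp_le)
  have t: "norm (t d) \<le> 2 * (2 * K) ^ d" for d
  proof -
    have "norm z ^ (d - Suc 0) \<le> K ^ (d - Suc 0)" using K by (intro power_mono) auto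
    also have "\<dots> \<le> K ^ d" using K by (intro power_increasing) auto
    finally have "real d * norm z ^ (d - Suc 0) \<le> 2 ^ d * K ^ d" using two by (intro mult_mono) auto
    then show ?thesis by (simp add: t_def norm_mult norm_power power_mult_distrib)
  qed
  \<comment> \<open>The second-order remainder of a d-th power carries the factor d (d - 1), which
    is absorbed into \<open>4 ^ d\<close>. What remains is a geometric weight whose ratio
    \<open>4 * K\<close> is free of h and whose constant is proportional to |h|.\<close>
  have sh: "norm (s h d) \<le> (4 * norm h) * (4 * K) ^ d" if h: "h \<noteq> 0" "norm h \<le> 1" for h d
  proof -
    have "norm (z + 2 * h) \<le> norm z + norm (2 * h)" by (rule norm_triangle_ineq)
    also have "\<dots> \<le> K" using h by (simp add: z_def K_def norm_mult)
    finally have "norm (((z + 2 * h) ^ d - z ^ d) / (2 * h) - of_nat d * z ^ (d - Suc 0))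
        \<le> real d * real (d - Suc 0) * K ^ (d - 2) * norm (2 * h)"
      using h K by (intro lemma_termdiff3) auto
    also have "\<dots> \<le> 2 ^ d * 2 ^ d * K ^ d * norm (2 * h)"
    proof -
      have "real (d - Suc 0) \<le> 2 ^ d" using two [of d] by linarith
      moreover have "K ^ (d - 2) \<le> K ^ d" using K by (intro power_increasing) auto
      ultimately show ?thesis using two [of d] K by (intro mult_right_mono mult_mono) auto
    qed
    also have "\<dots> = 2 * norm h * (4 * K) ^ d"
    proof -
      have "(4::real) ^ d = 2 ^ d * 2 ^ d" by (simp flip: power_mult_distrib)
      then show ?thesis by (simp add: norm_mult power_mult_distrib)
    qed
    finally have "2 * norm (((z + 2 * h) ^ d - z ^ d) / (2 * h) - of_nat d * z ^ (d - Suc 0))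
        \<le> (4 * norm h) * (4 * K) ^ d" by (simp add: mult_ac)
    moreover have "s h d = 2 * (((z + 2 * h) ^ d - z ^ d) / (2 * h) - of_nat d * z ^ (d - Suc 0))"
      using h by (simp add: s_def t_def z_def field_simps)
    ultimately show ?thesis by (simp only: norm_mult norm_numeral)
  qed
  let ?q = "\<lambda>h. inverse h \<odot>\<^bsub>\<A>\<^esub> (wick_star (\<alpha> + h) f g \<ominus>\<^bsub>\<A>\<^esub> wick_star \<alpha> f g)"
  let ?d = "weighted_star t f g"
  have d: "order_one ?d" using K by (intro order_one_weighted_star [OF f g t]) auto
  have q: "order_one (?q h)" for h
    unfolding wick_algebra_minus [OF order_one_wick_star order_one_wick_star, OF f g f g] wick_algebra_simps
    by (intro order_one_cmult order_one_diff order_one_wick_star f g)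
  have q_eq: "?q h \<ominus>\<^bsub>\<A>\<^esub> ?d = weighted_star (s h) f g" for h
  proof -
    have 1: "weighted_star (\<lambda>k. 1 * (2 * (\<alpha> + h)) ^ k + (-1) * (2 * \<alpha>) ^ k) f g
        = (\<lambda>x. 1 * wick_star (\<alpha> + h) f g x + (-1) * wick_star \<alpha> f g x)"
      unfolding wick_star_eq
      by (rule weighted_star_lincomb_weight [OF f g geometric_weight geometric_weight]) auto
    \<comment> \<open>A bound that depends on h is enough here, since it only ensures convergence of
      the series being combined; the uniform estimate is \<open>sh\<close>.\<close>
    have 2: "norm (1 * (2 * (\<alpha> + h)) ^ k + (-1) * (2 * \<alpha>) ^ k) \<le> 2 * (norm (2 * (\<alpha> + h)) + norm (2 * \<alpha>)) ^ k" for k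
    proof -
      have "norm (1 * (2 * (\<alpha> + h)) ^ k + (-1) * (2 * \<alpha>) ^ k) \<le> norm (2 * (\<alpha> + h)) ^ k + norm (2 * \<alpha>) ^ k"
        by (rule norm_triangle_le) (simp add: norm_power norm_mult)
      also have "\<dots> \<le> (norm (2 * (\<alpha> + h)) + norm (2 * \<alpha>)) ^ k + (norm (2 * (\<alpha> + h)) + norm (2 * \<alpha>)) ^ k"
        by (intro add_mono power_mono) auto
      finally show ?thesis by simp
    qed
    have 3: "weighted_star (\<lambda>k. inverse h * (1 * (2 * (\<alpha> + h)) ^ k + (-1) * (2 * \<alpha>) ^ k) + (-1) * t k) f g
        = (\<lambda>x. inverse h * weighted_star (\<lambda>k. 1 * (2 * (\<alpha> + h)) ^ k + (-1) * (2 * \<alpha>) ^ k) f g x + (-1) * ?d x)"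
      using K by (intro weighted_star_lincomb_weight [OF f g 2 t]) auto
    have 4: "(\<lambda>k. inverse h * (1 * (2 * (\<alpha> + h)) ^ k + (-1) * (2 * \<alpha>) ^ k) + (-1) * t k) = s h"
      by (simp add: s_def z_def fun_eq_iff)
    show ?thesis
      unfolding wick_algebra_minus [OF q d]
      unfolding wick_algebra_minus [OF order_one_wick_star order_one_wick_star, OF f g f g] wick_algebra_simps
      using 3 [unfolded 1 4] by simp
  qed
  have "((\<lambda>h. \<Q> i (?q h \<ominus>\<^bsub>\<A>\<^esub> ?d)) \<longlongrightarrow> 0) (at 0)"
    if i: "i \<in> wick_indices" for i
  proof -
    have nn: "0 \<le> 4 * K" using K by simp
    \<comment> \<open>The ratio \<open>4 * K\<close> does not involve h, so j and C are fixed once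
      and h enters only through the constant \<open>4 * norm h\<close> of the weight.\<close>
    obtain j C where C: "\<forall>t T f g. 0 \<le> T \<longrightarrow> (\<forall>d. norm (t d) \<le> T * (4 * K) ^ d) \<longrightarrow> order_one f \<longrightarrow> order_one g \<longrightarrow>
       \<Q> i (weighted_star t f g) \<le> C * T * \<Q> j f * \<Q> j g"
      using wick_seminorm_weighted_star [where p = p, OF hbar i nn] by blast
    show ?thesis
    proof (rule tendsto_sandwich)
      show "\<forall>\<^sub>F h in at 0. 0 \<le> \<Q> i (?q h \<ominus>\<^bsub>\<A>\<^esub> ?d)"
        by (simp add: wick_seminorm_def split: prod.split)
      have "\<forall>\<^sub>F h :: complex in at 0. h \<noteq> 0 \<and> norm h \<le> 1"
        unfolding eventually_at by (intro exI [of _ 1]) auto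
      then show "\<forall>\<^sub>F h in at 0. \<Q> i (?q h \<ominus>\<^bsub>\<A>\<^esub> ?d)
          \<le> C * (4 * norm h) * \<Q> j f * \<Q> j g"
        by eventually_elim (unfold q_eq, intro C [rule_format] sh f g, auto)
      have "((\<lambda>h :: complex. C * (4 * norm h) * \<Q> j f * \<Q> j g)
          \<longlongrightarrow> C * (4 * norm (0 :: complex)) * \<Q> j f * \<Q> j g) (at 0)"
        by (intro tendsto_intros)
      then show "((\<lambda>h :: complex. C * (4 * norm h) * \<Q> j f * \<Q> j g) \<longlongrightarrow> 0) (at 0)"
        by simp
    qed auto
  qed
  then show "\<exists>d. limitin (seminorm_topology \<A> wick_indices \<Q>) ?q d (at 0)"
    unfolding W.limitin_seminorm_topology using q d
    by (intro exI [of _ ?d]) (auto simp: carrier_wick_algebra [OF hbar])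
qed

lemma holomorphic_deformation_wick_star:
  "holomorphic_deformation \<A> wick_indices \<Q> wick_star"
proof (rule frechet_space.holomorphic_deformationI [OF frechet_space_wick_algebra])
  note carrier = carrier_wick_algebra [OF hbar, of p]
  have lin: "wick_star \<alpha> (\<lambda>x. c * f x + d * f' x) g = (\<lambda>x. c * wick_star \<alpha> f g x + d * wick_star \<alpha> f' g x)"
      "wick_star \<alpha> g (\<lambda>x. c * f x + d * f' x) = (\<lambda>x. c * wick_star \<alpha> g f x + d * wick_star \<alpha> g f' x)"
    if "order_one f" "order_one f'" "order_one g" for \<alpha> c d and f f' g :: "complex ^ 'n \<Rightarrow> complex"
    unfolding wick_star_eq using that
    by (auto intro!: weighted_star_lincomb_left [OF geometric_weight] weighted_star_lincomb_right [OF geometric_weight])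
  show "bilinear_product \<A> (wick_star \<alpha>)" for \<alpha>
    unfolding bilinear_product_def carrier wick_algebra_simps
  proof (intro conjI ballI allI; unfold mem_Collect_eq)
    fix f g h :: "complex ^ 'n \<Rightarrow> complex" and c assume f: "order_one f" and g: "order_one g"
    show "order_one (wick_star \<alpha> f g)" by (rule order_one_wick_star [OF f g])
    show "wick_star \<alpha> (\<lambda>x. c * f x) g = (\<lambda>x. c * wick_star \<alpha> f g x)"
      using lin(1) [OF f f g, of \<alpha> c 0] by simp
    show "wick_star \<alpha> f (\<lambda>x. c * g x) = (\<lambda>x. c * wick_star \<alpha> f g x)"
      using lin(2) [OF g g f, of \<alpha> c 0] by simp
    assume h: "order_one h"
    show "wick_star \<alpha> (\<lambda>x. f x + g x) h = (\<lambda>x. wick_star \<alpha> f h x + wick_star \<alpha> g h x)"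
      using lin(1) [OF f g h, of \<alpha> 1 1] by simp
    show "wick_star \<alpha> h (\<lambda>x. f x + g x) = (\<lambda>x. wick_star \<alpha> h f x + wick_star \<alpha> h g x)"
      using lin(2) [OF f g h, of \<alpha> 1 1] by simp
  qed
  show "(\<lambda>\<alpha>. wick_star \<alpha> f g) \<in> entire_functions \<A> wick_indices \<Q>"
    if "f \<in> carrier \<A>" "g \<in> carrier \<A>" for f g
    using that by (intro wick_star_entire) (auto simp: carrier)
  show "associative_on (carrier \<A>) (wick_star \<alpha>)" for \<alpha>
    unfolding associative_on_def carrier by (auto intro: wick_star_assoc)
  show "wick_star 0 f g = f \<otimes>\<^bsub>\<A>\<^esub> g" for f g :: "complex ^ 'n \<Rightarrow> complex"
    by (simp add: wick_star_0 wick_algebra_simps)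
  fix i :: "'n wick_index" and \<rho> :: real assume i: "i \<in> wick_indices"
  \<comment> \<open>The radius \<rho> is an arbitrary real number, whereas the ratio of a geometric
    weight must be nonnegative.\<close>
  have nn: "0 \<le> 2 * max \<rho> 0" by simp
  obtain j C where j: "j \<in> wick_indices"
    and C: "\<forall>t T f g. 0 \<le> T \<longrightarrow> (\<forall>d. norm (t d) \<le> T * (2 * max \<rho> 0) ^ d) \<longrightarrow> order_one f \<longrightarrow> order_one g \<longrightarrow>
       \<Q> i (weighted_star t f g) \<le> C * T * \<Q> j f * \<Q> j g"
    using wick_seminorm_weighted_star [where p = p, OF hbar i nn] by blast
  have "\<Q> i (wick_star \<alpha> f g) \<le> C * \<Q> j f * \<Q> j g"
    if "norm \<alpha> \<le> \<rho>" "order_one f" "order_one g" for \<alpha> f g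
  proof -
    have "norm ((2 * \<alpha>) ^ d) \<le> 1 * (2 * max \<rho> 0) ^ d" for d
      unfolding norm_power norm_mult mult_1 using that by (intro power_mono) auto
    from C [rule_format, OF zero_le_one this that(2,3)] show ?thesis by (simp add: wick_star_eq)
  qed
  with j show "\<exists>j\<in>wick_indices. \<exists>C. \<forall>\<alpha> f g. norm \<alpha> \<le> \<rho> \<longrightarrow> f \<in> carrier \<A> \<longrightarrow>
      g \<in> carrier \<A> \<longrightarrow>
      \<Q> i (wick_star \<alpha> f g) \<le> C * \<Q> j f * \<Q> j g"
    by (intro bexI [of _ j] exI [of _ C]) (auto simp: carrier)
qed

section \<open>Jet classes and their real-analytic representatives\<close>

lemma jet_rel_iff:
  "(f, g) \<in> jet_rel p hbar \<longleftrightarrow> f \<in> wick_functions p hbar \<and> g \<in> wick_functions p hbar \<and> jet f p = jet g p"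
proof -
  have "(\<lambda>x. f x - g x) \<in> jet_vanishing p \<longleftrightarrow> jet f p = jet g p" if "smooth f" "smooth g"
  proof -
    have "smooth (\<lambda>x. f x - g x)" using smooth_lincomb [OF that, of 1 "-1"] by simp
    moreover have "mderiv R S (\<lambda>x. f x - g x) p = mderiv R S f p - mderiv R S g p" for R S
      using mderiv_lincomb [OF that, of R S 1 "-1" p] by simp
    ultimately show ?thesis
      unfolding jet_vanishing_def by (auto simp: fun_eq_iff jet_def) (metis parts_mpair(1,2))
  qed
  then show ?thesis by (auto simp: jet_rel_def dest: wick_functions_smooth)
qed

text \<open>The representative of the class of g is the sum of the Taylor series of g at p: it
  converges everywhere, although g itself need not be analytic, and has the same jet at p. It is the
  only one because the jet at p determines an element through its global expansion.\<close>

lemma bij_betw_jet_classes: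
  "bij_betw (\<lambda>f. jet_rel p hbar `` {f}) (carrier \<A>) (wick_functions p hbar // jet_rel p hbar)"
  unfolding bij_betw_def
proof
  note carrier = carrier_wick_algebra [OF hbar, of p]
  show "inj_on (\<lambda>f. jet_rel p hbar `` {f}) (carrier \<A>)"
  proof (rule inj_onI)
    fix f g assume fg: "f \<in> carrier \<A>" "g \<in> carrier \<A>"
      and eq: "jet_rel p hbar `` {f} = jet_rel p hbar `` {g}"
    have "order_one f" "order_one g" using fg by (auto simp: carrier)
    moreover have "g \<in> jet_rel p hbar `` {g}"
      using fg by (auto simp: jet_rel_iff wick_algebra_def)
    then have "(f, g) \<in> jet_rel p hbar" using eq by auto
    ultimately show "f = g" by (intro order_one_eqI) (auto simp: jet_rel_iff)
  qed
  show "(\<lambda>f. jet_rel p hbar `` {f}) ` carrier \<A> = wick_functions p hbar // jet_rel p hbar"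
  proof (intro equalityI subsetI)
    fix X assume "X \<in> (\<lambda>f. jet_rel p hbar `` {f}) ` carrier \<A>"
    then show "X \<in> wick_functions p hbar // jet_rel p hbar"
      by (auto simp: wick_algebra_def intro: quotientI)
  next
    fix X assume "X \<in> wick_functions p hbar // jet_rel p hbar"
    then obtain g where g: "g \<in> wick_functions p hbar" and X: "X = jet_rel p hbar `` {g}"
      by (auto elim: quotientE)
    let ?f = "\<lambda>x. recentre (jet g p) (x - p) 0"
    have sub: "subfactorial (jet g p)" by (rule wick_functions_subfactorial [OF hbar g])
    then have exp: "entire_expansion ?f (jet g p) p" by (rule subfactorial_entire_expansion)
    have f: "order_one ?f" by (rule order_oneI [OF exp sub])
    have "X = jet_rel p hbar `` {?f}"
      unfolding X using g order_one_wick_functions [OF hbar f] entire_expansion_jet [OF exp]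
      by (auto simp: jet_rel_iff)
    then show "X \<in> (\<lambda>f. jet_rel p hbar `` {f}) ` carrier \<A>"
      using f by (auto simp: carrier)
  qed
qed

end

text \<open>Since \<open>infsum\<close> is 0 by default on families that are not summable,
  convergence of the star series is asserted separately. The bijection confirms that passing from
  jet classes to analytic representatives loses and adds nothing.\<close>

theorem corollary4p6:
  fixes p :: "complex ^ 'n" and hbar :: real
  assumes "hbar > 0"
  shows "bij_betw (\<lambda>f. jet_rel p hbar `` {f})
           (carrier (wick_algebra p hbar)) (wick_functions p hbar // jet_rel p hbar)
       \<and> (\<forall>\<alpha>. \<forall>f\<in>carrier (wick_algebra p hbar). \<forall>g\<in>carrier (wick_algebra p hbar). \<forall>x.
            wick_term \<alpha> f g x summable_on UNIV)
       \<and> holomorphic_deformation (wick_algebra p hbar) wick_indices (wick_seminorm p hbar) wick_star"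
proof (intro conjI allI ballI)
  show "bij_betw (\<lambda>f. jet_rel p hbar `` {f})
           (carrier (wick_algebra p hbar)) (wick_functions p hbar // jet_rel p hbar)"
    by (rule bij_betw_jet_classes [OF assms])
  show "holomorphic_deformation (wick_algebra p hbar) wick_indices (wick_seminorm p hbar) wick_star"
    by (rule holomorphic_deformation_wick_star [OF assms])
  fix \<alpha> f g x assume "f \<in> carrier (wick_algebra p hbar)" "g \<in> carrier (wick_algebra p hbar)"
  then show "wick_term \<alpha> f g x summable_on UNIV"
    by (intro has_sum_imp_summable [OF wick_term_has_sum]) (auto simp: carrier_wick_algebra [OF assms])
qed

end
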